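(* Let $1\le q\le p\le\infty$. For each integer $n\ge2$ let $N=\sum_{k=1}^n2^k$ and let $\sigma^\star=(\lambda_1,\dots,\lambda_N)\in\mathbb{D}_*^N$ be the sequence (depending on $n$) defined in the context. There is a constant $c=c(p,q)>0$ such that for all $n\ge 2$ (with $1/\infty=0$): $$\prod_{i=1}^N|\lambda_i|\cdot\mathrm{cap}_{\mathcal{B}^0_{p,q}}(\sigma^\star)\ge c\,(\log N)^{1/q-1/p}\qquad\text{if } p<\infty,$$ $$\prod_{i=1}^N|\lambda_i|\cdot\mathrm{cap}_{\mathcal{B}^0_{\infty,q}}(\sigma^\star)\ge c\,\frac{(\log N)^{1/q}}{\log\log N}\qquad\text{if } p=\infty.$$ In particular, if $1\le q\le p<\infty$ and $p\ge2$, then there are constants $0<c\le C<\infty$ depending only on $p,q$ such that for all $n\ge2$ $$c\,(\log N)^{1/q-1/p}\le\prod_{i=1}^N|\lambda_i|\cdot\mathrm{cap}_{\mathcal{B}^0_{p,q}}(\sigma^\star)\le C\,(\log N)^{1/q-1/p}.$$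
   Context: $\mathbb{D}$ is the open unit disc in $\mathbb{C}$, $\mathbb{D}_*=\mathbb{D}\setminus\{0\}$, $\mathbb{T}$ is the unit circle with normalized Lebesgue measure. Besov spaces of zero smoothness: for $1\le p,q\le\infty$, $\mathcal{B}^0_{p,q}$ is the Banach space of analytic functions $f$ on $\mathbb{D}$ with $\|f\|_{\mathcal{B}^0_{p,q}}=|f(0)|+\|f\|^*_{\mathcal{B}^0_{p,q}}<\infty$, where, with $f'_\rho(\zeta)=f'(\rho\zeta)$ for $\zeta\in\mathbb{T}$, $$\|f\|^*_{\mathcal{B}^0_{p,q}}=\Big(\int_0^1(1-\rho)^{q-1}\|f'_\rho\|^q_{L^p(\mathbb{T})}\,d\rho\Big)^{1/q}\ (q<\infty),\qquad \|f\|^*_{\mathcal{B}^0_{p,\infty}}=\sup_{0<\rho<1}(1-\rho)\|f'_\rho\|_{L^p(\mathbb{T})}.$$ Capacity: for a Banach space $X$ of analytic functions on $\mathbb{D}$ and a finite sequence $\sigma=(\lambda_1,\dots,\lambda_N)\in\mathbb{D}_*^N$, $\mathrm{cap}_X(\sigma)=\inf\{\|f\|_X: f\in X,\ f(0)=1,\ f|\sigma=0\}$, where $f|\sigma=0$ means that $f$ vanishes at every point of $\sigma$ with multiplicity at least the number of times that point occurs in $\sigma$. The sequence $\sigma^\star$: for an integer $n\ge2$ and $k=1,\dots,n$ put $r_k^{(n)}=(1-1/n)^{2^{-k}}$ and $\sigma_k=(r_k^{(n)}e^{2\pi i j/2^k})_{j=1}^{2^k}\in\mathbb{D}_*^{2^k}$.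 Put $N=\sum_{k=1}^n 2^k$ and let $\sigma^\star=(\lambda_1,\dots,\lambda_N)\in\mathbb{D}_*^N$ be the concatenation $(\sigma_1,\sigma_2,\dots,\sigma_n)$. *)

theory Defs
  imports "HOL-Complex_Analysis.Complex_Analysis" "HOL-Probability.Essential_Supremum"
begin

text \<open>Exponents \<open>p, q \<in> [1, \<infinity>]\<close> and all norms take values in \<^typ>\<open>ennreal\<close>, so that divergent
  integrals, suprema and infima over the empty set are \<open>\<infinity>\<close>. The reciprocal \<open>1/p\<close> is
  \<open>enn2real (1 / p)\<close>, which is \<open>0\<close> for \<open>p = \<infinity>\<close>.\<close>

text \<open>Real powers on \<open>[0, \<infinity>]\<close>; only meant for exponents \<open>a > 0\<close>.\<close>

definition ennreal_powr :: "ennreal \<Rightarrow> real \<Rightarrow> ennreal" where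
  "ennreal_powr x a = (if x = \<infinity> then \<infinity> else ennreal (enn2real x powr a))"

definition Lp_norm :: "ennreal \<Rightarrow> 'a measure \<Rightarrow> ('a \<Rightarrow> complex) \<Rightarrow> ennreal" where
  "Lp_norm p M g =
    (if p = \<infinity> then esssup M (\<lambda>x. ennreal (norm (g x)))
     else ennreal_powr (\<integral>\<^sup>+x. ennreal (norm (g x) powr enn2real p) \<partial>M) (enn2real (1 / p)))"

text \<open>The underlying space is the unit circle itself and not the whole plane: below,
  \<open>\<lambda>\<zeta>. deriv f (\<rho> * \<zeta>)\<close> is only known to be measurable on the circle.\<close>

definition circle_measure :: "complex measure" where
  "circle_measure =
    distr (uniform_measure lborel {0..2 * pi}) (restrict_space borel (sphere 0 1)) cis"

definition besov_seminorm :: "ennreal \<Rightarrow> ennreal \<Rightarrow> (complex \<Rightarrow> complex) \<Rightarrow> ennreal" where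
  "besov_seminorm p q f =
    (if q = \<infinity> then
       (SUP \<rho>\<in>{0<..<1::real}.
          ennreal (1 - \<rho>) * Lp_norm p circle_measure (\<lambda>\<zeta>. deriv f (of_real \<rho> * \<zeta>)))
     else
       ennreal_powr
         (\<integral>\<^sup>+\<rho>\<in>{0<..<1::real}.
            (ennreal ((1 - \<rho>) powr (enn2real q - 1)) *
             ennreal_powr (Lp_norm p circle_measure (\<lambda>\<zeta>. deriv f (of_real \<rho> * \<zeta>)))
               (enn2real q)) \<partial>lborel)
         (enn2real (1 / q)))"

definition besov_norm :: "ennreal \<Rightarrow> ennreal \<Rightarrow> (complex \<Rightarrow> complex) \<Rightarrow> ennreal" where
  "besov_norm p q f = ennreal (norm (f 0)) + besov_seminorm p q f"

text \<open>Analytic functions on the disc are total functions of which only the values on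
  \<^term>\<open>ball 0 1 :: complex set\<close> matter.\<close>

definition besov_space :: "ennreal \<Rightarrow> ennreal \<Rightarrow> (complex \<Rightarrow> complex) set" where
  "besov_space p q = {f. f holomorphic_on ball 0 1 \<and> besov_norm p q f < \<infinity>}"

definition vanishes_on :: "(complex \<Rightarrow> complex) \<Rightarrow> complex list \<Rightarrow> bool" where
  "vanishes_on f \<sigma> \<longleftrightarrow> (\<forall>z\<in>set \<sigma>. \<forall>j<count_list \<sigma> z. (deriv ^^ j) f z = 0)"

text \<open>The capacity of a finite sequence with respect to a space \<open>X\<close> with norm \<open>nrm\<close>.\<close>

definition capacity ::
  "(complex \<Rightarrow> complex) set \<Rightarrow> ((complex \<Rightarrow> complex) \<Rightarrow> ennreal) \<Rightarrow> complex list \<Rightarrow> ennreal" where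
  "capacity X nrm \<sigma> = (INF f\<in>{f \<in> X. f 0 = 1 \<and> vanishes_on f \<sigma>}. nrm f)"

definition besov_capacity :: "ennreal \<Rightarrow> ennreal \<Rightarrow> complex list \<Rightarrow> ennreal" where
  "besov_capacity p q \<sigma> = capacity (besov_space p q) (besov_norm p q) \<sigma>"

definition radius :: "nat \<Rightarrow> nat \<Rightarrow> real" where
  "radius n k = (1 - 1 / real n) powr (2 powr (- real k))"

definition sigma_block :: "nat \<Rightarrow> nat \<Rightarrow> complex list" where
  "sigma_block n k =
    map (\<lambda>j. of_real (radius n k) * cis (2 * pi * real j / 2 ^ k)) [1..<Suc (2 ^ k)]"

definition sigma_star :: "nat \<Rightarrow> complex list" where
  "sigma_star n = concat (map (sigma_block n) [1..<Suc n])"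

lemma length_sigma_star: "length (sigma_star n) = (\<Sum>k=1..n. 2 ^ k)"
proof -
  have "length (sigma_star n) = sum_list (map (\<lambda>k. 2 ^ k) [1..<Suc n])"
    by (simp add: sigma_star_def sigma_block_def length_concat o_def del: upt_Suc)
  also have "\<dots> = (\<Sum>k=1..n. 2 ^ k)"
    by (subst sum_list_distinct_conv_sum_set)
      (simp_all add: atLeastLessThanSuc_atLeastAtMost del: upt_Suc)
  finally show ?thesis .
qed

lemma sigma_star_in_punctured_disc:
  assumes "n \<ge> 2" "z \<in> set (sigma_star n)"
  shows "z \<in> ball 0 1 - {0}"
proof -
  obtain k j where z: "z = of_real (radius n k) * cis (2 * pi * real j / 2 ^ k)"
    using assms(2) unfolding sigma_star_def sigma_block_def by (auto simp del: upt_Suc)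
  have "0 < radius n k" "radius n k < 1"
    using assms(1) powr_less_mono2[of "2 powr (- real k)" "1 - 1 / real n" 1]
    by (auto simp: radius_def)
  thus ?thesis by (auto simp: z norm_mult)
qed

end

theory Submission
  imports Defs "HOL-Probability.Probability_Measure" "HOL-Real_Asymp.Real_Asymp"
begin

text \<open>Write \<open>s = 1 - 1/n\<close>, \<open>\<alpha> = 1/p\<close>, and let \<open>M = 2^k\<close> run over the first \<open>n\<close> powers of two. The points of
the \<open>k\<close>-th block are exactly the solutions of \<open>z^M = s\<close>, so the product of all moduli is \<open>s^n\<close>,
which lies between \<open>e^-2\<close> and \<open>1\<close>, and \<open>log N\<close> is comparable to \<open>n\<close>. The claim is thus that the
capacity is at least of order \<open>n^(1/q) / n^\<alpha>\<close> for \<open>p < \<infinity>\<close> and \<open>n^(1/q) / log n\<close> for \<open>p = \<infinity>\<close>,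
and that the first order is attained when \<open>p \<ge> 2\<close>.

Lower bound. Let \<open>f = \<Sum> a_j z^j\<close> be admissible. Averaging \<open>f\<close> over the \<open>k\<close>-th block retains only
the coefficients with \<open>M dvd j\<close> and gives \<open>\<Sum> a_(mM) s^m = -1\<close>, summed over \<open>m \<ge> 1\<close>
(\<open>scale_coefficients\<close>). Adding these \<open>n\<close> identities produces a linear functional of \<open>f\<close> with value
\<open>-n\<close>, namely the pairing of \<open>f\<close> with \<open>g = \<Sum>\<^sub>k 1 / (1 - s z^M)\<close>. Because
\<open>\<integral> 4 \<rho> log (1/\<rho>) \<rho>^(2j-2) d\<rho> = 1/j^2\<close>, this pairing is the integral over the disc of
\<open>f' (\<rho> \<zeta>)\<close> times \<open>g' (\<rho> \<zeta>\<^sup>*)\<close>, \<open>\<zeta>\<^sup>*\<close> being the conjugate of \<open>\<zeta>\<close>, against the weight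
\<open>4 \<rho> log (1/\<rho>) \<le> 4 (1 - \<rho>)\<close> (\<open>scale_mean_total\<close>). On the circle of radius \<open>\<rho>\<close>, Hoelder's
inequality and the Poisson kernel bound the \<open>k\<close>-th summand by
\<open>\<parallel>f'\<^sub>\<rho>\<parallel>\<^sub>p M \<rho>^(M-1) (1 - s \<rho>^M)^(-1-\<alpha>)\<close> (\<open>scale_mean_le_Lp_norm\<close>).
The crucial point is that, after multiplication by \<open>1 - \<rho>\<close>, these weights add up over \<open>k\<close> to a lower
Riemann sum of \<open>\<integral> (1 - s x)^(-1-\<alpha>) dx\<close> over \<open>[0,1]\<close> with nodes \<open>x = \<rho>^(2^k)\<close>
(\<open>dyadic_sum_le\<close>). That integral is of order \<open>n^\<alpha>\<close>, or \<open>log n\<close> when \<open>\<alpha> = 0\<close>; this is \<open>growth\<close>.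
A cruder estimate shows that the weights are negligible for \<open>1 - \<rho> < 1/A\<close>, where
\<open>A = n 2^(n+1)\<close>, so that only a range of \<open>\<rho>\<close> of logarithmic length about \<open>n\<close> matters. Young's
inequality in \<open>\<rho>\<close> then yields the factor \<open>n^(1/q)\<close> (\<open>besov_seminorm_ge\<close>).

Upper bound. The normalised Blaschke product
\<open>f = s^(-n) \<Prod>\<^sub>k (s - z^M) / (1 - s z^M)\<close> is admissible and bounded by \<open>s^(-n) \<le> e^2\<close>. Parseval's
identity bounds the integral of \<open>(1 - \<rho>) \<parallel>f'\<^sub>\<rho>\<parallel>\<^sub>2\<^sup>2\<close> and Cauchy's inequality bounds \<open>(1 - |z|) |f' z|\<close>;
as \<open>p \<ge> 2\<close>, together they control the case \<open>q = p\<close>. For \<open>q < p\<close> one passes from exponent \<open>p\<close> to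
\<open>q\<close> on the range \<open>1 - \<rho> \<ge> 1/A\<close>, at the cost \<open>(log A)^(1/q - 1/p)\<close>, and uses \<open>|f'| \<le> e^2 A\<close>
elsewhere; here \<open>A = n 2^(n+2)\<close> (\<open>besov_seminorm_upper_bound\<close>).\<close>

section \<open>Integration and orthogonality on the unit circle\<close>

lemma measurable_cis_circle:
  "cis \<in> uniform_measure lborel A \<rightarrow>\<^sub>M restrict_space borel (sphere 0 1)"
proof (rule measurable_restrict_space2)
  have "cis \<in> borel_measurable borel"
    by (intro borel_measurable_continuous_onI continuous_intros)
  then show "cis \<in> borel_measurable (uniform_measure lborel A)"
    by (simp cong: measurable_cong_sets)
qed auto

lemma prob_space_circle: "prob_space circle_measure"
  and space_circle [simp]: "space circle_measure = sphere 0 1"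
  and sets_circle [measurable_cong]:
    "sets circle_measure = sets (restrict_space borel (sphere 0 1))"
proof -
  have "prob_space (uniform_measure lborel {0..2 * pi})"
    by (intro prob_space_uniform_measure) auto
  then show "prob_space circle_measure"
    unfolding circle_measure_def by (intro prob_space.prob_space_distr measurable_cis_circle)
qed (auto simp: circle_measure_def space_restrict_space)

lemma measurable_circle:
  fixes f :: "complex \<Rightarrow> 'b::topological_space"
  assumes "continuous_on (sphere 0 1) f"
  shows "f \<in> borel_measurable circle_measure"
  using borel_measurable_continuous_on_restrict[OF assms]
  by (simp cong: measurable_cong_sets add: sets_circle)

lemma integrable_circle:
  fixes f :: "complex \<Rightarrow> 'b::{banach, second_countable_topology}"
  assumes "f \<in> borel_measurable circle_measure" "\<And>z. norm z = 1 \<Longrightarrow> norm (f z) \<le> C"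
  shows "integrable circle_measure f"
proof -
  interpret prob_space circle_measure by (rule prob_space_circle)
  show ?thesis using assms
    by (intro integrable_const_bound[where B = C]) auto
qed

lemma circle_orthogonality:
  "integral\<^sup>L circle_measure (\<lambda>z. z ^ i * cnj z ^ j) = (if i = j then 1 else 0)"
proof (cases "i = j")
  case True
  interpret prob_space circle_measure by (rule prob_space_circle)
  have "integral\<^sup>L circle_measure (\<lambda>z. z ^ i * cnj z ^ j) = integral\<^sup>L circle_measure (\<lambda>z. 1)"
  proof (rule Bochner_Integration.integral_cong)
    fix z assume "z \<in> space circle_measure"
    then have "z * cnj z = 1" by (simp add: complex_norm_square[symmetric])
    then show "z ^ i * cnj z ^ j = 1" using True by (simp flip: power_mult_distrib)
  qed simp
  with True show ?thesis using prob_space[unfolded space_circle] by simp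
next
  case False
  define m :: real where "m = real i - real j"
  have m: "m \<noteq> 0" using False by (simp add: m_def)
  have U: "uniform_measure lborel {0..2 * pi} =
      density lborel (\<lambda>x. ennreal (indicator {0..2 * pi} x / (2 * pi)))"
    unfolding uniform_measure_def
    by (intro density_cong) (auto simp: divide_ennreal split: split_indicator simp flip: ennreal_1)
  have "integral\<^sup>L circle_measure (\<lambda>z. z ^ i * cnj z ^ j) =
      integral\<^sup>L (uniform_measure lborel {0..2 * pi}) (\<lambda>t. cis t ^ i * cnj (cis t) ^ j)"
    unfolding circle_measure_def
    by (subst integral_distr[OF measurable_cis_circle])
      (auto intro!: borel_measurable_continuous_on_restrict continuous_intros)
  also have "\<dots> = integral\<^sup>L (uniform_measure lborel {0..2 * pi}) (\<lambda>t. cis (m * t))"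
    by (simp add: cis_cnj Complex.DeMoivre cis_mult m_def algebra_simps)
  also have "\<dots> = integral\<^sup>L lborel (\<lambda>t. (indicator {0..2 * pi} t / (2 * pi)) *\<^sub>R cis (m * t))"
    unfolding U by (subst integral_density) (auto intro!: borel_measurable_continuous_onI continuous_intros)
  also have "\<dots> = (1 / (2 * pi)) *\<^sub>R (\<integral>t. indicator {0..2 * pi} t *\<^sub>R cis (m * t) \<partial>lborel)"
    by (simp flip: integral_scaleR_right)
  also have "(\<integral>t. indicator {0..2 * pi} t *\<^sub>R cis (m * t) \<partial>lborel) =
      cis (m * (2 * pi)) / (\<i> * m) - cis (m * 0) / (\<i> * m)"
  proof (rule integral_FTC_Icc)
    fix t
    have "((\<lambda>t. exp (\<i> * of_real (m * t)) / (\<i> * m)) has_vector_derivative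
        exp (\<i> * of_real (m * t))) (at t within {0..2 * pi})"
      using m by (auto intro!: derivative_eq_intros has_vector_derivative_real_field simp: field_simps)
    then show "((\<lambda>t. cis (m * t) / (\<i> * m)) has_vector_derivative cis (m * t)) (at t within {0..2 * pi})"
      by (simp add: cis_conv_exp)
  qed (auto intro!: continuous_intros)
  also have "cis (m * (2 * pi)) = 1"
    using cis_multiple_2pi[of m] by (simp add: m_def mult.commute)
  finally show ?thesis using False by simp
qed

text \<open>All series on the circle are absolutely and uniformly convergent here, so sum and integral commute by
dominated convergence. This is the only interchange needed for coefficients, Parseval's identity
and the pairing of \<open>f'\<close> with a kernel.\<close>

lemma circle_integral_sums:
  fixes F :: "complex \<Rightarrow> complex"
  assumes F: "F \<in> borel_measurable circle_measure" "\<And>z. norm z = 1 \<Longrightarrow> norm (F z) \<le> C"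
    and g: "\<And>m. continuous_on (sphere 0 1) (g m)" "\<And>m z. norm z = 1 \<Longrightarrow> norm (g m z) \<le> 1"
    and d: "summable (\<lambda>m. norm (d m))"
  shows "(\<lambda>m. d m * integral\<^sup>L circle_measure (\<lambda>z. F z * g m z)) sums
    integral\<^sup>L circle_measure (\<lambda>z. F z * (\<Sum>m. d m * g m z))"
proof -
  interpret prob_space circle_measure by (rule prob_space_circle)
  have meas: "(\<lambda>z. d m * (F z * g m z)) \<in> borel_measurable circle_measure" for m
    using F(1) measurable_circle[OF g(1)] by measurable
  have bnd: "norm (d m * (F z * g m z)) \<le> norm (d m) * C" if "norm z = 1" for m z
  proof -
    have "norm (F z) * norm (g m z) \<le> C * 1"
      using F(2)[OF that] g(2)[OF that] order_trans[OF norm_ge_zero F(2)[OF that]]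
      by (intro mult_mono) auto
    then show ?thesis by (simp add: norm_mult mult_left_mono)
  qed
  have sm: "summable (\<lambda>m. norm (d m) * C)" using d by (rule summable_mult2)
  have "(\<lambda>m. integral\<^sup>L circle_measure (\<lambda>z. d m * (F z * g m z))) sums
    integral\<^sup>L circle_measure (\<lambda>z. \<Sum>m. d m * (F z * g m z))"
  proof (rule sums_integral)
    show "integrable circle_measure (\<lambda>z. d m * (F z * g m z))" for m
      using meas bnd by (rule integrable_circle)
    show "AE z in circle_measure. summable (\<lambda>m. norm (d m * (F z * g m z)))"
    proof (rule AE_I2)
      fix z assume "z \<in> space circle_measure"
      then show "summable (\<lambda>m. norm (d m * (F z * g m z)))"
        using bnd by (intro summable_comparison_test'[OF sm]) auto
    qed
    show "summable (\<lambda>m. integral\<^sup>L circle_measure (\<lambda>z. norm (d m * (F z * g m z))))"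
    proof (rule summable_comparison_test'[OF sm])
      fix m
      have "integral\<^sup>L circle_measure (\<lambda>z. norm (d m * (F z * g m z))) \<le> norm (d m) * C"
        using meas bnd
        by (intro integral_le_const integrable_norm integrable_circle[where C = "norm (d m) * C"] AE_I2)
          auto
      then show "norm (integral\<^sup>L circle_measure (\<lambda>z. norm (d m * (F z * g m z)))) \<le> norm (d m) * C"
        by (simp add: integral_nonneg_AE)
    qed
  qed
  also have "integral\<^sup>L circle_measure (\<lambda>z. \<Sum>m. d m * (F z * g m z)) =
      integral\<^sup>L circle_measure (\<lambda>z. F z * (\<Sum>m. d m * g m z))"
  proof (rule Bochner_Integration.integral_cong)
    fix z assume "z \<in> space circle_measure"
    then have "summable (\<lambda>m. d m * g m z)"
      using g(2)
      by (intro summable_norm_cancel[OF summable_comparison_test'[OF d]])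
        (auto simp: norm_mult intro!: mult_left_le)
    then show "(\<Sum>m. d m * (F z * g m z)) = F z * (\<Sum>m. d m * g m z)"
      by (subst suminf_mult[symmetric]) (auto simp: algebra_simps)
  qed simp
  finally show ?thesis by simp
qed

lemma continuous_circle_series:
  fixes c :: "nat \<Rightarrow> complex"
  assumes "summable (\<lambda>m. norm (c m))"
  shows "continuous_on (sphere 0 1) (\<lambda>z. \<Sum>m. c m * z ^ e m)"
    and "norm z = 1 \<Longrightarrow> norm (\<Sum>m. c m * z ^ e m) \<le> (\<Sum>m. norm (c m))"
    and "norm z = 1 \<Longrightarrow> summable (\<lambda>m. c m * z ^ e m)"
proof -
  show "continuous_on (sphere 0 1) (\<lambda>z. \<Sum>m. c m * z ^ e m)"
  proof (rule uniform_limit_theorem)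
    show "uniform_limit (sphere 0 1) (\<lambda>n z. \<Sum>m<n. c m * z ^ e m) (\<lambda>z. \<Sum>m. c m * z ^ e m) sequentially"
      using assms by (intro Weierstrass_m_test) (auto simp: norm_mult norm_power)
  qed (auto intro!: always_eventually continuous_intros)
next
  assume z: "norm z = 1"
  then show "norm (\<Sum>m. c m * z ^ e m) \<le> (\<Sum>m. norm (c m))"
    using assms by (intro norm_suminf_le) (auto simp: norm_mult norm_power)
  show "summable (\<lambda>m. c m * z ^ e m)"
    using z assms by (intro summable_norm_cancel[where f = "\<lambda>m. c m * z ^ e m"]) (auto simp: norm_mult norm_power)
qed

text \<open>The exponents are allowed to be lacunary (\<open>e\<close> injective) so that series in \<open>z^M\<close> are covered.\<close>

lemma circle_coefficient:
  fixes c :: "nat \<Rightarrow> complex"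
  assumes "summable (\<lambda>m. norm (c m))" "inj e"
  shows "integral\<^sup>L circle_measure (\<lambda>z. (\<Sum>i. c i * z ^ e i) * cnj z ^ e m) = c m"
proof -
  have "(\<lambda>i. c i * integral\<^sup>L circle_measure (\<lambda>z. cnj z ^ e m * z ^ e i)) sums
      integral\<^sup>L circle_measure (\<lambda>z. cnj z ^ e m * (\<Sum>i. c i * z ^ e i))"
    using assms(1)
    by (intro circle_integral_sums[where C = 1])
      (auto intro!: measurable_circle continuous_intros simp: norm_power)
  then have "(\<lambda>i. c i * (if i = m then 1 else 0)) sums
      integral\<^sup>L circle_measure (\<lambda>z. (\<Sum>i. c i * z ^ e i) * cnj z ^ e m)"
    using circle_orthogonality[of "e _" "e m"] inj_eq[OF assms(2)] by (simp add: mult.commute)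
  then have "(\<lambda>i. if i = m then c i else 0) sums
      integral\<^sup>L circle_measure (\<lambda>z. (\<Sum>i. c i * z ^ e i) * cnj z ^ e m)"
    by (simp add: if_distrib cong: if_cong)
  with sums_single[of m c] show ?thesis by (rule sums_unique2[symmetric])
qed

lemma circle_parseval:
  fixes c :: "nat \<Rightarrow> complex"
  assumes c: "summable (\<lambda>m. norm (c m))" and e: "inj e"
  shows "(\<lambda>m. (norm (c m))\<^sup>2) sums
    integral\<^sup>L circle_measure (\<lambda>z. (norm (\<Sum>i. c i * z ^ e i))\<^sup>2)"
proof -
  have "(\<lambda>m. cnj (c m) * integral\<^sup>L circle_measure (\<lambda>z. (\<Sum>i. c i * z ^ e i) * cnj z ^ e m)) sums
    integral\<^sup>L circle_measure (\<lambda>z. (\<Sum>i. c i * z ^ e i) * (\<Sum>m. cnj (c m) * cnj z ^ e m))"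
    using continuous_circle_series[OF c] c
    by (intro circle_integral_sums[where C = "\<Sum>m. norm (c m)"])
      (auto intro!: measurable_circle continuous_intros simp: norm_power)
  also have "(\<lambda>m. cnj (c m) * integral\<^sup>L circle_measure (\<lambda>z. (\<Sum>i. c i * z ^ e i) * cnj z ^ e m)) =
      (\<lambda>m. complex_of_real ((norm (c m))\<^sup>2))"
    using circle_coefficient[OF c e]
    by (auto simp: complex_norm_square mult.commute simp del: of_real_power)
  also have "integral\<^sup>L circle_measure (\<lambda>z. (\<Sum>i. c i * z ^ e i) * (\<Sum>m. cnj (c m) * cnj z ^ e m)) =
      integral\<^sup>L circle_measure (\<lambda>z. complex_of_real ((norm (\<Sum>i. c i * z ^ e i))\<^sup>2))"
  proof (rule Bochner_Integration.integral_cong)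
    fix z assume "z \<in> space circle_measure"
    then have "(\<lambda>m. cnj (c m * z ^ e m)) sums cnj (\<Sum>i. c i * z ^ e i)"
      using continuous_circle_series(3)[OF c, of z e] by (subst sums_cnj) (auto intro: summable_sums)
    then have "(\<Sum>m. cnj (c m) * cnj z ^ e m) = cnj (\<Sum>i. c i * z ^ e i)"
      by (simp add: sums_iff)
    then show "(\<Sum>i. c i * z ^ e i) * (\<Sum>m. cnj (c m) * cnj z ^ e m) =
        complex_of_real ((norm (\<Sum>i. c i * z ^ e i))\<^sup>2)"
      by (simp add: complex_norm_square del: of_real_power)
  qed simp
  finally show ?thesis
    by (simp only: integral_complex_of_real sums_of_real_iff)
qed

text \<open>The integrand is the squared modulus of \<open>\<Sum> t^m z^(M m)\<close>, so its mean is \<open>\<Sum> t^(2 m)\<close> by Parseval.\<close>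

lemma circle_poisson_kernel:
  assumes "0 \<le> t" "t < 1" "M > 0"
  shows "(\<integral>\<^sup>+z. ennreal (1 / (norm (1 - of_real t * z ^ M))\<^sup>2) \<partial>circle_measure) = ennreal (1 / (1 - t\<^sup>2))"
proof -
  let ?h = "\<lambda>z. 1 / (norm (1 - complex_of_real t * z ^ M))\<^sup>2"
  have t: "norm (complex_of_real t) < 1" using assms by simp
  have sm: "summable (\<lambda>m. norm (complex_of_real t ^ m))"
    using assms by (simp add: norm_power summable_geometric)
  have series: "(\<Sum>i. complex_of_real t ^ i * z ^ (M * i)) = 1 / (1 - of_real t * z ^ M)" if "norm z = 1" for z
    using suminf_geometric[of "of_real t * z ^ M"] assms that
    by (simp add: norm_mult norm_power power_mult_distrib power_mult)
  have "inj (\<lambda>m. M * m)" using assms by (auto simp: inj_on_def)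
  from circle_parseval[OF sm this]
  have "(\<lambda>m. (t\<^sup>2) ^ m) sums
      integral\<^sup>L circle_measure (\<lambda>z. (norm (\<Sum>i. complex_of_real t ^ i * z ^ (M * i)))\<^sup>2)"
    using assms by (simp add: norm_power power_mult[symmetric] mult.commute)
  also have "integral\<^sup>L circle_measure (\<lambda>z. (norm (\<Sum>i. complex_of_real t ^ i * z ^ (M * i)))\<^sup>2) =
      integral\<^sup>L circle_measure ?h"
    by (intro Bochner_Integration.integral_cong refl) (simp add: series norm_divide power_divide)
  finally have "integral\<^sup>L circle_measure ?h = 1 / (1 - t\<^sup>2)"
    using geometric_sums[of "t\<^sup>2"] assms by (simp add: sums_iff abs_square_less_1)
  moreover have "(\<integral>\<^sup>+z. ennreal (?h z) \<partial>circle_measure) = ennreal (integral\<^sup>L circle_measure ?h)"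
  proof (rule nn_integral_eq_integral)
    have nz: "1 - t \<le> norm (1 - complex_of_real t * z ^ M)" if "norm z = 1" for z
      using norm_triangle_ineq2[of 1 "complex_of_real t * z ^ M"] assms that
      by (simp add: norm_mult norm_power)
    then have "1 - complex_of_real t * z ^ M \<noteq> 0" if "norm z = 1" for z
      using assms that by fastforce
    then have "continuous_on (sphere 0 1) ?h"
      by (intro continuous_intros) auto
    moreover have "norm (?h z) \<le> 1 / (1 - t)\<^sup>2" if "norm z = 1" for z
    proof -
      have "(1 - t)\<^sup>2 \<le> (norm (1 - complex_of_real t * z ^ M))\<^sup>2"
        using nz[OF that] assms by (intro power_mono) auto
      then show ?thesis using assms by (simp add: frac_le)
    qed
    ultimately show "integrable circle_measure ?h"
      by (intro integrable_circle measurable_circle)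
  qed simp
  ultimately show ?thesis by simp
qed

section \<open>Exponents and a weighted Hoelder inequality\<close>

lemma exponent_cases [consumes 1, case_names infinite finite]:
  fixes p :: ennreal
  assumes "1 \<le> p"
  obtains (infinite) "p = \<infinity>" "enn2real (1 / p) = 0"
    | (finite) P where "p = ennreal P" "1 \<le> P" "enn2real p = P" "enn2real (1 / p) = 1 / P"
proof (cases p)
  case (real P)
  have P: "1 \<le> P" using assms real by (simp flip: ennreal_1)
  then have "1 / p = ennreal (1 / P)"
    unfolding real(2) by (subst ennreal_1[symmetric], subst divide_ennreal) auto
  then show ?thesis using finite[of P] P real by simp
qed (use infinite in auto)

text \<open>Convexity of the exponential function gives \<open>y \<le> (1 - 1/P) + y^P / P\<close>; rescale by \<open>y = x / l\<close>. A
suitable choice of the free parameter \<open>l\<close> after integration turns this into an inequality of Hoelder type.\<close>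

lemma young_powr:
  fixes x l P :: real
  assumes "0 \<le> x" "0 < l" "1 \<le> P"
  shows "x \<le> (1 - 1 / P) * l + (1 / P) * l powr (1 - P) * x powr P"
proof (cases "x = 0")
  case False
  define y where "y = x / l"
  have y: "y > 0" using assms False by (simp add: y_def)
  have "exp ((1 - 1 / P) *\<^sub>R 0 + (1 / P) *\<^sub>R (P * ln y)) \<le> (1 - 1 / P) * exp 0 + (1 / P) * exp (P * ln y)"
    using assms by (intro convex_onD[OF exp_convex]) auto
  then have "y \<le> (1 - 1 / P) + (1 / P) * y powr P"
    using y assms by (simp add: powr_def)
  then have "l * y \<le> l * ((1 - 1 / P) + (1 / P) * y powr P)"
    using assms by (intro mult_left_mono) auto
  moreover have "l * y powr P = l powr (1 - P) * x powr P"
    using assms y by (simp add: y_def powr_divide powr_diff)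
  ultimately show ?thesis using assms by (simp add: y_def algebra_simps)
qed (use assms in auto)

text \<open>Interpolation between the two bounds on the weight \<open>K\<close>: its supremum \<open>T\<close> and its integral \<open>I\<close>.
For powers of the Poisson kernel both are explicit.\<close>

lemma Lp_norm_weighted_Holder:
  fixes p :: ennreal and F :: "'a \<Rightarrow> complex" and K :: "'a \<Rightarrow> real"
  assumes p: "1 \<le> p" and [measurable]: "F \<in> borel_measurable M" "K \<in> borel_measurable M"
    and K: "\<And>x. x \<in> space M \<Longrightarrow> 0 \<le> K x" "\<And>x. x \<in> space M \<Longrightarrow> K x \<le> T"
    and T: "0 < T" and I: "0 < I" "(\<integral>\<^sup>+x. ennreal (K x) \<partial>M) \<le> ennreal I"
  defines "a \<equiv> enn2real (1 / p)"
  shows "(\<integral>\<^sup>+x. ennreal (norm (F x) * K x) \<partial>M) \<le> Lp_norm p M F * ennreal (T powr a * I powr (1 - a))"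
proof (cases "p = \<infinity>")
  case True
  then have a: "a = 0" by (simp add: a_def)
  have "(\<integral>\<^sup>+x. ennreal (norm (F x) * K x) \<partial>M) \<le>
      (\<integral>\<^sup>+x. esssup M (\<lambda>x. ennreal (norm (F x))) * ennreal (K x) \<partial>M)"
    using esssup_AE[of "\<lambda>x. ennreal (norm (F x))" M]
    by (intro nn_integral_mono_AE) (auto simp: ennreal_mult'' K intro!: mult_right_mono)
  also have "\<dots> = esssup M (\<lambda>x. ennreal (norm (F x))) * (\<integral>\<^sup>+x. ennreal (K x) \<partial>M)"
    by (rule nn_integral_cmult) measurable
  also have "\<dots> \<le> Lp_norm p M F * ennreal I"
    using True I by (auto simp: Lp_norm_def intro!: mult_left_mono)
  finally show ?thesis using T I by (simp add: a)
next
  case False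
  with p obtain P where P: "1 \<le> P" and Pp: "enn2real p = P" "enn2real (1 / p) = 1 / P"
    by (cases rule: exponent_cases) auto
  have a: "a = 1 / P" by (simp add: a_def Pp)
  let ?L = "\<integral>\<^sup>+x. ennreal (norm (F x) powr P) \<partial>M"
  have Lp: "Lp_norm p M F = ennreal_powr ?L a"
    using False by (simp add: Lp_norm_def Pp a_def)
  show ?thesis
  proof (cases "?L = \<infinity>")
    case True
    then show ?thesis unfolding Lp using T I by (simp add: ennreal_powr_def ennreal_top_mult)
  next
    case finite: False
    define L where "L = enn2real ?L"
    have L: "?L = ennreal L" "L \<ge> 0" using finite by (auto simp: L_def less_top)
    show ?thesis
    proof (cases "L = 0")
      case True
      then have "AE x in M. ennreal (norm (F x) powr P) = 0"
        using L(1) by (subst nn_integral_0_iff_AE[symmetric]) auto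
      then have "AE x in M. ennreal (norm (F x) * K x) = 0"
        by eventually_elim (auto simp: ennreal_eq_0_iff)
      then have "(\<integral>\<^sup>+x. ennreal (norm (F x) * K x) \<partial>M) = 0"
        by (subst nn_integral_0_iff_AE) auto
      then show ?thesis by simp
    next
      case Lpos: False
      \<comment> \<open>This value of the parameter makes both terms of the inequality of Young proportional to \<open>l * I\<close>.\<close>
      define l where "l = (T * L / I) powr a"
      have l: "l > 0" using T I L Lpos by (simp add: l_def)
      have "(\<integral>\<^sup>+x. ennreal (norm (F x) * K x) \<partial>M) \<le>
          (\<integral>\<^sup>+x. ennreal ((1 - a) * l) * ennreal (K x) + ennreal (a * l powr (1 - P) * T) * ennreal (norm (F x) powr P) \<partial>M)"
      proof (intro nn_integral_mono)
        fix x assume x: "x \<in> space M"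
        have "norm (F x) * K x \<le> ((1 - a) * l + a * l powr (1 - P) * norm (F x) powr P) * K x"
          using young_powr[OF norm_ge_zero l P, of "F x"] K[OF x] by (intro mult_right_mono) (auto simp: a)
        also have "\<dots> = (1 - a) * l * K x + a * l powr (1 - P) * norm (F x) powr P * K x"
          by (simp add: algebra_simps)
        also have "\<dots> \<le> (1 - a) * l * K x + a * l powr (1 - P) * norm (F x) powr P * T"
          using K[OF x] P by (intro add_left_mono mult_left_mono) (auto simp: a)
        finally have *: "norm (F x) * K x \<le> (1 - a) * l * K x + a * l powr (1 - P) * T * norm (F x) powr P"
          by (simp add: mult_ac)
        have "0 \<le> (1 - a) * l * K x" "0 \<le> a * l powr (1 - P) * T"
          using K[OF x] P l T by (auto simp: a)
        with * show "ennreal (norm (F x) * K x) \<le> ennreal ((1 - a) * l) * ennreal (K x) +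
            ennreal (a * l powr (1 - P) * T) * ennreal (norm (F x) powr P)"
          using K[OF x] by (simp add: ennreal_leI flip: ennreal_mult'' ennreal_plus)
      qed
      also have "\<dots> = ennreal ((1 - a) * l) * (\<integral>\<^sup>+x. ennreal (K x) \<partial>M) + ennreal (a * l powr (1 - P) * T) * ?L"
        by (subst nn_integral_add) (auto simp: nn_integral_cmult)
      also have "\<dots> \<le> ennreal ((1 - a) * l) * ennreal I + ennreal (a * l powr (1 - P) * T) * ennreal L"
        using I(2) L(1) by (intro add_mono mult_left_mono) auto
      also have "\<dots> = ennreal ((1 - a) * l * I + a * (l powr (1 - P) * T * L))"
      proof -
        have "0 \<le> (1 - a) * l * I" "0 \<le> a * (l powr (1 - P) * T * L)" using l I T L P by (auto simp: a)
        moreover have "ennreal ((1 - a) * l) * ennreal I = ennreal ((1 - a) * l * I)"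
          using I by (simp only: ennreal_mult'')
        moreover have "ennreal (a * l powr (1 - P) * T) * ennreal L = ennreal (a * (l powr (1 - P) * T * L))"
          unfolding ennreal_mult''[OF L(2), symmetric] by (simp only: mult.assoc)
        ultimately show ?thesis by (simp only: ennreal_plus)
      qed
      also have "l powr (1 - P) * T * L = l * I"
      proof -
        have "l powr P = T * L / I" using T I L P by (simp add: l_def powr_powr a)
        then show ?thesis using l T I L Lpos by (simp add: powr_diff)
      qed
      also have "(1 - a) * l * I + a * (l * I) = l * I" by (simp add: algebra_simps)
      also have "l * I = L powr a * (T powr a * I powr (1 - a))"
        using T I L by (simp add: l_def powr_mult powr_divide powr_diff algebra_simps)
      finally show ?thesis
        unfolding Lp L(1) using L T I
        by (simp add: ennreal_powr_def flip: ennreal_mult'')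
    qed
  qed
qed

section \<open>Summing kernels over dyadic scales\<close>

text \<open>With \<open>l = 2^(k-1)\<close>, the estimate \<open>(1 - \<rho>) l \<rho>^(l-1) \<le> 1 - \<rho>^l\<close> shows that the coefficient
of \<open>\<psi>\<close> is at most \<open>2 (\<rho>^l - \<rho>^(2l))\<close>, twice the distance of two consecutive nodes \<open>\<rho>^(2^k)\<close>.
The hypothesis on \<open>\<Phi>\<close> holds for a primitive of an increasing \<open>\<psi>\<close>, in which case the sum is
at most twice a lower Riemann sum of \<open>\<psi>\<close>.\<close>

lemma dyadic_sum_le:
  fixes \<rho> :: real
  assumes \<rho>: "0 < \<rho>" "\<rho> < 1"
    and \<Phi>: "\<And>x y. 0 \<le> y \<Longrightarrow> y \<le> x \<Longrightarrow> x \<le> 1 \<Longrightarrow> (x - y) * \<psi> y \<le> \<Phi> x - \<Phi> y"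
    and \<psi>: "\<And>y. 0 \<le> y \<Longrightarrow> y \<le> 1 \<Longrightarrow> 0 \<le> \<psi> y"
  shows "(\<Sum>k=1..n. (1 - \<rho>) * (2 ^ k * \<rho> ^ (2 ^ k - 1)) * \<psi> (\<rho> ^ 2 ^ k)) \<le> 2 * (\<Phi> 1 - \<Phi> 0)"
proof -
  have step: "(1 - \<rho>) * (2 ^ Suc k * \<rho> ^ (2 ^ Suc k - 1)) \<le> 2 * (\<rho> ^ 2 ^ k - \<rho> ^ 2 ^ Suc k)" for k
  proof -
    define l :: nat where "l = 2 ^ k"
    have l: "l \<ge> 1" by (simp add: l_def)
    have "real l * \<rho> ^ (l - 1) \<le> (\<Sum>i<l. \<rho> ^ i)"
      using sum_bounded_below[of "{..<l}" "\<rho> ^ (l - 1)" "\<lambda>i. \<rho> ^ i"] \<rho>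
      by (auto intro!: power_decreasing)
    then have "(1 - \<rho>) * (real l * \<rho> ^ (l - 1)) \<le> 1 - \<rho> ^ l"
      using \<rho> by (simp add: one_diff_power_eq mult_left_mono)
    then have "2 * \<rho> ^ l * ((1 - \<rho>) * (real l * \<rho> ^ (l - 1))) \<le> 2 * \<rho> ^ l * (1 - \<rho> ^ l)"
      using \<rho> by (intro mult_left_mono) auto
    moreover have "2 * l - 1 = l + (l - 1)" using l by simp
    then have "\<rho> ^ (2 * l - 1) = \<rho> ^ l * \<rho> ^ (l - 1)" by (simp add: power_add)
    moreover have "\<rho> ^ (2 * l) = \<rho> ^ l * \<rho> ^ l" by (simp add: mult_2 power_add)
    ultimately have "(1 - \<rho>) * (2 * real l * \<rho> ^ (2 * l - 1)) \<le> 2 * (\<rho> ^ l - \<rho> ^ (2 * l))"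
      by (simp add: algebra_simps del: One_nat_def)
    then show ?thesis by (simp add: l_def)
  qed
  have range: "0 \<le> \<rho> ^ m" "\<rho> ^ m \<le> 1" for m using \<rho> by (auto intro: power_le_one)
  have "(\<Sum>k=1..n. (1 - \<rho>) * (2 ^ k * \<rho> ^ (2 ^ k - 1)) * \<psi> (\<rho> ^ 2 ^ k)) \<le> 2 * (\<Phi> \<rho> - \<Phi> (\<rho> ^ 2 ^ n))"
  proof (induction n)
    case (Suc n)
    have "(1 - \<rho>) * (2 ^ Suc n * \<rho> ^ (2 ^ Suc n - 1)) * \<psi> (\<rho> ^ 2 ^ Suc n) \<le>
        2 * (\<rho> ^ 2 ^ n - \<rho> ^ 2 ^ Suc n) * \<psi> (\<rho> ^ 2 ^ Suc n)"
      using step \<psi> range by (intro mult_right_mono) auto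
    also have "\<dots> \<le> 2 * (\<Phi> (\<rho> ^ 2 ^ n) - \<Phi> (\<rho> ^ 2 ^ Suc n))"
    proof -
      have "\<rho> ^ 2 ^ Suc n \<le> \<rho> ^ 2 ^ n" by (rule power_decreasing) (use \<rho> in auto)
      from mult_left_mono[OF \<Phi>[OF range(1) this range(2)] zero_le_numeral[of "num.Bit0 num.One"]]
      show ?thesis by (simp only: mult.assoc)
    qed
    finally show ?case using Suc.IH by simp
  qed simp
  also have "\<dots> \<le> 2 * (\<Phi> 1 - \<Phi> 0)"
  proof -
    have mono: "\<Phi> y \<le> \<Phi> x" if "0 \<le> y" "y \<le> x" "x \<le> 1" for x y
    proof -
      have "0 \<le> (x - y) * \<psi> y" using \<psi>[of y] that by simp
      with \<Phi>[OF that] show ?thesis by linarith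
    qed
    have "\<Phi> \<rho> \<le> \<Phi> 1" "\<Phi> 0 \<le> \<Phi> (\<rho> ^ 2 ^ n)"
      using mono[of \<rho> 1] mono[of 0 "\<rho> ^ 2 ^ n"] \<rho> range by auto
    then show ?thesis by simp
  qed
  finally show ?thesis .
qed

lemma primitive_of_increasing:
  fixes \<Phi> \<psi> :: "real \<Rightarrow> real"
  assumes "\<And>x. 0 \<le> x \<Longrightarrow> x \<le> 1 \<Longrightarrow> (\<Phi> has_real_derivative \<psi> x) (at x)"
    and "\<And>x y. 0 \<le> y \<Longrightarrow> y \<le> x \<Longrightarrow> x \<le> 1 \<Longrightarrow> \<psi> y \<le> \<psi> x"
    and "0 \<le> y" "y \<le> x" "x \<le> 1"
  shows "(x - y) * \<psi> y \<le> \<Phi> x - \<Phi> y"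
proof (cases "y = x")
  case False
  then obtain z where z: "y < z" "z < x" "\<Phi> x - \<Phi> y = (x - y) * \<psi> z"
    using MVT2[of y x \<Phi> \<psi>] assms by force
  then show ?thesis using assms(2)[of y z] assms by (auto intro!: mult_left_mono)
qed simp

text \<open>The order of \<open>\<integral> (1 - s x) powr (-1 - a) dx\<close> over \<open>[0,1]\<close> for \<open>s = 1 - 1/n\<close>. Its change of form at
\<open>a = 0\<close> is responsible for the separate estimate in the case \<open>p = \<infinity>\<close>.\<close>

definition growth :: "real \<Rightarrow> nat \<Rightarrow> real" where
  "growth a n = (if a = 0 then ln (real n) else real n powr a)"

lemma growth_pos: "n \<ge> 2 \<Longrightarrow> growth a n > 0"
  by (simp add: growth_def)

lemma ln2_half: "1 / 2 \<le> ln (2::real)"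
  using ln2_ge_two_thirds by simp

lemma kernel_scales_le_growth:
  fixes a :: real
  assumes a: "0 \<le> a" "a \<le> 1" and n: "2 \<le> n" and \<rho>: "0 < \<rho>" "\<rho> < 1"
  defines "s \<equiv> 1 - 1 / real n"
  shows "(\<Sum>k=1..n. (1 - \<rho>) * (2 ^ k * \<rho> ^ (2 ^ k - 1)) * (1 - s * \<rho> ^ 2 ^ k) powr (- 1 - a))
    \<le> (if a = 0 then 4 else 4 / a) * growth a n"
proof -
  have s: "1 / 2 \<le> s" "s < 1" "1 - s = 1 / n" using n by (auto simp: s_def field_simps)
  have pos: "1 - s * x > 0" if "0 \<le> x" "x \<le> 1" for x
    using mult_left_le[of x s] that s by linarith
  define \<Phi> where "\<Phi> x = (if a = 0 then - ln (1 - s * x) / s else (1 - s * x) powr (- a) / (s * a))" for x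
  have "(\<Sum>k=1..n. (1 - \<rho>) * (2 ^ k * \<rho> ^ (2 ^ k - 1)) * (1 - s * \<rho> ^ 2 ^ k) powr (- 1 - a))
      \<le> 2 * (\<Phi> 1 - \<Phi> 0)"
  proof (rule dyadic_sum_le[where \<psi> = "\<lambda>x. (1 - s * x) powr (- 1 - a)"])
    fix x y :: real assume xy: "0 \<le> y" "y \<le> x" "x \<le> 1"
    then show "(x - y) * (1 - s * y) powr (- 1 - a) \<le> \<Phi> x - \<Phi> y"
    proof (rule primitive_of_increasing[where \<psi> = "\<lambda>x. (1 - s * x) powr (- 1 - a)", rotated 2])
      fix x :: real assume x: "0 \<le> x" "x \<le> 1"
      show "(\<Phi> has_real_derivative (1 - s * x) powr (- 1 - a)) (at x)"
      proof (cases "a = 0")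
        case True
        then show ?thesis using pos[OF x] s unfolding \<Phi>_def
          by (auto intro!: derivative_eq_intros simp: powr_minus_divide)
      next
        case False
        then show ?thesis using pos[OF x] s unfolding \<Phi>_def
          by (auto intro!: derivative_eq_intros simp: powr_diff powr_minus field_simps)
      qed
    next
      fix x y :: real assume xy: "0 \<le> y" "y \<le> x" "x \<le> 1"
      have "1 - s * x \<le> 1 - s * y" using s xy by (simp add: mult_left_mono)
      then show "(1 - s * y) powr (- 1 - a) \<le> (1 - s * x) powr (- 1 - a)"
        using pos[of x] xy a by (intro powr_mono2') auto
    qed
  qed (use \<rho> in auto)
  also have "\<dots> \<le> (if a = 0 then 4 else 4 / a) * growth a n"
  proof (cases "a = 0")
    case True
    have "- ln (1 - s) / s = ln n / s" using n by (simp add: s ln_div)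
    also have "\<dots> \<le> 2 * ln n"
      using s n mult_right_mono[of "1/2" s "ln n"] by (simp add: field_simps)
    finally show ?thesis using True by (simp add: \<Phi>_def growth_def)
  next
    case False
    have "\<Phi> 1 - \<Phi> 0 \<le> (1 - s) powr (- a) / (s * a)"
      using False s a by (simp add: \<Phi>_def)
    also have "(1 - s) powr (- a) = n powr a"
      using n by (simp add: s powr_minus powr_divide)
    also have "n powr a / (s * a) \<le> n powr a / (1 / 2 * a)"
      using s a False n by (intro divide_left_mono mult_right_mono) auto
    finally show ?thesis using False by (simp add: growth_def)
  qed
  finally show ?thesis .
qed

text \<open>Close to the boundary the bound by \<open>growth\<close> is not integrable against \<open>d\<rho> / (1 - \<rho>)\<close>. There
\<open>1 - s \<rho>^M \<ge> 1/n\<close> gives a bound that is linear in \<open>1 - \<rho>\<close>.\<close>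

lemma kernel_scales_le_boundary:
  fixes a :: real
  assumes a: "0 \<le> a" "a \<le> 1" and n: "2 \<le> n" and \<rho>: "0 < \<rho>" "\<rho> < 1"
  defines "s \<equiv> 1 - 1 / real n"
  shows "(\<Sum>k=1..n. (1 - \<rho>) * (2 ^ k * \<rho> ^ (2 ^ k - 1)) * (1 - s * \<rho> ^ 2 ^ k) powr (- 1 - a))
    \<le> 2 * growth a n * (n * 2 ^ (n + 1) * (1 - \<rho>))"
proof -
  have s: "0 \<le> s" "1 - s = 1 / n" using n by (auto simp: s_def field_simps)
  have "(\<Sum>k=1..n. (1 - \<rho>) * (2 ^ k * \<rho> ^ (2 ^ k - 1)) * (1 - s * \<rho> ^ 2 ^ k) powr (- 1 - a))
     \<le> (\<Sum>k=1..n. (1 - \<rho>) * (2 ^ k * 1) * n powr (1 + a))"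
  proof (intro sum_mono mult_mono mult_left_mono)
    fix k
    have "1 / n \<le> 1 - s * \<rho> ^ 2 ^ k"
      using mult_left_le[of "\<rho> ^ 2 ^ k" s] power_le_one[of \<rho> "2 ^ k"] s \<rho> by simp
    then have "(1 - s * \<rho> ^ 2 ^ k) powr (- 1 - a) \<le> (1 / n) powr (- 1 - a)"
      using n a by (intro powr_mono2') auto
    also have "\<dots> = n powr (1 + a)" using n by (simp add: powr_divide powr_minus powr_diff powr_add)
    finally show "(1 - s * \<rho> ^ 2 ^ k) powr (- 1 - a) \<le> n powr (1 + a)" .
  qed (use \<rho> in \<open>auto intro: power_le_one\<close>)
  also have "\<dots> = (1 - \<rho>) * n powr (1 + a) * (\<Sum>k=1..n. 2 ^ k)"
    by (simp add: sum_distrib_left sum_distrib_right mult_ac)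
  also have "\<dots> \<le> (1 - \<rho>) * n powr (1 + a) * 2 ^ (n + 1)"
  proof -
    have "(\<Sum>k=1..n. 2 ^ k :: real) \<le> 2 ^ (n + 1)" by (induction n) auto
    then show ?thesis using \<rho> by (intro mult_left_mono) auto
  qed
  also have "\<dots> \<le> (1 - \<rho>) * (n * (2 * growth a n)) * 2 ^ (n + 1)"
  proof -
    have "n powr a \<le> 2 * growth a n"
    proof (cases "a = 0")
      case True
      have "1 \<le> 2 * ln (real n)" using n ln2_half ln_mono[of 2 "real n"] by linarith
      then show ?thesis using n True by (simp add: growth_def)
    qed (use n in \<open>simp add: growth_def\<close>)
    then have "n powr (1 + a) \<le> n * (2 * growth a n)"
      using n by (simp add: powr_add)
    then show ?thesis using \<rho> by (intro mult_right_mono mult_left_mono) auto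
  qed
  finally show ?thesis by (simp only: mult_ac)
qed

section \<open>From a weighted radial integral to the seminorm\<close>

text \<open>The cut-off \<open>min 1 (A (1 - \<rho>))\<close> essentially restricts the divergent integral of \<open>1 / (1 - \<rho>)\<close> to the range
\<open>1 - \<rho> \<ge> 1/A\<close>, of logarithmic length \<open>ln A\<close>.\<close>

lemma cutoff_integral_le:
  assumes "1 \<le> A"
  shows "(\<integral>\<^sup>+\<rho>\<in>{0<..<1}. ennreal (min 1 (A * (1 - \<rho>)) / (1 - \<rho>)) \<partial>lborel) \<le> ennreal (1 + ln A)"
proof -
  have "(\<integral>\<^sup>+\<rho>\<in>{0<..<1}. ennreal (min 1 (A * (1 - \<rho>)) / (1 - \<rho>)) \<partial>lborel) \<le>
    (\<integral>\<^sup>+\<rho>. ennreal A * indicator {1 - 1 / A..1} \<rho> +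
      ennreal (1 / (1 - \<rho>)) * indicator {0..1 - 1 / A} \<rho> \<partial>lborel)"
  proof (rule nn_integral_mono)
    fix \<rho> :: real
    show "ennreal (min 1 (A * (1 - \<rho>)) / (1 - \<rho>)) * indicator {0<..<1} \<rho> \<le>
      ennreal A * indicator {1 - 1 / A..1} \<rho> + ennreal (1 / (1 - \<rho>)) * indicator {0..1 - 1 / A} \<rho>"
    proof (cases "\<rho> \<in> {0<..<1}")
      case True
      then have "min 1 (A * (1 - \<rho>)) / (1 - \<rho>) \<le> A" "min 1 (A * (1 - \<rho>)) / (1 - \<rho>) \<le> 1 / (1 - \<rho>)"
        by (auto simp: divide_right_mono pos_divide_le_eq)
      then have "ennreal (min 1 (A * (1 - \<rho>)) / (1 - \<rho>)) \<le> ennreal A"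
          "ennreal (min 1 (A * (1 - \<rho>)) / (1 - \<rho>)) \<le> ennreal (1 / (1 - \<rho>))"
        by (auto intro: ennreal_leI)
      with True show ?thesis
        by (cases "\<rho> \<le> 1 - 1 / A") (auto intro: add_increasing2 add_increasing split: split_indicator)
    qed simp
  qed
  also have "\<dots> = (\<integral>\<^sup>+\<rho>. ennreal A * indicator {1 - 1 / A..1} \<rho> \<partial>lborel) +
      (\<integral>\<^sup>+\<rho>. ennreal (1 / (1 - \<rho>)) * indicator {0..1 - 1 / A} \<rho> \<partial>lborel)"
    by (rule nn_integral_add) auto
  also have "(\<integral>\<^sup>+\<rho>. ennreal A * indicator {1 - 1 / A..1} \<rho> \<partial>lborel) = ennreal 1"
    using assms by (subst nn_integral_cmult_indicator) (auto simp: emeasure_lborel_Icc_eq simp flip: ennreal_mult'')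
  also have "(\<integral>\<^sup>+\<rho>. ennreal (1 / (1 - \<rho>)) * indicator {0..1 - 1 / A} \<rho> \<partial>lborel) =
      ennreal (- ln (1 - (1 - 1 / A)) - (- ln (1 - 0)))"
  proof (rule nn_integral_FTC_Icc)
    fix x assume "x \<in> {0..1 - 1 / A}"
    then have "0 \<le> x" "x \<le> 1 - 1 / A" by auto
    moreover have "1 / A > 0" using assms by simp
    ultimately have "x < 1" by linarith
    then show "((\<lambda>x. - ln (1 - x)) has_real_derivative 1 / (1 - x)) (at x)"
      by (auto intro!: derivative_eq_intros)
    show "0 \<le> 1 / (1 - x)" using \<open>x < 1\<close> by simp
  qed (use assms in auto)
  finally show ?thesis
    using assms by (subst ennreal_plus) (simp_all add: ln_div)
qed

text \<open>The dual form of Hoelder's inequality in \<open>\<rho>\<close>. The measurable minorant \<open>D\<close> stands for the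
\<open>L^p\<close> norm itself, so that no measurability of the latter in \<open>\<rho>\<close> has to be established.\<close>

lemma besov_seminorm_ge:
  fixes q :: ennreal and D :: "real \<Rightarrow> real"
  assumes q: "1 \<le> q" and D [measurable]: "D \<in> borel_measurable borel"
    and D0: "\<And>\<rho>. 0 \<le> D \<rho>"
    and Lp: "\<And>\<rho>. 0 < \<rho> \<Longrightarrow> \<rho> < 1 \<Longrightarrow>
      ennreal (D \<rho>) \<le> Lp_norm p circle_measure (\<lambda>\<zeta>. deriv f (of_real \<rho> * \<zeta>))"
    and A: "1 \<le> A" "1 + ln A \<le> J" and B: "0 < B"
    and int: "ennreal (J / B) \<le> (\<integral>\<^sup>+\<rho>\<in>{0<..<1}. ennreal (min 1 (A * (1 - \<rho>)) * D \<rho>) \<partial>lborel)"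
  shows "ennreal (J powr enn2real (1 / q) / (2 * B)) \<le> besov_seminorm p q f"
proof -
  let ?\<phi> = "\<lambda>\<rho>. min 1 (A * (1 - \<rho>))"
  have J: "J \<ge> 1" using A ln_ge_zero[of A] by linarith
  have cut: "(\<integral>\<^sup>+\<rho>\<in>{0<..<1}. ennreal (?\<phi> \<rho> / (1 - \<rho>)) \<partial>lborel) \<le> ennreal J"
    using cutoff_integral_le[OF A(1)] ennreal_leI[OF A(2)] by (rule order_trans)
  show ?thesis
  proof (cases "q = \<infinity>")
    case True
    define S where "S = besov_seminorm p q f"
    have S: "ennreal ((1 - \<rho>) * D \<rho>) \<le> S" if "0 < \<rho>" "\<rho> < 1" for \<rho>
    proof -
      have "ennreal ((1 - \<rho>) * D \<rho>) \<le> ennreal (1 - \<rho>) * Lp_norm p circle_measure (\<lambda>\<zeta>. deriv f (of_real \<rho> * \<zeta>))"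
        using Lp[OF that] that D0 by (simp add: ennreal_mult' mult_left_mono)
      also have "\<dots> \<le> S" unfolding S_def besov_seminorm_def using True that
        by (auto intro!: SUP_upper2[where i = \<rho>])
      finally show ?thesis .
    qed
    have "ennreal (J / B) \<le> (\<integral>\<^sup>+\<rho>\<in>{0<..<1}. S * ennreal (?\<phi> \<rho> / (1 - \<rho>)) \<partial>lborel)"
    proof (rule order_trans[OF int], rule nn_integral_mono)
      fix \<rho> :: real
      show "ennreal (?\<phi> \<rho> * D \<rho>) * indicator {0<..<1} \<rho> \<le> S * ennreal (?\<phi> \<rho> / (1 - \<rho>)) * indicator {0<..<1} \<rho>"
      proof (cases "\<rho> \<in> {0<..<1}")
        case r: True
        then have "?\<phi> \<rho> * D \<rho> = ((1 - \<rho>) * D \<rho>) * (?\<phi> \<rho> / (1 - \<rho>))" by simp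
        moreover have "0 \<le> ?\<phi> \<rho> / (1 - \<rho>)" using r A by simp
        ultimately have "ennreal (?\<phi> \<rho> * D \<rho>) = ennreal ((1 - \<rho>) * D \<rho>) * ennreal (?\<phi> \<rho> / (1 - \<rho>))"
          by (simp only: ennreal_mult'')
        also have "\<dots> \<le> S * ennreal (?\<phi> \<rho> / (1 - \<rho>))" using S r by (intro mult_right_mono) auto
        finally show ?thesis using r by simp
      qed simp
    qed
    also have "\<dots> = S * (\<integral>\<^sup>+\<rho>\<in>{0<..<1}. ennreal (?\<phi> \<rho> / (1 - \<rho>)) \<partial>lborel)"
      by (subst nn_integral_cmult[symmetric]) (auto simp: mult.assoc)
    also have "\<dots> \<le> S * ennreal J" using cut by (rule mult_left_mono) simp
    finally have *: "ennreal (J / B) \<le> S * ennreal J" .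
    show ?thesis
    proof (cases "S = \<infinity>")
      case False
      then obtain r where r: "S = ennreal r" "r \<ge> 0" by (cases S) auto
      with * J have "J * (1 / B) \<le> J * r" by (simp add: mult.commute flip: ennreal_mult'')
      then have "1 / B \<le> r" using J by (subst (asm) mult_le_cancel_left_pos) auto
      moreover have "1 / (2 * B) \<le> 1 / B" using B by (simp add: field_simps)
      ultimately have "1 / (2 * B) \<le> r" by linarith
      then show ?thesis using True J r unfolding S_def[symmetric] by (simp add: ennreal_leI)
    qed (simp add: S_def[symmetric])
  next
    case False
    with q obtain Q where Q: "1 \<le> Q" and qQ: "enn2real q = Q" and iq: "enn2real (1 / q) = 1 / Q"
      by (cases rule: exponent_cases) auto
    define I where "I = (\<integral>\<^sup>+\<rho>\<in>{0<..<1::real}. (ennreal ((1 - \<rho>) powr (Q - 1)) *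
             ennreal_powr (Lp_norm p circle_measure (\<lambda>\<zeta>. deriv f (of_real \<rho> * \<zeta>))) Q) \<partial>lborel)"
    have sem: "besov_seminorm p q f = ennreal_powr I (1 / Q)"
      using False by (simp add: besov_seminorm_def I_def qQ iq)
    \<comment> \<open>With this parameter the first term of the inequality of Young absorbs half of the lower bound \<open>J / B\<close>.\<close>
    define l where "l = 1 / (2 * B)"
    have l: "l > 0" using B by (simp add: l_def)
    have "ennreal (J / B) \<le> (\<integral>\<^sup>+\<rho>. ennreal l * (ennreal (?\<phi> \<rho> / (1 - \<rho>)) * indicator {0<..<1} \<rho>) +
        ennreal (l powr (1 - Q)) * (ennreal ((1 - \<rho>) powr (Q - 1) * D \<rho> powr Q) * indicator {0<..<1} \<rho>) \<partial>lborel)"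
    proof (rule order_trans[OF int], rule nn_integral_mono)
      fix \<rho> :: real
      show "ennreal (?\<phi> \<rho> * D \<rho>) * indicator {0<..<1} \<rho> \<le>
        ennreal l * (ennreal (?\<phi> \<rho> / (1 - \<rho>)) * indicator {0<..<1} \<rho>) +
        ennreal (l powr (1 - Q)) * (ennreal ((1 - \<rho>) powr (Q - 1) * D \<rho> powr Q) * indicator {0<..<1} \<rho>)"
      proof (cases "\<rho> \<in> {0<..<1}")
        case r: True
        define u where "u = 1 - \<rho>"
        have u: "u > 0" using r by (simp add: u_def)
        have ph: "0 \<le> ?\<phi> \<rho>" "?\<phi> \<rho> \<le> 1" using r A by auto
        have "u * D \<rho> \<le> (1 - 1 / Q) * l + 1 / Q * l powr (1 - Q) * (u * D \<rho>) powr Q"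
          using u D0 l Q by (intro young_powr) auto
        also have "\<dots> \<le> 1 * l + 1 * l powr (1 - Q) * (u * D \<rho>) powr Q"
          using l Q by (intro add_mono mult_right_mono) auto
        finally have "D \<rho> \<le> (l + l powr (1 - Q) * (u * D \<rho>) powr Q) / u"
          using u by (simp add: pos_le_divide_eq mult.commute)
        also have "\<dots> = l / u + l powr (1 - Q) * (u powr (Q - 1) * D \<rho> powr Q)"
          using u D0 by (simp add: powr_mult powr_diff field_simps)
        finally have "?\<phi> \<rho> * D \<rho> \<le> ?\<phi> \<rho> * (l / u + l powr (1 - Q) * (u powr (Q - 1) * D \<rho> powr Q))"
          using ph by (intro mult_left_mono)
        also have "\<dots> = l * (?\<phi> \<rho> / u) + ?\<phi> \<rho> * (l powr (1 - Q) * (u powr (Q - 1) * D \<rho> powr Q))"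
          by (simp add: distrib_left)
        also have "\<dots> \<le> l * (?\<phi> \<rho> / u) + 1 * (l powr (1 - Q) * (u powr (Q - 1) * D \<rho> powr Q))"
          using ph by (intro add_left_mono mult_right_mono) auto
        finally have "ennreal (?\<phi> \<rho> * D \<rho>) \<le> ennreal (l * (?\<phi> \<rho> / u) + l powr (1 - Q) * (u powr (Q - 1) * D \<rho> powr Q))"
          by (intro ennreal_leI) simp
        also have "\<dots> = ennreal (l * (?\<phi> \<rho> / u)) + ennreal (l powr (1 - Q) * (u powr (Q - 1) * D \<rho> powr Q))"
          using ph l u by (intro ennreal_plus) auto
        also have "\<dots> = ennreal l * ennreal (?\<phi> \<rho> / u) + ennreal (l powr (1 - Q)) * ennreal (u powr (Q - 1) * D \<rho> powr Q)"
          using ph l u by (simp only: ennreal_mult'' divide_nonneg_pos powr_ge_zero mult_nonneg_nonneg)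
        finally show ?thesis using r by (simp add: u_def)
      qed simp
    qed
    also have "\<dots> = ennreal l * (\<integral>\<^sup>+\<rho>\<in>{0<..<1}. ennreal (?\<phi> \<rho> / (1 - \<rho>)) \<partial>lborel) +
        ennreal (l powr (1 - Q)) * (\<integral>\<^sup>+\<rho>\<in>{0<..<1}. ennreal ((1 - \<rho>) powr (Q - 1) * D \<rho> powr Q) \<partial>lborel)"
      by (subst nn_integral_add) (auto simp: nn_integral_cmult)
    also have "\<dots> \<le> ennreal l * ennreal J + ennreal (l powr (1 - Q)) * I"
    proof (intro add_mono mult_left_mono cut)
      show "(\<integral>\<^sup>+\<rho>\<in>{0<..<1}. ennreal ((1 - \<rho>) powr (Q - 1) * D \<rho> powr Q) \<partial>lborel) \<le> I"
        unfolding I_def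
      proof (rule nn_integral_mono)
        fix \<rho> :: real
        have "ennreal (D \<rho> powr Q) \<le> ennreal_powr (Lp_norm p circle_measure (\<lambda>\<zeta>. deriv f (of_real \<rho> * \<zeta>))) Q"
          if "\<rho> \<in> {0<..<1}"
        proof (cases "Lp_norm p circle_measure (\<lambda>\<zeta>. deriv f (of_real \<rho> * \<zeta>)) = \<infinity>")
          case nt: False
          then obtain x where x: "Lp_norm p circle_measure (\<lambda>\<zeta>. deriv f (of_real \<rho> * \<zeta>)) = ennreal x" "x \<ge> 0"
            by (cases "Lp_norm p circle_measure (\<lambda>\<zeta>. deriv f (of_real \<rho> * \<zeta>))") auto
          with Lp[of \<rho>] that have "D \<rho> \<le> x" by simp
          then show ?thesis using x D0 Q by (simp add: ennreal_powr_def ennreal_leI powr_mono2)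
        qed (simp add: ennreal_powr_def)
        then show "ennreal ((1 - \<rho>) powr (Q - 1) * D \<rho> powr Q) * indicator {0<..<1} \<rho> \<le>
            ennreal ((1 - \<rho>) powr (Q - 1)) *
             ennreal_powr (Lp_norm p circle_measure (\<lambda>\<zeta>. deriv f (of_real \<rho> * \<zeta>))) Q * indicator {0<..<1} \<rho>"
          by (auto simp: ennreal_mult'' mult_left_mono split: split_indicator)
      qed
    qed auto
    finally have *: "ennreal (J / B) \<le> ennreal l * ennreal J + ennreal (l powr (1 - Q)) * I" .
    show ?thesis
    proof (cases "I = top")
      case True
      then show ?thesis by (simp add: sem ennreal_powr_def)
    next
      case False
      then obtain i where i: "I = ennreal i" "i \<ge> 0" by (cases I) auto
      have "ennreal l * ennreal J + ennreal (l powr (1 - Q)) * I = ennreal (l * J + l powr (1 - Q) * i)"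
        using l J i by (simp add: ennreal_mult'')
      moreover have "0 \<le> l * J + l powr (1 - Q) * i" using l J i by simp
      ultimately have "J / B \<le> l * J + l powr (1 - Q) * i"
        using * by (simp only: ennreal_le_iff)
      moreover have "J / B = 2 * (l * J)" using B by (simp add: l_def)
      ultimately have "l * J \<le> l powr (1 - Q) * i" by linarith
      then have "J * l powr Q \<le> i" using l by (simp add: powr_diff field_simps)
      then have "(J * l powr Q) powr (1 / Q) \<le> i powr (1 / Q)"
        using J l Q by (intro powr_mono2) auto
      also have "(J * l powr Q) powr (1 / Q) = J powr (1 / Q) / (2 * B)"
        using J l Q B by (simp add: powr_mult powr_powr l_def)
      finally show ?thesis using i False by (simp add: sem iq ennreal_powr_def ennreal_leI)
    qed
  qed
qed

section \<open>Taylor coefficients and the Szegoe kernel\<close>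

definition taylor :: "(complex \<Rightarrow> complex) \<Rightarrow> nat \<Rightarrow> complex" where
  "taylor f i = (deriv ^^ i) f 0 / fact i"

text \<open>Absolute convergence is recorded separately, since it is what the theorems on the circle require.\<close>

lemma taylor_sums:
  assumes "f holomorphic_on ball 0 1" "norm z < 1"
  shows "(\<lambda>i. taylor f i * z ^ i) sums f z"
    and "summable (\<lambda>i. norm (taylor f i * z ^ i))"
proof -
  have *: "(\<lambda>i. taylor f i * w ^ i) sums f w" if "norm w < 1" for w
    using holomorphic_power_series[OF assms(1), of w] that by (simp add: taylor_def)
  from *[OF assms(2)] show "(\<lambda>i. taylor f i * z ^ i) sums f z" .
  obtain r where r: "norm z < r" "r < 1" using dense assms(2) by blast
  then have "0 \<le> r" using norm_ge_zero[of z] by linarith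
  with *[of "of_real r"] r have "summable (\<lambda>i. taylor f i * complex_of_real r ^ i)"
    by (auto intro: sums_summable)
  then show "summable (\<lambda>i. norm (taylor f i * z ^ i))"
    by (rule powser_insidea) (use r \<open>0 \<le> r\<close> in auto)
qed

lemma taylor_deriv: "taylor (deriv f) i = of_nat (Suc i) * taylor f (Suc i)"
  by (simp add: taylor_def funpow_swap1 del: of_nat_Suc)

lemma deriv_circle_series:
  assumes f: "f holomorphic_on ball 0 1" and \<rho>: "0 \<le> \<rho>" "\<rho> < 1"
  defines "c \<equiv> \<lambda>i. of_nat (Suc i) * taylor f (Suc i) * of_real \<rho> ^ i"
  shows "summable (\<lambda>i. norm (c i))"
    and "norm \<zeta> = 1 \<Longrightarrow> deriv f (of_real \<rho> * \<zeta>) = (\<Sum>i. c i * \<zeta> ^ i)"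
proof -
  have d: "deriv f holomorphic_on ball 0 1" using f by (intro holomorphic_deriv) auto
  from taylor_sums(2)[OF d, of "of_real \<rho>"] \<rho> show "summable (\<lambda>i. norm (c i))"
    by (simp add: c_def taylor_deriv)
  assume "norm \<zeta> = 1"
  then show "deriv f (of_real \<rho> * \<zeta>) = (\<Sum>i. c i * \<zeta> ^ i)"
    using taylor_sums(1)[OF d, of "of_real \<rho> * \<zeta>"] \<rho>
    by (simp add: sums_iff norm_mult c_def taylor_deriv power_mult_distrib mult_ac)
qed

lemma continuous_deriv_circle:
  assumes f: "f holomorphic_on ball 0 1" and \<rho>: "0 \<le> \<rho>" "\<rho> < 1"
  shows "continuous_on (sphere 0 1) (\<lambda>\<zeta>. deriv f (of_real \<rho> * \<zeta>))"
proof (rule continuous_on_compose2[where g = "deriv f"])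
  show "continuous_on (ball 0 1) (deriv f)"
    using f by (intro holomorphic_on_imp_continuous_on holomorphic_deriv) auto
qed (use \<rho> in \<open>auto intro!: continuous_intros simp: norm_mult\<close>)

text \<open>Summing \<open>f (r \<omega>^j)\<close> over all \<open>M\<close>-th roots of unity annihilates every Taylor coefficient whose index
is not divisible by \<open>M\<close>.\<close>

lemma roots_of_unity_mean:
  assumes f: "f holomorphic_on ball 0 1" and r: "0 < r" "r < 1" and M: "M > 0"
    and zero: "\<And>j. j \<in> {1..M} \<Longrightarrow> f (of_real r * cis (2 * pi * real j / M)) = 0"
  shows "(\<lambda>m. taylor f (M * m) * of_real (r ^ M) ^ m) sums 0"
    and "summable (\<lambda>m. norm (taylor f (M * m) * of_real (r ^ M) ^ m))"
proof -
  define w where "w i = cis (2 * pi * real i / M)" for i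
  have w_power: "w i ^ j = w (i * j)" for i j
    unfolding w_def Complex.DeMoivre by (simp add: mult_ac)
  have w1: "w i = 1 \<longleftrightarrow> M dvd i" for i
    using complex_root_unity_eq_1[of M i] M by (simp add: w_def cis_conv_exp mult_ac)
  have filter: "(\<Sum>j=1..M. w (i * j)) = (if M dvd i then of_nat M else 0)" for i
  proof (cases "M dvd i")
    case True
    then have "w (i * j) = 1" for j by (simp add: w1)
    with True show ?thesis by simp
  next
    case False
    have "(\<Sum>j=1..M. w (i * j)) = (\<Sum>j<M. w i ^ Suc j)"
      by (intro sum.reindex_bij_witness[of _ Suc "\<lambda>j. j - 1"]) (auto simp: w_power simp del: power_Suc)
    also have "\<dots> = w i * (\<Sum>j<M. w i ^ j)" by (simp add: sum_distrib_left)
    also have "(\<Sum>j<M. w i ^ j) = (w i ^ M - 1) / (w i - 1)"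
      using False w1 by (intro geometric_sum) auto
    also have "w i ^ M = 1" unfolding w_power w1 by simp
    finally show ?thesis using False by simp
  qed
  have "(\<lambda>i. \<Sum>j=1..M. taylor f i * (of_real r * w j) ^ i) sums (\<Sum>j=1..M. f (of_real r * w j))"
    using r by (intro sums_sum taylor_sums(1) f) (auto simp: norm_mult w_def)
  also have "(\<Sum>j=1..M. f (of_real r * w j)) = 0"
    using zero by (intro sum.neutral) (auto simp: w_def)
  also have "(\<lambda>i. \<Sum>j=1..M. taylor f i * (of_real r * w j) ^ i) =
      (\<lambda>i. taylor f i * of_real r ^ i * (if M dvd i then of_nat M else 0))"
    by (auto simp: filter[symmetric] sum_distrib_left power_mult_distrib w_power mult_ac)
  finally have sums: "(\<lambda>i. taylor f i * of_real r ^ i * (if M dvd i then of_nat M else 0)) sums 0" .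
  have mono: "strict_mono (\<lambda>m. M * m)" using M by (auto simp: strict_mono_def)
  have "(\<lambda>m. (\<lambda>i. taylor f i * of_real r ^ i * (if M dvd i then of_nat M else 0)) (M * m)) sums 0"
    by (subst sums_mono_reindex[OF mono]) (use sums in \<open>auto simp: dvd_def\<close>)
  then have "(\<lambda>m. of_nat M * (taylor f (M * m) * of_real (r ^ M) ^ m)) sums (of_nat M * 0)"
    by (simp add: power_mult mult.commute[of "of_nat M"])
  then show "(\<lambda>m. taylor f (M * m) * of_real (r ^ M) ^ m) sums 0"
    using M by (subst (asm) sums_mult_iff) auto
  have "summable ((\<lambda>i. norm (taylor f i * of_real r ^ i)) \<circ> (\<lambda>m. M * m))"
    using taylor_sums(2)[OF f, of "of_real r"] r mono
    by (intro summable_reindex strict_mono_imp_inj_on) auto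
  then show "summable (\<lambda>m. norm (taylor f (M * m) * of_real (r ^ M) ^ m))"
    by (simp add: o_def power_mult)
qed

text \<open>The derivative of \<open>1 / (1 - s w^M)\<close> with respect to \<open>w\<close>.\<close>

definition szego_deriv :: "real \<Rightarrow> nat \<Rightarrow> complex \<Rightarrow> complex" where
  "szego_deriv s M w = of_nat M * of_real s * w ^ (M - 1) / (1 - of_real s * w ^ M)\<^sup>2"

lemma szego_deriv_sums:
  assumes "0 \<le> s" "s < 1" "M > 0" "norm w \<le> 1"
  shows "(\<lambda>m. of_nat (Suc m * M) * of_real s ^ Suc m * w ^ (Suc m * M - 1)) sums szego_deriv s M w"
proof -
  have "norm (of_real s * w ^ M) \<le> s * 1"
    unfolding norm_mult using assms by (intro mult_mono) (auto simp: norm_power power_le_one)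
  then have "norm (of_real s * w ^ M) < 1" using assms by linarith
  from geometric_deriv_sums[OF this]
  have "(\<lambda>m. of_nat M * of_real s * w ^ (M - 1) * (of_nat (Suc m) * (of_real s * w ^ M) ^ m)) sums
      (of_nat M * of_real s * w ^ (M - 1) * (1 / (1 - of_real s * w ^ M)\<^sup>2))"
    by (rule sums_mult)
  also have "(\<lambda>m. of_nat M * of_real s * w ^ (M - 1) * (of_nat (Suc m) * (of_real s * w ^ M) ^ m)) =
     (\<lambda>m. of_nat (Suc m * M) * of_real s ^ Suc m * w ^ (Suc m * M - 1))"
  proof
    fix m
    have "Suc m * M - 1 = (M - 1) + M * m" using assms by (cases M) auto
    then show "of_nat M * of_real s * w ^ (M - 1) * (of_nat (Suc m) * (of_real s * w ^ M) ^ m) =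
       of_nat (Suc m * M) * of_real s ^ Suc m * w ^ (Suc m * M - 1)"
      by (simp add: power_add power_mult power_mult_distrib mult_ac del: of_nat_Suc)
        (simp add: algebra_simps)
  qed
  finally show ?thesis by (simp add: szego_deriv_def)
qed

text \<open>The contribution of the circle of radius \<open>\<rho>\<close> to the pairing of \<open>f\<close> with \<open>1 / (1 - s z^M)\<close>.\<close>

definition scale_mean :: "(complex \<Rightarrow> complex) \<Rightarrow> real \<Rightarrow> nat \<Rightarrow> real \<Rightarrow> complex" where
  "scale_mean f s M \<rho> = integral\<^sup>L circle_measure
     (\<lambda>\<zeta>. deriv f (of_real \<rho> * \<zeta>) * szego_deriv s M (of_real \<rho> * cnj \<zeta>))"

lemma scale_mean_sums:
  assumes f: "f holomorphic_on ball 0 1" and \<rho>: "0 < \<rho>" "\<rho> < 1" and s: "0 \<le> s" "s < 1" and M: "M > 0"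
  shows "(\<lambda>m. of_nat (Suc m * M) ^ 2 * (taylor f (Suc m * M) * of_real s ^ Suc m) *
      of_real \<rho> ^ (2 * (Suc m * M - 1))) sums scale_mean f s M \<rho>"
proof -
  define c where "c i = of_nat (Suc i) * taylor f (Suc i) * of_real \<rho> ^ i" for i
  define d where "d m = complex_of_real (of_nat (Suc m * M) * s ^ Suc m * \<rho> ^ (Suc m * M - 1))" for m
  note c = deriv_circle_series[OF f less_imp_le[OF \<rho>(1)] \<rho>(2), folded c_def]
  have cm: "integral\<^sup>L circle_measure (\<lambda>\<zeta>. deriv f (of_real \<rho> * \<zeta>) * cnj \<zeta> ^ j) = c j" for j
  proof -
    have "integral\<^sup>L circle_measure (\<lambda>\<zeta>. deriv f (of_real \<rho> * \<zeta>) * cnj \<zeta> ^ j) =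
        integral\<^sup>L circle_measure (\<lambda>\<zeta>. (\<Sum>i. c i * \<zeta> ^ id i) * cnj \<zeta> ^ id j)"
      using c(2) by (intro Bochner_Integration.integral_cong) auto
    also have "\<dots> = c j" by (rule circle_coefficient[OF c(1)]) simp
    finally show ?thesis .
  qed
  have d: "summable (\<lambda>m. norm (d m))"
  proof -
    have "summable d"
      using sums_summable[OF szego_deriv_sums[OF s M, of "of_real \<rho>"]] \<rho>
      unfolding d_def by (simp only: of_real_mult of_real_power of_real_of_nat_eq norm_of_real)
    then show ?thesis using s \<rho> unfolding d_def summable_complex_of_real norm_of_real
      by (subst abs_of_nonneg) auto
  qed
  have "(\<lambda>m. d m * integral\<^sup>L circle_measure (\<lambda>\<zeta>. deriv f (of_real \<rho> * \<zeta>) * cnj \<zeta> ^ (Suc m * M - 1))) sums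
    integral\<^sup>L circle_measure (\<lambda>\<zeta>. deriv f (of_real \<rho> * \<zeta>) * (\<Sum>m. d m * cnj \<zeta> ^ (Suc m * M - 1)))"
  proof (rule circle_integral_sums[where C = "\<Sum>i. norm (c i)"])
    show "(\<lambda>\<zeta>. deriv f (of_real \<rho> * \<zeta>)) \<in> borel_measurable circle_measure"
      using f \<rho> by (intro measurable_circle continuous_deriv_circle) auto
    show "norm (deriv f (of_real \<rho> * \<zeta>)) \<le> (\<Sum>i. norm (c i))" if "norm \<zeta> = 1" for \<zeta>
      using c(2)[OF that] continuous_circle_series(2)[OF c(1) that, of id] by simp
  qed (use d in \<open>auto intro!: continuous_intros simp: norm_power\<close>)
  also have "integral\<^sup>L circle_measure (\<lambda>\<zeta>. deriv f (of_real \<rho> * \<zeta>) * (\<Sum>m. d m * cnj \<zeta> ^ (Suc m * M - 1))) =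
      scale_mean f s M \<rho>"
    unfolding scale_mean_def
  proof (rule Bochner_Integration.integral_cong)
    fix \<zeta> assume "\<zeta> \<in> space circle_measure"
    then have "(\<lambda>m. d m * cnj \<zeta> ^ (Suc m * M - 1)) sums szego_deriv s M (of_real \<rho> * cnj \<zeta>)"
      using szego_deriv_sums[OF s M, of "of_real \<rho> * cnj \<zeta>"] \<rho>
      by (simp add: d_def norm_mult power_mult_distrib mult_ac del: mult_Suc power_Suc)
    then show "deriv f (of_real \<rho> * \<zeta>) * (\<Sum>m. d m * cnj \<zeta> ^ (Suc m * M - 1)) =
       deriv f (of_real \<rho> * \<zeta>) * szego_deriv s M (of_real \<rho> * cnj \<zeta>)"
      by (simp only: sums_unique[symmetric])
  qed simp
  also have "(\<lambda>m. d m * integral\<^sup>L circle_measure (\<lambda>\<zeta>. deriv f (of_real \<rho> * \<zeta>) * cnj \<zeta> ^ (Suc m * M - 1))) =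
    (\<lambda>m. of_nat (Suc m * M) ^ 2 * (taylor f (Suc m * M) * of_real s ^ Suc m) * of_real \<rho> ^ (2 * (Suc m * M - 1)))"
  proof
    fix m
    have "Suc (Suc m * M - 1) = Suc m * M" using M by simp
    then have "c (Suc m * M - 1) = of_nat (Suc m * M) * taylor f (Suc m * M) * of_real \<rho> ^ (Suc m * M - 1)"
      unfolding c_def by (simp only:)
    then show "d m * integral\<^sup>L circle_measure (\<lambda>\<zeta>. deriv f (of_real \<rho> * \<zeta>) * cnj \<zeta> ^ (Suc m * M - 1)) =
      of_nat (Suc m * M) ^ 2 * (taylor f (Suc m * M) * of_real s ^ Suc m) * of_real \<rho> ^ (2 * (Suc m * M - 1))"
      unfolding cm by (simp only: d_def mult_2 power_add power2_eq_square of_real_mult of_real_power of_real_of_nat_eq mult_ac)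
  qed
  finally show ?thesis .
qed

text \<open>For \<open>t = s \<rho>^M\<close> the kernel is a multiple of \<open>1 / |1 - t \<zeta>^M|^2\<close>, with supremum \<open>(1 - t)^-2\<close> and mean at most
\<open>(1 - t)^-1\<close>; the weighted Hoelder inequality turns these into \<open>(1 - t)^(-1-1/p)\<close>.\<close>

lemma scale_mean_le_Lp_norm:
  fixes p :: ennreal
  assumes f: "f holomorphic_on ball 0 1" and \<rho>: "0 < \<rho>" "\<rho> < 1" and s: "0 \<le> s" "s < 1" and M: "M > 0"
    and p: "1 \<le> p"
  shows "ennreal (norm (scale_mean f s M \<rho>)) \<le>
    Lp_norm p circle_measure (\<lambda>\<zeta>. deriv f (of_real \<rho> * \<zeta>)) *
    ennreal (real M * \<rho> ^ (M - 1) * (1 - s * \<rho> ^ M) powr (- 1 - enn2real (1 / p)))"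
proof -
  define t where "t = s * \<rho> ^ M"
  have "t \<le> s * 1" unfolding t_def using \<rho> s by (intro mult_left_mono power_le_one) auto
  then have t: "0 \<le> t" "t < 1" using s \<rho> by (auto simp: t_def)
  define F where "F = (\<lambda>\<zeta>. deriv f (of_real \<rho> * \<zeta>))"
  define K where "K \<zeta> = 1 / (norm (1 - complex_of_real t * \<zeta> ^ M))\<^sup>2" for \<zeta>
  define a where "a = enn2real (1 / p)"
  have F: "continuous_on (sphere 0 1) F"
    unfolding F_def using f \<rho> by (intro continuous_deriv_circle) auto
  have nz: "1 - t \<le> norm (1 - complex_of_real t * z ^ M)" if "norm z = 1" for z
    using norm_triangle_ineq2[of 1 "complex_of_real t * z ^ M"] t that
    by (simp add: norm_mult norm_power)
  have nz': "1 - complex_of_real t * z ^ M \<noteq> 0" if "norm z = 1" for z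
    using nz[OF that] t by (metis diff_gt_0_iff_gt norm_zero not_le)
  have K: "continuous_on (sphere 0 1) K"
    unfolding K_def using nz' by (intro continuous_intros) auto
  have KT: "K z \<le> 1 / (1 - t)\<^sup>2" if "norm z = 1" for z
  proof -
    have "(1 - t)\<^sup>2 \<le> (norm (1 - complex_of_real t * z ^ M))\<^sup>2"
      using nz[OF that] t by (intro power_mono) auto
    then show ?thesis unfolding K_def using t by (simp add: frac_le)
  qed
  have norm_kernel: "norm (szego_deriv s M (of_real \<rho> * cnj \<zeta>)) = real M * s * \<rho> ^ (M - 1) * K \<zeta>"
    if "norm \<zeta> = 1" for \<zeta>
  proof -
    have "norm (1 - of_real s * (of_real \<rho> * cnj \<zeta>) ^ M) = norm (cnj (1 - of_real t * \<zeta> ^ M))"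
      by (simp add: t_def power_mult_distrib mult_ac)
    then have "norm (1 - of_real s * (of_real \<rho> * cnj \<zeta>) ^ M) = norm (1 - of_real t * \<zeta> ^ M)"
      by (simp only: complex_mod_cnj)
    then show ?thesis using that s \<rho>
      by (simp add: szego_deriv_def K_def norm_mult norm_divide norm_power)
  qed
  have "ennreal (norm (scale_mean f s M \<rho>)) \<le>
      (\<integral>\<^sup>+\<zeta>. ennreal (norm (F \<zeta> * szego_deriv s M (of_real \<rho> * cnj \<zeta>))) \<partial>circle_measure)"
    unfolding scale_mean_def F_def
    by (cases "integrable circle_measure (\<lambda>\<zeta>. deriv f (of_real \<rho> * \<zeta>) * szego_deriv s M (of_real \<rho> * cnj \<zeta>))")
      (auto intro: integral_norm_bound_ennreal simp: not_integrable_integral_eq)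
  also have "\<dots> = (\<integral>\<^sup>+\<zeta>. ennreal (real M * s * \<rho> ^ (M - 1)) * ennreal (norm (F \<zeta>) * K \<zeta>) \<partial>circle_measure)"
  proof (rule nn_integral_cong)
    fix \<zeta> assume "\<zeta> \<in> space circle_measure"
    then show "ennreal (norm (F \<zeta> * szego_deriv s M (of_real \<rho> * cnj \<zeta>))) =
       ennreal (real M * s * \<rho> ^ (M - 1)) * ennreal (norm (F \<zeta>) * K \<zeta>)"
      using norm_kernel[of \<zeta>] s \<rho> by (simp add: norm_mult mult_ac flip: ennreal_mult'')
  qed
  also have "\<dots> = ennreal (real M * s * \<rho> ^ (M - 1)) * (\<integral>\<^sup>+\<zeta>. ennreal (norm (F \<zeta>) * K \<zeta>) \<partial>circle_measure)"
    using F K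
    by (intro nn_integral_cmult measurable_compose[OF _ measurable_ennreal] measurable_circle continuous_intros)
  also have "\<dots> \<le> ennreal (real M * s * \<rho> ^ (M - 1)) *
      (Lp_norm p circle_measure F * ennreal ((1 / (1 - t)\<^sup>2) powr a * (1 / (1 - t)) powr (1 - a)))"
    unfolding a_def
  proof (rule mult_left_mono[OF Lp_norm_weighted_Holder[OF p]])
    show "F \<in> borel_measurable circle_measure" "K \<in> borel_measurable circle_measure"
      using F K by (auto intro!: measurable_circle)
    have "(\<integral>\<^sup>+\<zeta>. ennreal (K \<zeta>) \<partial>circle_measure) = ennreal (1 / (1 - t\<^sup>2))"
      unfolding K_def using t M by (rule circle_poisson_kernel)
    also have "\<dots> \<le> ennreal (1 / (1 - t))"
      using t by (intro ennreal_leI frac_le) (auto simp: power2_eq_square mult_left_le)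
    finally show "(\<integral>\<^sup>+\<zeta>. ennreal (K \<zeta>) \<partial>circle_measure) \<le> ennreal (1 / (1 - t))" .
  qed (use t KT in \<open>auto simp: K_def\<close>)
  also have "(1 / (1 - t)\<^sup>2) powr a * (1 / (1 - t)) powr (1 - a) = (1 - t) powr (- 1 - a)"
  proof -
    have "(1 / (1 - t)\<^sup>2) powr a = (1 - t) powr (- 2 * a)"
      using t by (simp add: powr_divide powr_minus_divide powr_powr flip: powr_numeral)
    moreover have "(1 / (1 - t)) powr (1 - a) = (1 - t) powr (a - 1)"
      using t by (simp add: powr_divide flip: powr_minus_divide)
    moreover have "(1 - t) powr (- 2 * a) * (1 - t) powr (a - 1) = (1 - t) powr (- 2 * a + (a - 1))"
      by (simp only: powr_add)
    moreover have "- 2 * a + (a - 1) = - 1 - a" by simp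
    ultimately show ?thesis by (simp only:)
  qed
  also have "ennreal (real M * s * \<rho> ^ (M - 1)) * (Lp_norm p circle_measure F * ennreal ((1 - t) powr (- 1 - a))) =
      Lp_norm p circle_measure F * ennreal (real M * s * \<rho> ^ (M - 1) * (1 - t) powr (- 1 - a))"
    unfolding ennreal_mult''[OF powr_ge_zero, of "real M * s * \<rho> ^ (M - 1)"] by (simp only: mult_ac)
  also have "\<dots> \<le> Lp_norm p circle_measure F * ennreal (real M * 1 * \<rho> ^ (M - 1) * (1 - t) powr (- 1 - a))"
    using s \<rho> by (intro mult_left_mono ennreal_leI mult_right_mono) auto
  finally show ?thesis by (simp add: F_def t_def a_def)
qed

text \<open>The weight \<open>4 \<rho> log (1/\<rho>)\<close> is chosen so that its moments cancel exactly the factor \<open>(j + 1)^2\<close>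
produced by differentiating two power series.\<close>

lemma log_weight_moment:
  fixes j :: nat
  defines "w \<equiv> \<lambda>\<rho>::real. 4 * \<rho> * ln (1 / \<rho>) * \<rho> ^ (2 * j)"
  shows "integrable lborel (\<lambda>\<rho>. indicator {0<..<1} \<rho> *\<^sub>R w \<rho>)"
    and "(\<integral>\<rho>. indicator {0<..<1} \<rho> *\<^sub>R w \<rho> \<partial>lborel) = 1 / (real j + 1)\<^sup>2"
proof -
  define N where "N = 2 * real j + 2"
  \<comment> \<open>The primitive of \<open>- 4 x^(2j+1) ln x\<close>; its limit at \<open>0\<close> exists although \<open>ln\<close> is singular there.\<close>
  define F where "F x = - 4 * (x ^ (2 * j + 2) * ln x / N - x ^ (2 * j + 2) / N\<^sup>2)" for x :: real
  have N: "N > 0" by (simp add: N_def)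
  have F0: "((F \<circ> real_of_ereal) \<longlongrightarrow> 0) (at_right (ereal 0))"
  proof -
    have "((\<lambda>x::real. x * ln x) \<longlongrightarrow> 0) (at_right 0)" by real_asymp
    moreover have "((\<lambda>x::real. x ^ (2 * j + 1)) \<longlongrightarrow> 0 ^ (2 * j + 1)) (at_right 0)"
      "((\<lambda>x::real. x ^ (2 * j + 2)) \<longlongrightarrow> 0 ^ (2 * j + 2)) (at_right 0)"
      by (intro tendsto_intros)+
    ultimately have "((\<lambda>x. - 4 * (x ^ (2 * j + 1) * (x * ln x) / N - x ^ (2 * j + 2) / N\<^sup>2))
        \<longlongrightarrow> - 4 * (0 ^ (2 * j + 1) * 0 / N - 0 ^ (2 * j + 2) / N\<^sup>2)) (at_right 0)"
      using N by (intro tendsto_intros) auto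
    then have "(F \<longlongrightarrow> 0) (at_right 0)"
      by (simp add: F_def[abs_def] mult_ac)
    then show ?thesis by (simp add: ereal_tendsto_simps)
  qed
  have F1: "((F \<circ> real_of_ereal) \<longlongrightarrow> F 1) (at_left (ereal 1))"
  proof -
    have "(F \<longlongrightarrow> F 1) (at_left 1)"
      unfolding F_def using N by (intro tendsto_intros) auto
    then show ?thesis by (simp add: ereal_tendsto_simps)
  qed
  have deriv: "(F has_real_derivative w x) (at x)" if x: "0 < x" "x < 1" for x
  proof -
    have pow: "((\<lambda>x. x ^ (2 * j + 2)) has_real_derivative N * x ^ (2 * j + 1)) (at x)"
      using DERIV_pow[of "2 * j + 2" x] by (simp add: N_def add.commute)
    have ln: "(ln has_real_derivative 1 / x) (at x)" using x by (auto intro!: derivative_eq_intros)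
    have "(F has_real_derivative
        - 4 * ((N * x ^ (2 * j + 1) * ln x + 1 / x * x ^ (2 * j + 2)) / N - N * x ^ (2 * j + 1) / N\<^sup>2)) (at x)"
      unfolding F_def using N
      by (intro DERIV_cmult DERIV_diff DERIV_cdivide DERIV_mult pow ln)
    also have "1 / x * x ^ (2 * j + 2) = x ^ (2 * j + 1)" using x by simp
    also have "- 4 * ((N * x ^ (2 * j + 1) * ln x + x ^ (2 * j + 1)) / N - N * x ^ (2 * j + 1) / N\<^sup>2) =
        - 4 * x ^ (2 * j + 1) * ln x"
      using N by (simp add: add_divide_distrib power2_eq_square)
    also have "\<dots> = w x" using x by (simp add: w_def ln_div)
    finally show ?thesis .
  qed
  have cont: "isCont w x" if "0 < x" "x < 1" for x
    unfolding w_def using that by (intro continuous_intros) auto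
  have nonneg: "AE x in lborel. ereal 0 < ereal x \<longrightarrow> ereal x < ereal 1 \<longrightarrow> 0 \<le> w x"
    by (intro AE_I2) (auto simp: w_def)
  note FTC = interval_integral_FTC_nonneg[OF _ _ _ nonneg F0 F1, simplified less_ereal.simps, OF _ deriv cont]
  show "integrable lborel (\<lambda>\<rho>. indicator {0<..<1} \<rho> *\<^sub>R w \<rho>)"
    using FTC(1) by (simp add: set_integrable_def einterval_eq)
  have "F 1 = 4 / N\<^sup>2" by (simp add: F_def)
  also have "\<dots> = 1 / (real j + 1)\<^sup>2"
  proof -
    have "N = 2 * (real j + 1)" by (simp add: N_def)
    then show ?thesis by (simp only: power_mult_distrib) simp
  qed
  finally show "(\<integral>\<rho>. indicator {0<..<1} \<rho> *\<^sub>R w \<rho> \<partial>lborel) = 1 / (real j + 1)\<^sup>2"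
    using FTC(2) by (simp add: interval_lebesgue_integral_def set_lebesgue_integral_def einterval_eq)
qed

text \<open>Term by term, the factor \<open>(m + 1)^2 M^2\<close> of the series for \<open>scale_mean\<close> is removed by the corresponding
moment of the weight. What remains is absolutely summable by hypothesis, which justifies the interchange.\<close>

lemma scale_mean_integral:
  assumes f: "f holomorphic_on ball 0 1" and s: "0 \<le> s" "s < 1" and M: "M > 0"
    and sm: "summable (\<lambda>m. norm (taylor f (Suc m * M) * of_real s ^ Suc m))"
  shows "has_bochner_integral lborel
    (\<lambda>\<rho>. indicator {0<..<1} \<rho> *\<^sub>R (of_real (4 * \<rho> * ln (1 / \<rho>)) * scale_mean f s M \<rho>))
    (\<Sum>m. taylor f (Suc m * M) * of_real s ^ Suc m)"
proof -
  define b where "b m = taylor f (Suc m * M) * of_real s ^ Suc m" for m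
  define e where "e m = Suc m * M - 1" for m
  have e: "real (e m) + 1 = real (Suc m * M)" for m
    using M by (simp add: e_def of_nat_diff)
  define w where "w m \<rho> = indicator {0<..<1} \<rho> *\<^sub>R (4 * \<rho> * ln (1 / \<rho>) * \<rho> ^ (2 * e m))" for m and \<rho> :: real
  note w = log_weight_moment[of "e _", folded w_def, unfolded e]
  define t where "t m \<rho> = w m \<rho> *\<^sub>R (of_nat (Suc m * M) ^ 2 * b m)" for m \<rho>
  have t_int: "integrable lborel (t m)" for m
    unfolding t_def using w(1) by (intro integrable_scaleR_left) auto
  have nz: "of_nat (Suc m * M) \<noteq> (0 :: complex)" for m unfolding of_nat_eq_0_iff using M by simp
  have t_val: "integral\<^sup>L lborel (t m) = b m" for m
  proof -
    have "integral\<^sup>L lborel (t m) = integral\<^sup>L lborel (w m) *\<^sub>R (of_nat (Suc m * M) ^ 2 * b m)"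
      unfolding t_def using w(1) by (intro integral_scaleR_left) auto
    also have "\<dots> = b m"
      unfolding w(2) using nz[of m] by (simp add: scaleR_conv_of_real del: of_nat_mult of_nat_Suc)
    finally show ?thesis .
  qed
  have w0: "0 \<le> w m \<rho>" for m \<rho> by (auto simp: w_def split: split_indicator)
  have t_norm: "integral\<^sup>L lborel (\<lambda>\<rho>. norm (t m \<rho>)) = norm (b m)" for m
  proof -
    have "integral\<^sup>L lborel (\<lambda>\<rho>. norm (t m \<rho>)) = integral\<^sup>L lborel (\<lambda>\<rho>. w m \<rho> *\<^sub>R norm (of_nat (Suc m * M) ^ 2 * b m))"
      unfolding t_def using w0 by (intro Bochner_Integration.integral_cong) auto
    also have "\<dots> = integral\<^sup>L lborel (w m) *\<^sub>R norm (of_nat (Suc m * M) ^ 2 * b m)"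
      using w(1) by (intro integral_scaleR_left) auto
    also have "\<dots> = norm (b m)"
      unfolding w(2) using M by (simp add: norm_mult norm_power del: of_nat_mult of_nat_Suc mult_Suc)
    finally show ?thesis .
  qed
  have t_sums: "t m \<rho> = (of_nat (Suc m * M) ^ 2 * b m * of_real \<rho> ^ (2 * e m)) * of_real (4 * \<rho> * ln (1 / \<rho>))"
    if "\<rho> \<in> {0<..<1}" for m \<rho>
    using that unfolding t_def w_def by (simp add: scaleR_conv_of_real mult_ac)
  have sums: "(\<lambda>m. t m \<rho>) sums (indicator {0<..<1} \<rho> *\<^sub>R (of_real (4 * \<rho> * ln (1 / \<rho>)) * scale_mean f s M \<rho>))"
    for \<rho>
  proof (cases "\<rho> \<in> {0<..<1}")
    case True
    then have "0 < \<rho>" "\<rho> < 1" by auto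
    from sums_mult2[OF scale_mean_sums[OF f this s M], of "of_real (4 * \<rho> * ln (1 / \<rho>))"]
    have "(\<lambda>m. t m \<rho>) sums (of_real (4 * \<rho> * ln (1 / \<rho>)) * scale_mean f s M \<rho>)"
      unfolding t_sums[OF True] b_def e_def mult.commute[of _ "scale_mean f s M \<rho>"] .
    with True show ?thesis by simp
  qed (simp add: t_def w_def)
  have abs: "summable (\<lambda>m. norm (t m \<rho>))" for \<rho>
  proof (cases "\<rho> \<in> {0<..<1}")
    case True
    then have \<rho>: "0 < \<rho>" "\<rho> < 1" by auto
    \<comment> \<open>The polynomial factor is harmless for fixed \<open>\<rho> < 1\<close>: \<open>k \<rho>^k\<close> is bounded.\<close>
    then have "(\<lambda>k. of_nat k * \<rho> ^ k) \<longlonglongrightarrow> 0" by (intro powser_times_n_limit_0) auto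
    then obtain C where C: "\<And>k. norm (of_nat k * \<rho> ^ k) \<le> C"
      by (metis convergent_def convergent_imp_Bseq Bseq_def)
    show ?thesis
    proof (rule summable_comparison_test'[OF summable_mult[OF sm, of "norm (4 * \<rho> * ln (1 / \<rho>)) * (C / \<rho>)\<^sup>2"]])
      fix m
      have "real (Suc m * M) * \<rho> ^ e m = real (Suc m * M) * \<rho> ^ (Suc m * M) / \<rho>"
        using \<rho> M by (simp add: e_def power_diff del: mult_Suc of_nat_mult of_nat_Suc)
      also have "\<dots> \<le> C / \<rho>"
        using C[of "Suc m * M"] \<rho> by (intro divide_right_mono) auto
      finally have "(real (Suc m * M) * \<rho> ^ e m)\<^sup>2 \<le> (C / \<rho>)\<^sup>2"
        using \<rho> by (intro power_mono) auto
      then have "(real (Suc m * M) * \<rho> ^ e m)\<^sup>2 * (norm (4 * \<rho> * ln (1 / \<rho>)) * norm (b m)) \<le>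
          (C / \<rho>)\<^sup>2 * (norm (4 * \<rho> * ln (1 / \<rho>)) * norm (b m))"
        by (intro mult_right_mono) auto
      moreover have "norm (t m \<rho>) = (real (Suc m * M) * \<rho> ^ e m)\<^sup>2 * (norm (4 * \<rho> * ln (1 / \<rho>)) * norm (b m))"
      proof -
        define l where "l = 4 * \<rho> * ln (1 / \<rho>)"
        have "t m \<rho> = of_real ((real (Suc m * M) * \<rho> ^ e m)\<^sup>2) * of_real l * b m"
          unfolding t_sums[OF True] l_def[symmetric]
          by (simp only: of_real_mult of_real_power of_real_of_nat_eq power_mult_distrib power_mult mult_ac)
        then show ?thesis
          unfolding l_def[symmetric] by (simp only: norm_mult norm_of_real mult.assoc real_norm_def abs_power2)
      qed
      ultimately have "norm (t m \<rho>) \<le> norm (4 * \<rho> * ln (1 / \<rho>)) * (C / \<rho>)\<^sup>2 * norm (b m)"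
        by (simp only: mult_ac)
      then show "norm (norm (t m \<rho>)) \<le> norm (4 * \<rho> * ln (1 / \<rho>)) * (C / \<rho>)\<^sup>2 *
          norm (taylor f (Suc m * M) * of_real s ^ Suc m)"
        by (simp only: b_def real_norm_def abs_norm_cancel)
    qed
  qed (simp add: t_def w_def)
  have *: "summable (\<lambda>m. integral\<^sup>L lborel (\<lambda>\<rho>. norm (t m \<rho>)))"
    unfolding t_norm using sm by (simp add: b_def)
  have "integrable lborel (\<lambda>\<rho>. \<Sum>m. t m \<rho>)" "(\<lambda>m. integral\<^sup>L lborel (t m)) sums (\<integral>\<rho>. (\<Sum>m. t m \<rho>) \<partial>lborel)"
    using abs by (auto intro!: integrable_suminf sums_integral t_int *)
  then show ?thesis
    unfolding has_bochner_integral_iff t_val sums_unique[OF sums, symmetric]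
    by (simp add: b_def sums_iff)
qed

section \<open>The lower bound for the seminorm\<close>

lemma log_weight_le:
  assumes "0 < \<rho>" "\<rho> < (1::real)"
  shows "0 \<le> \<rho> * ln (1 / \<rho>)" "\<rho> * ln (1 / \<rho>) \<le> 1 - \<rho>"
proof -
  show "0 \<le> \<rho> * ln (1 / \<rho>)" using assms by (simp add: ln_div mult_nonneg_nonpos)
  have "ln (1 / \<rho>) \<le> 1 / \<rho> - 1" using assms by (intro ln_le_minus_one) auto
  then have "\<rho> * ln (1 / \<rho>) \<le> \<rho> * (1 / \<rho> - 1)" using assms by (intro mult_left_mono) auto
  also have "\<dots> = 1 - \<rho>" using assms by (simp add: right_diff_distrib)
  finally show "\<rho> * ln (1 / \<rho>) \<le> 1 - \<rho>" .
qed

lemma radius_power: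
  assumes "n \<ge> 2"
  shows "0 < radius n k" "radius n k < 1" "radius n k ^ 2 ^ k = 1 - 1 / real n"
proof -
  have n: "0 < 1 - 1 / real n" "1 - 1 / real n < 1" using assms by auto
  show "0 < radius n k" using n by (simp add: radius_def)
  show "radius n k < 1" unfolding radius_def using n powr_less_mono2[of "2 powr (- real k)" "1 - 1 / real n" 1] by simp
  have "radius n k ^ 2 ^ k = (1 - 1 / real n) powr (2 powr (- real k) * 2 ^ k)"
    using n by (simp add: radius_def powr_powr flip: powr_realpow)
  also have "2 powr (- real k) * 2 ^ k = 1"
    by (simp add: powr_minus powr_realpow)
  finally show "radius n k ^ 2 ^ k = 1 - 1 / real n" using n by simp
qed

text \<open>Vanishing at the points of the sequence, free of the bookkeeping of lists and multiplicities.\<close>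

definition vanishes_on_grid :: "nat \<Rightarrow> (complex \<Rightarrow> complex) \<Rightarrow> bool" where
  "vanishes_on_grid n f \<longleftrightarrow>
    (\<forall>k\<in>{1..n}. \<forall>j\<in>{1..2 ^ k}. f (of_real (radius n k) * cis (2 * pi * real j / 2 ^ k)) = 0)"

lemma scale_coefficients:
  assumes f: "f holomorphic_on ball 0 1" "f 0 = 1" and n: "n \<ge> 2"
    and zero: "vanishes_on_grid n f" and k: "k \<in> {1..n}"
  defines "s \<equiv> 1 - 1 / real n"
  shows "summable (\<lambda>m. norm (taylor f (Suc m * 2 ^ k) * of_real s ^ Suc m))"
    and "(\<Sum>m. taylor f (Suc m * 2 ^ k) * of_real s ^ Suc m) = - 1"
proof -
  note r = radius_power[OF n, of k, folded s_def]
  have z: "f (of_real (radius n k) * cis (2 * pi * real j / real (2 ^ k))) = 0" if "j \<in> {1..2 ^ k}" for j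
    using zero k that by (simp add: vanishes_on_grid_def)
  have sum2: "summable (\<lambda>m. norm (taylor f (2 ^ k * m) * of_real s ^ m))"
    using roots_of_unity_mean(2)[OF f(1) r(1,2) _ z] unfolding r(3) by simp
  then have "summable (\<lambda>m. norm (taylor f (2 ^ k * Suc m) * of_real s ^ Suc m))"
    by (subst summable_Suc_iff)
  then show "summable (\<lambda>m. norm (taylor f (Suc m * 2 ^ k) * of_real s ^ Suc m))"
    by (simp only: mult.commute)
  have "(\<lambda>m. taylor f (2 ^ k * m) * of_real s ^ m) sums 0"
    using roots_of_unity_mean(1)[OF f(1) r(1,2) _ z] unfolding r(3) by simp
  then have "(\<lambda>m. taylor f (2 ^ k * Suc m) * of_real s ^ Suc m) sums (0 - taylor f (2 ^ k * 0) * of_real s ^ 0)"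
    by (subst sums_Suc_iff) simp
  then show "(\<Sum>m. taylor f (Suc m * 2 ^ k) * of_real s ^ Suc m) = - 1"
    using f(2) by (simp only: sums_iff mult.commute) (simp add: taylor_def)
qed

text \<open>The \<open>n\<close> identities for the single blocks are added before absolute values are taken. The
resulting lower bound \<open>n/4\<close> is the only information about the zeros of \<open>f\<close> that is used.\<close>

lemma scale_mean_total:
  assumes f: "f holomorphic_on ball 0 1" "f 0 = 1" and n: "n \<ge> 2"
    and zero: "vanishes_on_grid n f"
  defines "s \<equiv> 1 - 1 / real n"
  shows "ennreal (real n / 4) \<le>
    (\<integral>\<^sup>+\<rho>\<in>{0<..<1}. ennreal ((1 - \<rho>) * norm (\<Sum>k=1..n. scale_mean f s (2 ^ k) \<rho>)) \<partial>lborel)"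
    and "(\<lambda>\<rho>. indicator {0<..<1} \<rho> *\<^sub>R (\<Sum>k=1..n. scale_mean f s (2 ^ k) \<rho>)) \<in> borel_measurable borel"
proof -
  have s: "0 \<le> s" "s < 1" using n by (auto simp: s_def)
  define G where "G \<rho> = (\<Sum>k=1..n. scale_mean f s (2 ^ k) \<rho>)" for \<rho>
  define h where "h \<rho> = indicator {0<..<1} \<rho> *\<^sub>R (of_real (4 * \<rho> * ln (1 / \<rho>)) * G \<rho>)" for \<rho> :: real
  note coeff = scale_coefficients[OF f n zero, folded s_def]
  have "has_bochner_integral lborel (\<lambda>\<rho>. \<Sum>k=1..n. indicator {0<..<1} \<rho> *\<^sub>R
      (of_real (4 * \<rho> * ln (1 / \<rho>)) * scale_mean f s (2 ^ k) \<rho>))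
      (\<Sum>k=1..n. \<Sum>m. taylor f (Suc m * 2 ^ k) * of_real s ^ Suc m)"
    using coeff(1) by (intro has_bochner_integral_sum scale_mean_integral f s) auto
  also have "(\<Sum>k=1..n. \<Sum>m. taylor f (Suc m * 2 ^ k) * of_real s ^ Suc m) = (\<Sum>k=1..n. - 1)"
    using coeff(2) by (intro sum.cong) auto
  also have "(\<lambda>\<rho>. \<Sum>k=1..n. indicator {0<..<1} \<rho> *\<^sub>R (of_real (4 * \<rho> * ln (1 / \<rho>)) * scale_mean f s (2 ^ k) \<rho>)) = h"
    unfolding h_def G_def sum_distrib_left scaleR_sum_right ..
  finally have h: "has_bochner_integral lborel h (- of_nat n)" by simp
  then have hm: "h \<in> borel_measurable borel" by (auto dest: borel_measurable_has_bochner_integral)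
  have "(\<lambda>\<rho>. h \<rho> / of_real (4 * \<rho> * ln (1 / \<rho>))) \<in> borel_measurable borel"
    using hm by measurable
  also have "(\<lambda>\<rho>. h \<rho> / of_real (4 * \<rho> * ln (1 / \<rho>))) = (\<lambda>\<rho>. indicator {0<..<1} \<rho> *\<^sub>R G \<rho>)"
    by (auto simp: h_def split: split_indicator)
  finally have Gm: "(\<lambda>\<rho>. indicator {0<..<1} \<rho> *\<^sub>R G \<rho>) \<in> borel_measurable borel" .
  then show "(\<lambda>\<rho>. indicator {0<..<1} \<rho> *\<^sub>R (\<Sum>k=1..n. scale_mean f s (2 ^ k) \<rho>)) \<in> borel_measurable borel"
    by (simp add: G_def)
  have gm: "(\<lambda>\<rho>. ennreal ((1 - \<rho>) * norm (indicator {0<..<1} \<rho> *\<^sub>R G \<rho>))) \<in> borel_measurable borel"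
    using Gm by measurable
  have "ennreal (real n) = ennreal (norm (integral\<^sup>L lborel h))"
    using h by (simp add: has_bochner_integral_iff)
  also have "\<dots> \<le> (\<integral>\<^sup>+\<rho>. ennreal (norm (h \<rho>)) \<partial>lborel)"
    using h by (intro integral_norm_bound_ennreal) (simp add: has_bochner_integral_iff)
  also have "\<dots> \<le> (\<integral>\<^sup>+\<rho>. ennreal 4 * ennreal ((1 - \<rho>) * norm (indicator {0<..<1} \<rho> *\<^sub>R G \<rho>)) \<partial>lborel)"
  proof (rule nn_integral_mono)
    fix \<rho> :: real
    show "ennreal (norm (h \<rho>)) \<le> ennreal 4 * ennreal ((1 - \<rho>) * norm (indicator {0<..<1} \<rho> *\<^sub>R G \<rho>))"
    proof (cases "\<rho> \<in> {0<..<1}")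
      case True
      then have l: "0 \<le> \<rho> * ln (1 / \<rho>)" "\<rho> * ln (1 / \<rho>) \<le> 1 - \<rho>" using log_weight_le[of \<rho>] by auto
      have "norm (h \<rho>) = 4 * ((\<rho> * ln (1 / \<rho>)) * norm (G \<rho>))"
        using True l unfolding h_def by (simp only: norm_mult norm_of_real indicator_simps scaleR_one mult.assoc abs_mult) simp
      also have "\<dots> \<le> 4 * ((1 - \<rho>) * norm (G \<rho>))"
        using l by (intro mult_left_mono mult_right_mono) auto
      finally have "ennreal (norm (h \<rho>)) \<le> ennreal (4 * ((1 - \<rho>) * norm (G \<rho>)))"
        by (rule ennreal_leI)
      also have "\<dots> = ennreal 4 * ennreal ((1 - \<rho>) * norm (G \<rho>))"
        using True by (intro ennreal_mult'') auto
      finally show ?thesis using True by simp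
    qed (simp add: h_def)
  qed
  also have "\<dots> = ennreal 4 * (\<integral>\<^sup>+\<rho>. ennreal ((1 - \<rho>) * norm (indicator {0<..<1} \<rho> *\<^sub>R G \<rho>)) \<partial>lborel)"
    using gm by (intro nn_integral_cmult) simp
  also have "(\<integral>\<^sup>+\<rho>. ennreal ((1 - \<rho>) * norm (indicator {0<..<1} \<rho> *\<^sub>R G \<rho>)) \<partial>lborel) =
      (\<integral>\<^sup>+\<rho>\<in>{0<..<1}. ennreal ((1 - \<rho>) * norm (G \<rho>)) \<partial>lborel)"
    by (intro nn_integral_cong) (auto split: split_indicator)
  finally have "ennreal (1 / 4) * ennreal (real n) \<le> ennreal (1 / 4) * (ennreal 4 * (\<integral>\<^sup>+\<rho>\<in>{0<..<1}. ennreal ((1 - \<rho>) * norm (G \<rho>)) \<partial>lborel))"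
    by (rule mult_left_mono) simp
  then show "ennreal (real n / 4) \<le>
    (\<integral>\<^sup>+\<rho>\<in>{0<..<1}. ennreal ((1 - \<rho>) * norm (\<Sum>k=1..n. scale_mean f s (2 ^ k) \<rho>)) \<partial>lborel)"
    unfolding G_def[symmetric] mult.assoc[symmetric] ennreal_mult''[symmetric, OF zero_le_numeral]
    by (simp flip: ennreal_mult'')
qed

text \<open>Dividing the total mean by the kernel bound \<open>C growth \<phi>\<close> gives a measurable function \<open>D\<close> below the
\<open>L^p\<close> norm of \<open>f'\<close> whose integral against the cut-off \<open>\<phi>\<close> is at least of order \<open>n / growth\<close>.\<close>

lemma besov_seminorm_lower_bound:
  fixes p q :: ennreal
  assumes p: "1 \<le> p" and q: "1 \<le> q" and f: "f holomorphic_on ball 0 1" "f 0 = 1" and n: "n \<ge> 2"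
    and zero: "vanishes_on_grid n f"
  defines "a \<equiv> enn2real (1 / p)"
  defines "C \<equiv> (if a = 0 then 4 else 4 / a)"
  shows "ennreal ((4 * real n) powr enn2real (1 / q) / (32 * C * growth a n)) \<le> besov_seminorm p q f"
proof -
  define s where "s = 1 - 1 / real n"
  have s: "0 \<le> s" "s < 1" using n by (auto simp: s_def)
  have a: "0 \<le> a" "a \<le> 1"
    unfolding a_def by (rule exponent_cases[OF p]; simp)+
  have C: "C \<ge> 4" "C > 0" using a by (auto simp: C_def field_simps)
  have g: "growth a n > 0" using n by (rule growth_pos)
  define A where "A = real n * 2 ^ (n + 1)"
  have A: "1 \<le> A"
    using mult_mono[of 1 "real n" 1 "2 ^ (n + 1)"] n by (simp add: A_def del: power_Suc)
  have lnA: "1 + ln A \<le> 4 * real n"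
  proof -
    have "ln A = ln (real n) + real (n + 1) * ln 2"
      using n by (simp add: A_def ln_mult ln_realpow del: power_Suc)
    moreover have "ln (real n) \<le> real n - 1" using n by (intro ln_le_minus_one) auto
    moreover have "real (n + 1) * ln 2 \<le> real (n + 1) * 1"
      using ln_le_minus_one[of 2] by (intro mult_left_mono) auto
    moreover have "real (n + 1) * 1 = real n + 1" "2 \<le> real n" using n by simp_all
    ultimately show ?thesis by linarith
  qed
  define \<phi> where "\<phi> \<rho> = min 1 (A * (1 - \<rho>))" for \<rho>
  define G where "G \<rho> = (\<Sum>k=1..n. scale_mean f s (2 ^ k) \<rho>)" for \<rho>
  define D where "D \<rho> = (1 - \<rho>) * norm (indicator {0<..<1} \<rho> *\<^sub>R G \<rho>) / (C * growth a n * \<phi> \<rho>)" for \<rho>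
  note total = scale_mean_total[OF f n zero, folded s_def, folded G_def]
  have \<phi>pos: "\<phi> \<rho> > 0" if "\<rho> \<in> {0<..<1}" for \<rho>
    using that A by (auto simp: \<phi>_def)
  have kernel: "(\<Sum>k=1..n. (1 - \<rho>) * (2 ^ k * \<rho> ^ (2 ^ k - 1)) * (1 - s * \<rho> ^ 2 ^ k) powr (- 1 - a))
      \<le> C * growth a n * \<phi> \<rho>" if "0 < \<rho>" "\<rho> < 1" for \<rho>
  proof -
    have "2 * growth a n * (A * (1 - \<rho>)) \<le> C * growth a n * (A * (1 - \<rho>))"
      using C g A that by (intro mult_right_mono) auto
    with kernel_scales_le_boundary[OF a n that, folded s_def A_def]
    have le: "(\<Sum>k=1..n. (1 - \<rho>) * (2 ^ k * \<rho> ^ (2 ^ k - 1)) * (1 - s * \<rho> ^ 2 ^ k) powr (- 1 - a))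
      \<le> C * growth a n * (A * (1 - \<rho>))"
      by (rule order_trans)
    show ?thesis
    proof (cases "1 \<le> A * (1 - \<rho>)")
      case True
      then have "\<phi> \<rho> = 1" by (simp add: \<phi>_def)
      then show ?thesis
        using kernel_scales_le_growth[OF a n that, folded s_def C_def] by (simp only: mult_1_right)
    next
      case False
      then have "\<phi> \<rho> = A * (1 - \<rho>)" by (simp add: \<phi>_def)
      then show ?thesis using le by (simp only:)
    qed
  qed
  have "ennreal ((4 * real n) powr enn2real (1 / q) / (2 * (16 * C * growth a n))) \<le> besov_seminorm p q f"
  proof (rule besov_seminorm_ge[OF q _ _ _ A lnA])
    show "D \<in> borel_measurable borel"
      unfolding D_def \<phi>_def using total(2) by measurable
    show "0 \<le> D \<rho>" for \<rho>
      using C g \<phi>pos[of \<rho>] by (cases "\<rho> \<in> {0<..<1}") (auto simp: D_def)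
    show "0 < 16 * C * growth a n" using C g by simp
    show "ennreal (D \<rho>) \<le> Lp_norm p circle_measure (\<lambda>\<zeta>. deriv f (of_real \<rho> * \<zeta>))"
      if \<rho>: "0 < \<rho>" "\<rho> < 1" for \<rho>
    proof (cases "Lp_norm p circle_measure (\<lambda>\<zeta>. deriv f (of_real \<rho> * \<zeta>))")
      case (real L)
      define x where "x k = 2 ^ k * \<rho> ^ (2 ^ k - 1) * (1 - s * \<rho> ^ 2 ^ k) powr (- 1 - a)" for k :: nat
      have "norm (scale_mean f s (2 ^ k) \<rho>) \<le> L * x k" for k
      proof -
        have x0: "0 \<le> x k" using \<rho> by (simp add: x_def)
        have "ennreal (norm (scale_mean f s (2 ^ k) \<rho>)) \<le> ennreal L * ennreal (x k)"
          using scale_mean_le_Lp_norm[OF f(1) \<rho> s _ p, of "2 ^ k"] by (simp add: real(2) x_def a_def)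
        with x0 real(1) show ?thesis by (simp flip: ennreal_mult'')
      qed
      then have "norm (G \<rho>) \<le> (\<Sum>k=1..n. L * x k)"
        unfolding G_def by (intro order_trans[OF norm_sum] sum_mono)
      then have "(1 - \<rho>) * norm (G \<rho>) \<le> (1 - \<rho>) * (\<Sum>k=1..n. L * x k)"
        using \<rho> by (intro mult_left_mono) auto
      also have "\<dots> = L * (\<Sum>k=1..n. (1 - \<rho>) * x k)"
        by (simp add: sum_distrib_left mult_ac)
      also have "\<dots> \<le> L * (C * growth a n * \<phi> \<rho>)"
        using kernel[OF \<rho>] real(1) by (intro mult_left_mono) (simp_all add: x_def mult.assoc)
      finally have "D \<rho> \<le> L"
        using C g \<phi>pos[of \<rho>] \<rho> by (simp add: D_def pos_divide_le_eq)
      then show ?thesis unfolding real(2) by (rule ennreal_leI)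
    qed simp
    have "4 * real n / (16 * C * growth a n) = 1 / (C * growth a n) * (real n / 4)" by simp
    then have "ennreal (4 * real n / (16 * C * growth a n)) = ennreal (1 / (C * growth a n)) * ennreal (real n / 4)"
      by (simp only: ennreal_mult'' divide_nonneg_pos of_nat_0_le_iff zero_less_numeral)
    also have "\<dots> \<le> ennreal (1 / (C * growth a n)) *
        (\<integral>\<^sup>+\<rho>\<in>{0<..<1}. ennreal ((1 - \<rho>) * norm (G \<rho>)) \<partial>lborel)"
      using total(1) by (rule mult_left_mono) simp
    also have "(\<integral>\<^sup>+\<rho>\<in>{0<..<1}. ennreal ((1 - \<rho>) * norm (G \<rho>)) \<partial>lborel) =
        (\<integral>\<^sup>+\<rho>. ennreal ((1 - \<rho>) * norm (indicator {0<..<1} \<rho> *\<^sub>R G \<rho>)) \<partial>lborel)"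
      by (intro nn_integral_cong) (auto split: split_indicator)
    also have "ennreal (1 / (C * growth a n)) * \<dots> =
        (\<integral>\<^sup>+\<rho>. ennreal (1 / (C * growth a n)) * ennreal ((1 - \<rho>) * norm (indicator {0<..<1} \<rho> *\<^sub>R G \<rho>)) \<partial>lborel)"
    proof (rule nn_integral_cmult[symmetric])
      have "(\<lambda>\<rho>. ennreal ((1 - \<rho>) * norm (indicator {0<..<1} \<rho> *\<^sub>R G \<rho>))) \<in> borel_measurable borel"
        using total(2) by measurable
      then show "(\<lambda>\<rho>. ennreal ((1 - \<rho>) * norm (indicator {0<..<1} \<rho> *\<^sub>R G \<rho>))) \<in> borel_measurable lborel"
        by simp
    qed
    also have "\<dots> = (\<integral>\<^sup>+\<rho>\<in>{0<..<1}. ennreal (min 1 (A * (1 - \<rho>)) * D \<rho>) \<partial>lborel)"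
    proof (rule nn_integral_cong)
      fix \<rho> :: real
      show "ennreal (1 / (C * growth a n)) * ennreal ((1 - \<rho>) * norm (indicator {0<..<1} \<rho> *\<^sub>R G \<rho>)) =
        ennreal (min 1 (A * (1 - \<rho>)) * D \<rho>) * indicator {0<..<1} \<rho>"
      proof (cases "\<rho> \<in> {0<..<1}")
        case True
        have "ennreal (1 / (C * growth a n)) * ennreal ((1 - \<rho>) * norm (indicator {0<..<1} \<rho> *\<^sub>R G \<rho>)) =
            ennreal (1 / (C * growth a n) * ((1 - \<rho>) * norm (indicator {0<..<1} \<rho> *\<^sub>R G \<rho>)))"
          using True by (intro ennreal_mult''[symmetric]) auto
        also have "1 / (C * growth a n) * ((1 - \<rho>) * norm (indicator {0<..<1} \<rho> *\<^sub>R G \<rho>)) = \<phi> \<rho> * D \<rho>"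
          unfolding D_def using \<phi>pos[OF True] by (simp add: divide_simps)
        finally show ?thesis using True by (simp add: \<phi>_def)
      qed simp
    qed
    finally show "ennreal (4 * real n / (16 * C * growth a n)) \<le>
      (\<integral>\<^sup>+\<rho>\<in>{0<..<1}. ennreal (min 1 (A * (1 - \<rho>)) * D \<rho>) \<partial>lborel)" .
  qed
  then show ?thesis by (simp add: mult.assoc)
qed

section \<open>The seminorm of a bounded holomorphic function\<close>

text \<open>Parseval's identity on the circle of radius \<open>\<rho> < 1\<close>, followed by the limit \<open>\<rho> \<rightarrow> 1\<close> in each partial sum.\<close>

lemma bounded_holomorphic_bessel:
  assumes F: "F holomorphic_on ball 0 1" "\<And>z. norm z < 1 \<Longrightarrow> norm (F z) \<le> K"
  shows "(\<Sum>i<m. (norm (taylor F i))\<^sup>2) \<le> K\<^sup>2"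
proof -
  interpret prob_space circle_measure by (rule prob_space_circle)
  have *: "(\<Sum>i<m. (norm (taylor F i))\<^sup>2 * \<rho> ^ (2 * i)) \<le> K\<^sup>2" if \<rho>: "0 < \<rho>" "\<rho> < 1" for \<rho> :: real
  proof -
    define c where "c i = taylor F i * of_real \<rho> ^ i" for i
    have c: "summable (\<lambda>i. norm (c i))"
      using taylor_sums(2)[OF F(1), of "of_real \<rho>"] \<rho> by (simp add: c_def)
    have val: "(\<Sum>i. c i * z ^ i) = F (of_real \<rho> * z)" if "norm z = 1" for z
      using taylor_sums(1)[OF F(1), of "of_real \<rho> * z"] \<rho> that
      by (simp add: sums_iff norm_mult c_def power_mult_distrib mult_ac)
    have pars: "(\<lambda>i. (norm (c i))\<^sup>2) sums integral\<^sup>L circle_measure (\<lambda>z. (norm (\<Sum>i. c i * z ^ id i))\<^sup>2)"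
      by (rule circle_parseval[OF c]) simp
    have "(\<Sum>i<m. (norm (taylor F i))\<^sup>2 * \<rho> ^ (2 * i)) = (\<Sum>i<m. (norm (c i))\<^sup>2)"
      using \<rho> by (simp add: c_def norm_mult norm_power power_mult_distrib power_mult mult.commute)
    also have "\<dots> \<le> (\<Sum>i. (norm (c i))\<^sup>2)"
      using pars by (intro sum_le_suminf) (auto simp: sums_iff)
    also have "\<dots> = integral\<^sup>L circle_measure (\<lambda>z. (norm (\<Sum>i. c i * z ^ id i))\<^sup>2)"
      using pars by (simp add: sums_iff)
    also have "\<dots> \<le> K\<^sup>2"
    proof (rule integral_le_const)
      have bd: "norm ((norm (\<Sum>i. c i * z ^ id i))\<^sup>2) \<le> K\<^sup>2" if "norm z = 1" for z
        using F(2)[of "of_real \<rho> * z"] \<rho> that by (simp add: val norm_mult power_mono)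
      then show "integrable circle_measure (\<lambda>z. (norm (\<Sum>i. c i * z ^ id i))\<^sup>2)"
        using continuous_circle_series(1)[OF c, of id]
        by (intro integrable_circle measurable_circle) (auto intro!: continuous_intros)
      show "AE z in circle_measure. (norm (\<Sum>i. c i * z ^ id i))\<^sup>2 \<le> K\<^sup>2"
        using bd by (intro AE_I2) simp
    qed
    finally show ?thesis .
  qed
  have "((\<lambda>\<rho>::real. \<Sum>i<m. (norm (taylor F i))\<^sup>2 * \<rho> ^ (2 * i)) \<longlongrightarrow>
      (\<Sum>i<m. (norm (taylor F i))\<^sup>2 * 1 ^ (2 * i))) (at_left 1)"
    by (intro tendsto_intros)
  moreover have "\<forall>\<^sub>F \<rho> in at_left (1::real). 0 < \<rho> \<and> \<rho> < 1"
    by (auto simp: eventually_at_left_field intro: exI[of _ 0])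
  then have "\<forall>\<^sub>F \<rho> in at_left (1::real). (\<Sum>i<m. (norm (taylor F i))\<^sup>2 * \<rho> ^ (2 * i)) \<le> K\<^sup>2"
    by eventually_elim (use * in auto)
  ultimately have "(\<Sum>i<m. (norm (taylor F i))\<^sup>2 * 1 ^ (2 * i)) \<le> K\<^sup>2"
    by (rule tendsto_upperbound) simp
  then show ?thesis by simp
qed

text \<open>The integral equals \<open>1 / ((2i + 1) (2i + 2))\<close>; the weaker bound fits the factor \<open>(i + 1)^2\<close> that arises
from Parseval's identity for a derivative.\<close>

lemma area_moment:
  "(\<integral>\<^sup>+\<rho>\<in>{0<..<1}. ennreal ((1 - \<rho>) * \<rho> ^ (2 * i)) \<partial>lborel) \<le> ennreal (1 / ((real i + 1)\<^sup>2))"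
proof -
  define F where "F x = x ^ (2 * i + 1) / (2 * real i + 1) - x ^ (2 * i + 2) / (2 * real i + 2)" for x :: real
  have "(\<integral>\<^sup>+\<rho>\<in>{0<..<1}. ennreal ((1 - \<rho>) * \<rho> ^ (2 * i)) \<partial>lborel) \<le>
      (\<integral>\<^sup>+\<rho>. ennreal ((1 - \<rho>) * \<rho> ^ (2 * i)) * indicator {0..1} \<rho> \<partial>lborel)"
    by (intro nn_integral_mono) (auto split: split_indicator)
  also have "\<dots> = ennreal (F 1 - F 0)"
  proof (rule nn_integral_FTC_Icc)
    fix x :: real assume x: "x \<in> {0..1}"
    have "(F has_real_derivative
       (2 * real i + 1) * x ^ (2 * i) / (2 * real i + 1) - (2 * real i + 2) * x ^ (2 * i + 1) / (2 * real i + 2)) (at x)"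
      unfolding F_def using DERIV_pow[of "2 * i + 1" x] DERIV_pow[of "2 * i + 2" x]
      by (intro DERIV_diff DERIV_cdivide) (simp_all add: add.commute)
    also have "(2 * real i + 1) * x ^ (2 * i) / (2 * real i + 1) = x ^ (2 * i)"
      by (rule nonzero_mult_div_cancel_left) linarith
    also have "(2 * real i + 2) * x ^ (2 * i + 1) / (2 * real i + 2) = x ^ (2 * i + 1)"
      by (rule nonzero_mult_div_cancel_left) linarith
    finally show "(F has_real_derivative (1 - x) * x ^ (2 * i)) (at x)"
      by (simp add: algebra_simps)
    show "0 \<le> (1 - x) * x ^ (2 * i)" using x by auto
  qed auto
  also have "F 1 - F 0 \<le> 1 / ((real i + 1)\<^sup>2)"
  proof -
    have "F 1 - F 0 = 1 / ((2 * real i + 1) * (2 * real i + 2))"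
      by (simp add: F_def divide_simps)
    also have "\<dots> \<le> 1 / ((real i + 1) * (real i + 1))"
      by (intro divide_left_mono mult_mono) auto
    finally show ?thesis by (simp add: power2_eq_square)
  qed
  finally show ?thesis by (simp add: ennreal_leI)
qed

text \<open>By Parseval's identity the integral is a combination of the \<open>|a_(i+1)|^2\<close>, \<open>a_i\<close> being the Taylor
coefficients of \<open>F\<close>, with weights \<open>(i + 1)^2\<close> times the integral of \<open>area_moment\<close>. These weights are
at most \<open>1\<close>, and Bessel's inequality applies.\<close>

lemma bounded_holomorphic_area:
  assumes F: "F holomorphic_on ball 0 1" "\<And>z. norm z < 1 \<Longrightarrow> norm (F z) \<le> K"
  shows "(\<integral>\<^sup>+\<rho>\<in>{0<..<1}. ennreal ((1 - \<rho>) *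
      integral\<^sup>L circle_measure (\<lambda>\<zeta>. (norm (deriv F (of_real \<rho> * \<zeta>)))\<^sup>2)) \<partial>lborel) \<le> ennreal (K\<^sup>2)"
    and "(\<lambda>\<rho>. indicator {0<..<1} \<rho> *
      integral\<^sup>L circle_measure (\<lambda>\<zeta>. (norm (deriv F (of_real \<rho> * \<zeta>)))\<^sup>2)) \<in> borel_measurable borel"
proof -
  define X where "X \<rho> = integral\<^sup>L circle_measure (\<lambda>\<zeta>. (norm (deriv F (of_real \<rho> * \<zeta>)))\<^sup>2)" for \<rho>
  define d where "d i = (real (Suc i))\<^sup>2 * (norm (taylor F (Suc i)))\<^sup>2" for i
  have d0: "0 \<le> d i" for i by (simp add: d_def)
  have X: "(\<lambda>i. d i * \<rho> ^ (2 * i)) sums X \<rho>" if \<rho>: "0 < \<rho>" "\<rho> < 1" for \<rho>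
  proof -
    define c where "c i = of_nat (Suc i) * taylor F (Suc i) * of_real \<rho> ^ i" for i
    note c = deriv_circle_series[OF F(1) less_imp_le[OF \<rho>(1)] \<rho>(2), folded c_def]
    have "(\<lambda>i. (norm (c i))\<^sup>2) sums integral\<^sup>L circle_measure (\<lambda>z. (norm (\<Sum>i. c i * z ^ id i))\<^sup>2)"
      by (rule circle_parseval[OF c(1)]) simp
    also have "integral\<^sup>L circle_measure (\<lambda>z. (norm (\<Sum>i. c i * z ^ id i))\<^sup>2) = X \<rho>"
      unfolding X_def using c(2) by (intro Bochner_Integration.integral_cong) auto
    also have "(\<lambda>i. (norm (c i))\<^sup>2) = (\<lambda>i. d i * \<rho> ^ (2 * i))"
      unfolding c_def d_def norm_mult norm_power norm_of_nat norm_of_real power_mult_distrib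
      using \<rho> by (simp add: mult.commute flip: power_mult)
    finally show ?thesis .
  qed
  have "(\<lambda>\<rho>. \<Sum>i. indicator {0<..<1} \<rho> * (d i * \<rho> ^ (2 * i))) \<in> borel_measurable borel"
    by measurable
  also have "(\<lambda>\<rho>. \<Sum>i. indicator {0<..<1} \<rho> * (d i * \<rho> ^ (2 * i))) = (\<lambda>\<rho>. indicator {0<..<1} \<rho> * X \<rho>)"
    using X by (auto simp: sums_iff split: split_indicator)
  finally show "(\<lambda>\<rho>. indicator {0<..<1} \<rho> *
      integral\<^sup>L circle_measure (\<lambda>\<zeta>. (norm (deriv F (of_real \<rho> * \<zeta>)))\<^sup>2)) \<in> borel_measurable borel"
    by (simp add: X_def)
  have "(\<integral>\<^sup>+\<rho>\<in>{0<..<1}. ennreal ((1 - \<rho>) * X \<rho>) \<partial>lborel) =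
      (\<integral>\<^sup>+\<rho>. (\<Sum>i. ennreal (d i) * (ennreal ((1 - \<rho>) * \<rho> ^ (2 * i)) * indicator {0<..<1} \<rho>)) \<partial>lborel)"
  proof (rule nn_integral_cong)
    fix \<rho> :: real
    show "ennreal ((1 - \<rho>) * X \<rho>) * indicator {0<..<1} \<rho> =
      (\<Sum>i. ennreal (d i) * (ennreal ((1 - \<rho>) * \<rho> ^ (2 * i)) * indicator {0<..<1} \<rho>))"
    proof (cases "\<rho> \<in> {0<..<1}")
      case True
      then have "(\<lambda>i. (1 - \<rho>) * (d i * \<rho> ^ (2 * i))) sums ((1 - \<rho>) * X \<rho>)"
        by (intro sums_mult X) auto
      moreover have "0 \<le> (1 - \<rho>) * (d i * \<rho> ^ (2 * i))" for i using True d0 by auto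
      ultimately have "(\<Sum>i. ennreal ((1 - \<rho>) * (d i * \<rho> ^ (2 * i)))) = ennreal ((1 - \<rho>) * X \<rho>)"
        by (simp add: suminf_ennreal2 sums_iff)
      moreover have "ennreal ((1 - \<rho>) * (d i * \<rho> ^ (2 * i))) = ennreal (d i) * ennreal ((1 - \<rho>) * \<rho> ^ (2 * i))" for i
        using d0[of i] by (simp add: mult.left_commute ennreal_mult')
      ultimately show ?thesis using True by simp
    qed simp
  qed
  also have "\<dots> = (\<Sum>i. ennreal (d i) * (\<integral>\<^sup>+\<rho>\<in>{0<..<1}. ennreal ((1 - \<rho>) * \<rho> ^ (2 * i)) \<partial>lborel))"
    by (subst nn_integral_suminf) (auto simp: nn_integral_cmult)
  also have "\<dots> \<le> (\<Sum>i. ennreal ((norm (taylor F (Suc i)))\<^sup>2))"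
  proof (rule suminf_le)
    fix i
    have "ennreal (d i) * (\<integral>\<^sup>+\<rho>\<in>{0<..<1}. ennreal ((1 - \<rho>) * \<rho> ^ (2 * i)) \<partial>lborel) \<le>
        ennreal (d i) * ennreal (1 / (real i + 1)\<^sup>2)"
      by (intro mult_left_mono area_moment) simp
    also have "\<dots> = ennreal (d i * (1 / (real i + 1)\<^sup>2))"
      by (rule ennreal_mult''[symmetric]) simp
    also have "d i * (1 / (real i + 1)\<^sup>2) = (norm (taylor F (Suc i)))\<^sup>2"
    proof -
      have suc: "real i + 1 = real (Suc i)" by simp
      show ?thesis unfolding d_def suc by (simp del: of_nat_Suc)
    qed
    finally show "ennreal (d i) * (\<integral>\<^sup>+\<rho>\<in>{0<..<1}. ennreal ((1 - \<rho>) * \<rho> ^ (2 * i)) \<partial>lborel) \<le>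
        ennreal ((norm (taylor F (Suc i)))\<^sup>2)" .
  qed auto
  also have "\<dots> \<le> ennreal (K\<^sup>2)"
  proof -
    have le: "(\<Sum>i<m. (norm (taylor F (Suc i)))\<^sup>2) \<le> K\<^sup>2" for m
      using bounded_holomorphic_bessel[OF F, of "Suc m"] sum.lessThan_Suc_shift[of "\<lambda>i. (norm (taylor F i))\<^sup>2" m]
        zero_le_power2[of "norm (taylor F 0)"] by linarith
    then have sm: "summable (\<lambda>i. (norm (taylor F (Suc i)))\<^sup>2)"
      by (intro summableI_nonneg_bounded) auto
    then have "(\<Sum>i. (norm (taylor F (Suc i)))\<^sup>2) \<le> K\<^sup>2" using le by (rule suminf_le_const)
    then show ?thesis using sm by (simp add: suminf_ennreal2 ennreal_leI)
  qed
  finally show "(\<integral>\<^sup>+\<rho>\<in>{0<..<1}. ennreal ((1 - \<rho>) *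
      integral\<^sup>L circle_measure (\<lambda>\<zeta>. (norm (deriv F (of_real \<rho> * \<zeta>)))\<^sup>2)) \<partial>lborel) \<le> ennreal (K\<^sup>2)"
    by (simp add: X_def)
qed

text \<open>Cauchy's inequality on discs around \<open>z\<close> whose radius tends to the distance from the boundary.\<close>

lemma bounded_holomorphic_deriv:
  assumes F: "F holomorphic_on ball 0 1" "\<And>z. norm z < 1 \<Longrightarrow> norm (F z) \<le> K" and z: "norm z < 1"
  shows "(1 - norm z) * norm (deriv F z) \<le> K"
proof -
  have "r * norm (deriv F z) \<le> K" if r: "0 < r" "r < 1 - norm z" for r
  proof -
    have sub: "cball z r \<subseteq> ball 0 1"
    proof
      fix w assume "w \<in> cball z r"
      then show "w \<in> ball 0 1"
        using norm_triangle_ineq2[of w z] r by (simp add: dist_norm norm_minus_commute)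
    qed
    have "norm ((deriv ^^ 1) F z) \<le> fact 1 * K / r ^ 1"
    proof (rule Cauchy_inequality)
      show "F holomorphic_on ball z r"
        using F(1) by (rule holomorphic_on_subset) (use sub ball_subset_cball in blast)
      show "continuous_on (cball z r) F"
        using F(1) sub by (intro holomorphic_on_imp_continuous_on) (rule holomorphic_on_subset)
      show "norm (F x) \<le> K" if "norm (z - x) = r" for x
        using sub that by (intro F(2)) (auto simp: dist_norm subset_eq)
    qed (use r in auto)
    then show ?thesis using r by (simp add: field_simps)
  qed
  then have *: "r * norm (deriv F z) \<le> K" if "r < 1 - norm z" "0 < r" for r using that by blast
  have "((\<lambda>r. r * norm (deriv F z)) \<longlongrightarrow> (1 - norm z) * norm (deriv F z)) (at_left (1 - norm z))"
    by (intro tendsto_intros)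
  moreover have "\<forall>\<^sub>F r in at_left (1 - norm z). r * norm (deriv F z) \<le> K"
    using z * by (auto simp: eventually_at_left_field intro!: exI[of _ 0])
  ultimately show ?thesis by (rule tendsto_upperbound) simp
qed

lemma ennreal_powr_mono: "0 \<le> a \<Longrightarrow> x \<le> y \<Longrightarrow> ennreal_powr x a \<le> ennreal_powr y a"
  unfolding ennreal_powr_def
  by (auto simp: top_unique less_top intro!: ennreal_leI powr_mono2 enn2real_mono)

lemma ennreal_powr_ennreal [simp]: "0 \<le> x \<Longrightarrow> ennreal_powr (ennreal x) a = ennreal (x powr a)"
  by (simp add: ennreal_powr_def)

lemma powr_le_one_add:
  fixes x t :: real
  assumes "0 \<le> x" "0 \<le> t" "t \<le> 1"
  shows "x powr t \<le> 1 + x"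
proof (cases "x \<le> 1")
  case True
  then show ?thesis using powr_mono2[of t x 1] assms by simp
next
  case False
  then show ?thesis using powr_mono[of t 1 x] assms by simp
qed

text \<open>Put \<open>u = 1 - \<rho>\<close> and let \<open>X\<close> be the squared \<open>L^2\<close> norm of \<open>f'\<^sub>\<rho>\<close>. Since \<open>u |f'| \<le> K\<close> and
\<open>P \<ge> 2\<close>, the \<open>P\<close>-th power of \<open>u \<parallel>f'\<^sub>\<rho>\<parallel>\<^sub>P / K\<close> is at most \<open>y = u^2 X / K^2\<close>, and \<open>y / u\<close> has
integral at most \<open>1\<close>. With \<open>t = Q/P \<le> 1\<close> the inequality \<open>(n y)^t \<le> 1 + n y\<close> replaces Hoelder's
inequality in the passage to the exponent \<open>Q\<close>: on the range \<open>u \<ge> 1/A\<close> the integral of \<open>1/u\<close> is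
\<open>ln A\<close>, at most of order \<open>n\<close>. Where \<open>u < 1/A\<close> the trivial bound \<open>|f'| \<le> K A\<close> suffices.\<close>

lemma besov_seminorm_upper_bound:
  fixes P Q A K :: real
  assumes Q: "1 \<le> Q" "Q \<le> P" and P: "2 \<le> P" and n: "1 \<le> n" and K: "0 < K"
    and F: "F holomorphic_on ball 0 1" "\<And>z. norm z < 1 \<Longrightarrow> norm (F z) \<le> K"
    and A: "1 \<le> A" "ln A \<le> 4 * real n" "\<And>z. norm z < 1 \<Longrightarrow> norm (deriv F z) \<le> K * A"
  shows "besov_seminorm (ennreal P) (ennreal Q) F \<le> ennreal (7 * K * real n powr (1 / Q - 1 / P))"
proof -
  interpret prob_space circle_measure by (rule prob_space_circle)
  define X where "X \<rho> = integral\<^sup>L circle_measure (\<lambda>\<zeta>. (norm (deriv F (of_real \<rho> * \<zeta>)))\<^sup>2)" for \<rho>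
  note area = bounded_holomorphic_area[OF F, folded X_def]
  define t where "t = Q / P"
  have t: "0 \<le> t" "t \<le> 1" using Q by (auto simp: t_def)
  have PQ: "enn2real (ennreal P) = P" "enn2real (1 / ennreal P) = 1 / P"
      "enn2real (ennreal Q) = Q" "enn2real (1 / ennreal Q) = 1 / Q"
    using P Q by (auto simp: divide_ennreal simp flip: ennreal_1)
  have Lp: "Lp_norm (ennreal P) circle_measure g = ennreal_powr (\<integral>\<^sup>+\<zeta>. ennreal (norm (g \<zeta>) powr P) \<partial>circle_measure) (1 / P)" for g
    by (simp add: Lp_norm_def PQ)
  let ?L = "\<lambda>\<rho>. Lp_norm (ennreal P) circle_measure (\<lambda>\<zeta>. deriv F (of_real \<rho> * \<zeta>))"
  have trivial: "?L \<rho> \<le> ennreal (K * A)" if \<rho>: "0 < \<rho>" "\<rho> < 1" for \<rho>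
  proof -
    have "(\<integral>\<^sup>+\<zeta>. ennreal (norm (deriv F (of_real \<rho> * \<zeta>)) powr P) \<partial>circle_measure) \<le>
        (\<integral>\<^sup>+\<zeta>. ennreal ((K * A) powr P) \<partial>circle_measure)"
      using \<rho> P A by (intro nn_integral_mono ennreal_leI powr_mono2) (auto simp: norm_mult)
    also have "\<dots> = ennreal ((K * A) powr P)"
      using emeasure_space_1 by simp
    finally have "?L \<rho> \<le> ennreal_powr (ennreal ((K * A) powr P)) (1 / P)"
      unfolding Lp using P by (intro ennreal_powr_mono) auto
    then show ?thesis using P K A by (simp add: powr_powr)
  qed
  have interp: "?L \<rho> \<le> ennreal (((K / (1 - \<rho>)) powr (P - 2) * X \<rho>) powr (1 / P))" if \<rho>: "0 < \<rho>" "\<rho> < 1" for \<rho>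
  proof -
    have X0: "0 \<le> X \<rho>" by (simp add: X_def)
    have c: "continuous_on (sphere 0 1) (\<lambda>\<zeta>. deriv F (of_real \<rho> * \<zeta>))"
      using F(1) \<rho> by (intro continuous_deriv_circle) auto
    have "(\<integral>\<^sup>+\<zeta>. ennreal (norm (deriv F (of_real \<rho> * \<zeta>)) powr P) \<partial>circle_measure) \<le>
        (\<integral>\<^sup>+\<zeta>. ennreal ((K / (1 - \<rho>)) powr (P - 2)) * ennreal ((norm (deriv F (of_real \<rho> * \<zeta>)))\<^sup>2) \<partial>circle_measure)"
    proof (rule nn_integral_mono)
      fix \<zeta> assume "\<zeta> \<in> space circle_measure"
      then have nz: "norm (of_real \<rho> * \<zeta>) = \<rho>" using \<rho> by (simp add: norm_mult)
      define y where "y = norm (deriv F (of_real \<rho> * \<zeta>))"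
      have "y \<le> K / (1 - \<rho>)"
        using bounded_holomorphic_deriv[OF F, of "of_real \<rho> * \<zeta>"] \<rho> nz
        by (simp add: y_def pos_le_divide_eq mult.commute)
      moreover have y0: "0 \<le> y" by (simp add: y_def)
      ultimately have "y powr (P - 2) \<le> (K / (1 - \<rho>)) powr (P - 2)"
        using P by (intro powr_mono2) auto
      then have "y powr (P - 2) * y\<^sup>2 \<le> (K / (1 - \<rho>)) powr (P - 2) * y\<^sup>2"
        by (rule mult_right_mono) simp
      moreover have "y powr P = y powr (P - 2) * y\<^sup>2"
        using y0 by (cases "y = 0") (auto simp: powr_diff powr_numeral)
      ultimately show "ennreal (norm (deriv F (of_real \<rho> * \<zeta>)) powr P) \<le>
         ennreal ((K / (1 - \<rho>)) powr (P - 2)) * ennreal ((norm (deriv F (of_real \<rho> * \<zeta>)))\<^sup>2)"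
        unfolding y_def[symmetric] by (simp add: ennreal_leI flip: ennreal_mult'')
    qed
    also have "\<dots> = ennreal ((K / (1 - \<rho>)) powr (P - 2)) *
        (\<integral>\<^sup>+\<zeta>. ennreal ((norm (deriv F (of_real \<rho> * \<zeta>)))\<^sup>2) \<partial>circle_measure)"
      using c by (intro nn_integral_cmult measurable_compose[OF _ measurable_ennreal] measurable_circle continuous_intros)
    also have "(\<integral>\<^sup>+\<zeta>. ennreal ((norm (deriv F (of_real \<rho> * \<zeta>)))\<^sup>2) \<partial>circle_measure) = ennreal (X \<rho>)"
      unfolding X_def
    proof (rule nn_integral_eq_integral)
      show "integrable circle_measure (\<lambda>\<zeta>. (norm (deriv F (of_real \<rho> * \<zeta>)))\<^sup>2)"
      proof (rule integrable_circle)
        show "norm ((norm (deriv F (of_real \<rho> * \<zeta>)))\<^sup>2) \<le> (K * A)\<^sup>2" if "norm \<zeta> = 1" for \<zeta>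
          using A(3)[of "of_real \<rho> * \<zeta>"] \<rho> that by (simp add: norm_mult power_mono)
      qed (use c in \<open>auto intro!: measurable_circle continuous_intros\<close>)
    qed simp
    also have "ennreal ((K / (1 - \<rho>)) powr (P - 2)) * ennreal (X \<rho>) = ennreal ((K / (1 - \<rho>)) powr (P - 2) * X \<rho>)"
      using X0 by (simp add: ennreal_mult'')
    finally have "?L \<rho> \<le> ennreal_powr (ennreal ((K / (1 - \<rho>)) powr (P - 2) * X \<rho>)) (1 / P)"
      unfolding Lp using P by (intro ennreal_powr_mono) auto
    then show ?thesis using X0 by simp
  qed
  let ?c = "K powr Q * real n powr (- t)"
  have pointwise: "ennreal ((1 - \<rho>) powr (Q - 1)) * ennreal_powr (?L \<rho>) Q \<le>
      ennreal (?c * real n / K\<^sup>2) * ennreal ((1 - \<rho>) * X \<rho>) + ennreal ?c * ennreal (min 1 (A * (1 - \<rho>)) / (1 - \<rho>))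
      + ennreal (K powr Q * A) * indicator {1 - 1 / A..1} \<rho>"
    if \<rho>: "0 < \<rho>" "\<rho> < 1" for \<rho>
  proof -
    define u where "u = 1 - \<rho>"
    have u: "0 < u" using \<rho> by (simp add: u_def)
    have X0: "0 \<le> X \<rho>" by (simp add: X_def)
    show ?thesis
    proof (cases "A * u \<le> 1")
      case True
      have "ennreal (u powr (Q - 1)) * ennreal_powr (?L \<rho>) Q \<le> ennreal (u powr (Q - 1)) * ennreal ((K * A) powr Q)"
        using ennreal_powr_mono[OF _ trivial[OF \<rho>], of Q] Q K A by (intro mult_left_mono) auto
      also have "\<dots> = ennreal (u powr (Q - 1) * (K * A) powr Q)"
        by (simp add: ennreal_mult'')
      also have "u powr (Q - 1) * (K * A) powr Q = K powr Q * A * (A * u) powr (Q - 1)"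
        using u K A by (simp add: powr_mult powr_diff)
      also have "\<dots> \<le> K powr Q * A * 1"
        using True u A Q powr_mono2[of "Q - 1" "A * u" 1] by (intro mult_left_mono) auto
      also have "1 - 1 / A \<le> \<rho>" using True A by (simp add: u_def field_simps)
      then have "ennreal (K powr Q * A * 1) = ennreal (K powr Q * A) * indicator {1 - 1 / A..1} \<rho>"
        using \<rho> by simp
      finally show ?thesis unfolding u_def by (intro add_increasing) (auto simp: ennreal_leI)
    next
      case False
      define y where "y = u\<^sup>2 * X \<rho> / K\<^sup>2"
      have y0: "0 \<le> y" using X0 by (simp add: y_def)
      have "ennreal (u powr (Q - 1)) * ennreal_powr (?L \<rho>) Q \<le>
          ennreal (u powr (Q - 1)) * ennreal ((((K / u) powr (P - 2) * X \<rho>) powr (1 / P)) powr Q)"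
        using ennreal_powr_mono[OF _ interp[OF \<rho>], of Q] Q unfolding u_def by (intro mult_left_mono) auto
      also have "\<dots> = ennreal (u powr (Q - 1) * (((K / u) powr (P - 2) * X \<rho>) powr (1 / P)) powr Q)"
        by (simp add: ennreal_mult'')
      also have "u powr (Q - 1) * (((K / u) powr (P - 2) * X \<rho>) powr (1 / P)) powr Q = K powr Q * y powr t / u"
      proof -
        have e: "(K / u) powr (P - 2) * X \<rho> = (K / u) powr P * y"
          using u K by (simp add: y_def powr_diff powr_numeral power_divide)
        have "(((K / u) powr (P - 2) * X \<rho>) powr (1 / P)) powr Q = (K / u) powr Q * y powr t"
          unfolding e using u K y0 P by (simp add: powr_powr powr_mult powr_divide t_def)
        then show ?thesis using u K by (simp add: powr_divide powr_diff)
      qed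
      also have "\<dots> \<le> K powr Q * (real n powr (- t) * (1 + real n * y)) / u"
      proof -
        have "y powr t = real n powr (- t) * (real n * y) powr t"
          using n y0 by (simp add: powr_mult powr_minus)
        also have "\<dots> \<le> real n powr (- t) * (1 + real n * y)"
          using y0 t by (intro mult_left_mono powr_le_one_add) auto
        finally show ?thesis using u by (intro divide_right_mono mult_left_mono) auto
      qed
      also have "\<dots> = ?c * real n / K\<^sup>2 * (u * X \<rho>) + ?c * (1 / u)"
        using u K by (simp add: y_def field_simps power2_eq_square)
      also have "1 / u = min 1 (A * u) / u" using False by simp
      finally have *: "ennreal (u powr (Q - 1)) * ennreal_powr (?L \<rho>) Q \<le>
          ennreal (?c * real n / K\<^sup>2 * (u * X \<rho>) + ?c * (min 1 (A * u) / u))"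
        by (simp add: ennreal_leI)
      have "0 \<le> ?c * real n / K\<^sup>2 * (u * X \<rho>)" "0 \<le> u * X \<rho>" "0 \<le> min 1 (A * u) / u" "0 \<le> ?c * (min 1 (A * u) / u)"
        using u X0 A by auto
      then have "ennreal (?c * real n / K\<^sup>2 * (u * X \<rho>) + ?c * (min 1 (A * u) / u)) =
          ennreal (?c * real n / K\<^sup>2) * ennreal (u * X \<rho>) + ennreal ?c * ennreal (min 1 (A * u) / u)"
        by (simp only: ennreal_plus ennreal_mult'')
      with * have "ennreal (u powr (Q - 1)) * ennreal_powr (?L \<rho>) Q \<le>
          ennreal (?c * real n / K\<^sup>2) * ennreal (u * X \<rho>) + ennreal ?c * ennreal (min 1 (A * u) / u)"
        by (simp only:)
      then show ?thesis unfolding u_def by (rule order_trans) (rule add_increasing2, auto)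
    qed
  qed
  define I where "I = (\<integral>\<^sup>+\<rho>\<in>{0<..<1}. (ennreal ((1 - \<rho>) powr (Q - 1)) * ennreal_powr (?L \<rho>) Q) \<partial>lborel)"
  have "I \<le> (\<integral>\<^sup>+\<rho>. ennreal (?c * real n / K\<^sup>2) * (ennreal ((1 - \<rho>) * (indicator {0<..<1} \<rho> * X \<rho>))) +
      ennreal ?c * (ennreal (min 1 (A * (1 - \<rho>)) / (1 - \<rho>)) * indicator {0<..<1} \<rho>)
      + ennreal (K powr Q * A) * indicator {1 - 1 / A..1} \<rho> \<partial>lborel)"
    unfolding I_def
  proof (rule nn_integral_mono)
    fix \<rho> :: real
    show "(ennreal ((1 - \<rho>) powr (Q - 1)) * ennreal_powr (?L \<rho>) Q) * indicator {0<..<1} \<rho> \<le>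
      ennreal (?c * real n / K\<^sup>2) * (ennreal ((1 - \<rho>) * (indicator {0<..<1} \<rho> * X \<rho>))) +
      ennreal ?c * (ennreal (min 1 (A * (1 - \<rho>)) / (1 - \<rho>)) * indicator {0<..<1} \<rho>)
      + ennreal (K powr Q * A) * indicator {1 - 1 / A..1} \<rho>"
      using pointwise[of \<rho>] by (cases "\<rho> \<in> {0<..<1}") auto
  qed
  also have "\<dots> = ennreal (?c * real n / K\<^sup>2) * (\<integral>\<^sup>+\<rho>. ennreal ((1 - \<rho>) * (indicator {0<..<1} \<rho> * X \<rho>)) \<partial>lborel) +
      ennreal ?c * (\<integral>\<^sup>+\<rho>\<in>{0<..<1}. ennreal (min 1 (A * (1 - \<rho>)) / (1 - \<rho>)) \<partial>lborel)
      + ennreal (K powr Q * A) * emeasure lborel {1 - 1 / A..1}"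
  proof -
    have [measurable]: "(\<lambda>\<rho>. ennreal ((1 - \<rho>) * (indicator {0<..<1} \<rho> * X \<rho>))) \<in> borel_measurable borel"
      using area(2) by measurable
    show ?thesis
      by (subst nn_integral_add, measurable, subst nn_integral_add, measurable)
        (simp add: nn_integral_cmult)
  qed
  also have "(\<integral>\<^sup>+\<rho>. ennreal ((1 - \<rho>) * (indicator {0<..<1} \<rho> * X \<rho>)) \<partial>lborel) =
      (\<integral>\<^sup>+\<rho>\<in>{0<..<1}. ennreal ((1 - \<rho>) * X \<rho>) \<partial>lborel)"
    by (intro nn_integral_cong) (auto split: split_indicator)
  also have "ennreal (?c * real n / K\<^sup>2) * (\<integral>\<^sup>+\<rho>\<in>{0<..<1}. ennreal ((1 - \<rho>) * X \<rho>) \<partial>lborel) +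
      ennreal ?c * (\<integral>\<^sup>+\<rho>\<in>{0<..<1}. ennreal (min 1 (A * (1 - \<rho>)) / (1 - \<rho>)) \<partial>lborel)
      + ennreal (K powr Q * A) * emeasure lborel {1 - 1 / A..1} \<le>
     ennreal (?c * real n / K\<^sup>2) * ennreal (K\<^sup>2) + ennreal ?c * ennreal (1 + 4 * real n) + ennreal (K powr Q * A) * ennreal (1 / A)"
    using area(1) order_trans[OF cutoff_integral_le[OF A(1)] ennreal_leI[of "1 + ln A" "1 + 4 * real n"]] A
    by (intro add_mono mult_left_mono) auto
  also have "\<dots> = ennreal (?c * real n / K\<^sup>2 * K\<^sup>2 + ?c * (1 + 4 * real n) + K powr Q * A * (1 / A))"
    using A by (simp only: ennreal_mult''[symmetric] ennreal_plus[symmetric] zero_le_power2 powr_ge_zero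
      add_nonneg_nonneg mult_nonneg_nonneg divide_nonneg_nonneg of_nat_0_le_iff zero_le_one zero_le_numeral order_trans[OF zero_le_one A(1)])
  also have "?c * real n / K\<^sup>2 * K\<^sup>2 + ?c * (1 + 4 * real n) + K powr Q * A * (1 / A) =
      K powr Q * (real n powr (- t) * (5 * real n + 1) + 1)"
    using K A by (simp add: algebra_simps)
  also have "ennreal \<dots> \<le> ennreal (K powr Q * (7 * real n powr (1 - t)))"
  proof -
    have "real n powr (- t) * real n = real n powr (1 - t)" using n by (simp add: powr_diff powr_minus field_simps)
    moreover have "real n powr (- t) \<le> real n powr (1 - t)" "1 \<le> real n powr (1 - t)"
      using n t by (auto intro: powr_mono ge_one_powr_ge_zero)
    moreover have "real n powr (- t) * (5 * real n + 1) = 5 * (real n powr (- t) * real n) + real n powr (- t)"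
      by (simp add: algebra_simps)
    ultimately have "real n powr (- t) * (5 * real n + 1) + 1 \<le> 7 * real n powr (1 - t)" by linarith
    then show ?thesis by (intro ennreal_leI mult_left_mono) auto
  qed
  finally have I: "I \<le> ennreal (K powr Q * (7 * real n powr (1 - t)))" .
  have "besov_seminorm (ennreal P) (ennreal Q) F = ennreal_powr I (1 / Q)"
    by (simp add: besov_seminorm_def PQ I_def)
  also have "\<dots> \<le> ennreal_powr (ennreal (K powr Q * (7 * real n powr (1 - t)))) (1 / Q)"
    using I Q by (intro ennreal_powr_mono) auto
  also have "\<dots> = ennreal (K * (7 powr (1 / Q) * real n powr (1 / Q - 1 / P)))"
  proof -
    have "(1 - t) * (1 / Q) = 1 / Q - 1 / P"
      using Q by (simp add: t_def diff_divide_distrib)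
    then show ?thesis using K Q by (simp add: powr_mult powr_powr)
  qed
  also have "\<dots> \<le> ennreal (7 * K * real n powr (1 / Q - 1 / P))"
  proof (rule ennreal_leI)
    have "7 powr (1 / Q) \<le> 7 powr (1::real)" using Q by (intro powr_mono) auto
    then have "K * (7 powr (1 / Q) * real n powr (1 / Q - 1 / P)) \<le> K * (7 * real n powr (1 / Q - 1 / P))"
      using K by (intro mult_left_mono mult_right_mono) auto
    then show "K * (7 powr (1 / Q) * real n powr (1 / Q - 1 / P)) \<le> 7 * K * real n powr (1 / Q - 1 / P)"
      by (simp add: mult_ac)
  qed
  finally show ?thesis .
qed

section \<open>The Blaschke product\<close>

text \<open>The identity \<open>|1 - s w|^2 - |s - w|^2 = (1 - s^2) (1 - |w|^2)\<close> gives the bound by \<open>1\<close>, and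
\<open>|1 - s w| \<ge> 1 - s\<close> gives the bound on the derivative.\<close>

lemma moebius_bounds:
  fixes s :: real and w :: complex
  assumes s: "0 \<le> s" "s < 1" and w: "norm w < 1"
  shows "1 - of_real s * w \<noteq> 0"
    and "norm ((of_real s - w) / (1 - of_real s * w)) \<le> 1"
    and "((\<lambda>w. (of_real s - w) / (1 - of_real s * w)) has_field_derivative
          - (1 - of_real (s\<^sup>2)) / (1 - of_real s * w)\<^sup>2) (at w)"
    and "norm (- (1 - complex_of_real (s\<^sup>2)) / (1 - of_real s * w)\<^sup>2) \<le> 2 / (1 - s)"
proof -
  have "norm (of_real s * w) \<le> s * 1" unfolding norm_mult using s w by (intro mult_mono) auto
  moreover have "1 - norm (of_real s * w) \<le> norm (1 - of_real s * w)"
    using norm_triangle_ineq2[of 1 "of_real s * w"] by simp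
  ultimately have d: "1 - s \<le> norm (1 - of_real s * w)" by linarith
  then show nz: "1 - of_real s * w \<noteq> 0" using s by auto
  have "(norm (1 - of_real s * w))\<^sup>2 - (norm (of_real s - w))\<^sup>2 = (1 - s\<^sup>2) * (1 - (norm w)\<^sup>2)"
    unfolding cmod_power2 by (simp add: power2_eq_square algebra_simps)
  moreover have "0 \<le> (1 - s\<^sup>2) * (1 - (norm w)\<^sup>2)"
    using s w by (intro mult_nonneg_nonneg) (auto simp: power_le_one)
  ultimately have "(norm (of_real s - w))\<^sup>2 \<le> (norm (1 - of_real s * w))\<^sup>2" by linarith
  then have "norm (of_real s - w) \<le> norm (1 - of_real s * w)" by (rule power2_le_imp_le) simp
  then show "norm ((of_real s - w) / (1 - of_real s * w)) \<le> 1"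
    using nz by (simp add: norm_divide)
  show "((\<lambda>w. (of_real s - w) / (1 - of_real s * w)) has_field_derivative
          - (1 - of_real (s\<^sup>2)) / (1 - of_real s * w)\<^sup>2) (at w)"
    using nz by (auto intro!: derivative_eq_intros simp: power2_eq_square field_simps)
  have "norm (- (1 - complex_of_real (s\<^sup>2)) / (1 - of_real s * w)\<^sup>2) = (1 - s\<^sup>2) / (norm (1 - of_real s * w))\<^sup>2"
  proof -
    have "norm (1 - complex_of_real (s\<^sup>2)) = norm (complex_of_real (1 - s\<^sup>2))" by simp
    also have "\<dots> = 1 - s\<^sup>2" unfolding norm_of_real using s by (simp add: power_le_one)
    finally show ?thesis by (simp only: norm_divide norm_power norm_minus_cancel)
  qed
  also have "\<dots> \<le> (1 - s\<^sup>2) / (1 - s)\<^sup>2"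
    using d s by (intro divide_left_mono power_mono mult_pos_pos zero_less_power) (auto simp: power_le_one)
  also have "\<dots> = (1 + s) / (1 - s)"
    using s by (simp add: power2_eq_square divide_simps) (simp add: algebra_simps)
  also have "\<dots> \<le> 2 / (1 - s)" using s by (intro divide_right_mono) auto
  finally show "norm (- (1 - complex_of_real (s\<^sup>2)) / (1 - of_real s * w)\<^sup>2) \<le> 2 / (1 - s)" .
qed

text \<open>Since every factor with \<open>M = 2^k\<close> is a Moebius transformation in \<open>z^M\<close>, all zeros of one block are
treated at once.\<close>

definition blaschke :: "nat \<Rightarrow> complex \<Rightarrow> complex" where
  "blaschke n z = (\<Prod>k=1..n. (of_real (1 - 1 / real n) - z ^ 2 ^ k) / (1 - of_real (1 - 1 / real n) * z ^ 2 ^ k))"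

text \<open>In the derivative of the product every summand has only one factor that is not bounded by \<open>1\<close>, and for
that factor \<open>1 / (1 - s) = n\<close> gives \<open>2 n 2^k\<close>.\<close>

lemma blaschke_bounds:
  assumes n: "n \<ge> 2"
  shows "blaschke n holomorphic_on ball 0 1"
    and "norm z < 1 \<Longrightarrow> norm (blaschke n z) \<le> 1"
    and "norm z < 1 \<Longrightarrow> norm (deriv (blaschke n) z) \<le> n * 2 ^ (n + 2)"
    and "blaschke n 0 = of_real ((1 - 1 / real n) ^ n)"
    and "vanishes_on_grid n (blaschke n)"
proof -
  define s where "s = 1 - 1 / real n"
  have s: "0 \<le> s" "s < 1" "2 / (1 - s) = 2 * real n" using n by (auto simp: s_def)
  define b where "b k z = (of_real s - z ^ 2 ^ k) / (1 - of_real s * z ^ 2 ^ k)" for k and z :: complex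
  define b' where "b' k z = - (1 - of_real (s\<^sup>2)) / (1 - of_real s * z ^ 2 ^ k)\<^sup>2 * (2 ^ k * z ^ (2 ^ k - 1))" for k and z :: complex
  have B: "blaschke n = (\<lambda>z. \<Prod>k=1..n. b k z)" by (simp add: blaschke_def b_def s_def fun_eq_iff)
  have pow: "norm (z ^ 2 ^ k) < 1" if "norm z < 1" for z :: complex and k
    using that by (simp add: norm_power power_less_one_iff)
  have b1: "norm (b k z) \<le> 1" if "norm z < 1" for k z
    unfolding b_def using moebius_bounds(2)[OF s(1,2) pow[OF that]] .
  have b': "(b k has_field_derivative b' k z) (at z)" if "norm z < 1" for k z
  proof -
    have "((\<lambda>z::complex. z ^ 2 ^ k) has_field_derivative (2 ^ k * z ^ (2 ^ k - 1))) (at z)"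
      by (auto intro!: derivative_eq_intros)
    from DERIV_chain2[OF moebius_bounds(3)[OF s(1,2) pow[OF that]] this] show ?thesis
      by (simp add: b_def[abs_def] b'_def)
  qed
  have b'_le: "norm (b' k z) \<le> 2 * real n * 2 ^ k" if "norm z < 1" for k z
  proof -
    have "norm (b' k z) \<le> 2 / (1 - s) * (2 ^ k * 1)"
      unfolding b'_def norm_mult using moebius_bounds(4)[OF s(1,2) pow[OF that, of k]] that s
      by (intro mult_mono) (auto simp: norm_power power_le_one)
    then show ?thesis unfolding s(3) by simp
  qed
  have D: "(blaschke n has_field_derivative (\<Sum>k=1..n. b' k z * (\<Prod>j\<in>{1..n}-{k}. b j z))) (at z)"
    if "norm z < 1" for z
    unfolding B using b'[OF that] by (intro has_field_derivative_prod) auto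
  then show "blaschke n holomorphic_on ball 0 1"
    by (intro holomorphic_onI) (auto simp: field_differentiable_def intro: has_field_derivative_at_within)
  show "norm (blaschke n z) \<le> 1" if "norm z < 1"
    unfolding B prod_norm[symmetric] using b1[OF that] by (intro prod_le_1 conjI norm_ge_zero)
  show "norm (deriv (blaschke n) z) \<le> n * 2 ^ (n + 2)" if z: "norm z < 1"
  proof -
    have "norm (deriv (blaschke n) z) = norm (\<Sum>k=1..n. b' k z * (\<Prod>j\<in>{1..n}-{k}. b j z))"
      using DERIV_imp_deriv[OF D[OF z]] by simp
    also have "\<dots> \<le> (\<Sum>k=1..n. 2 * real n * 2 ^ k)"
    proof (rule order_trans[OF norm_sum], rule sum_mono)
      fix k
      have "norm (\<Prod>j\<in>{1..n}-{k}. b j z) \<le> 1"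
        using b1[OF z] by (auto simp: prod_norm[symmetric] intro!: prod_le_1)
      then show "norm (b' k z * (\<Prod>j\<in>{1..n}-{k}. b j z)) \<le> 2 * real n * 2 ^ k"
        unfolding norm_mult using b'_le[OF z, of k] mult_mono[of "norm (b' k z)" "2 * real n * 2 ^ k" "norm (\<Prod>j\<in>{1..n}-{k}. b j z)" 1]
        by simp
    qed
    also have "\<dots> = 2 * real n * (\<Sum>k=1..n. 2 ^ k)" by (simp add: sum_distrib_left)
    also have "\<dots> \<le> 2 * real n * 2 ^ (n + 1)"
    proof (rule mult_left_mono)
      show "(\<Sum>k=1..n. 2 ^ k :: real) \<le> 2 ^ (n + 1)" by (induction n) auto
    qed simp
    finally show ?thesis by simp
  qed
  show "blaschke n 0 = of_real ((1 - 1 / real n) ^ n)"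
    by (simp add: blaschke_def power_0_left)
  show "vanishes_on_grid n (blaschke n)"
    unfolding vanishes_on_grid_def
  proof (intro ballI)
    fix k j assume k: "k \<in> {1..n}"
    have "(of_real (radius n k) * cis (2 * pi * real j / 2 ^ k)) ^ 2 ^ k =
       of_real (radius n k ^ 2 ^ k) * cis (2 ^ k * (2 * pi * real j / 2 ^ k))"
      by (simp only: power_mult_distrib Complex.DeMoivre of_real_power of_nat_power of_nat_numeral)
    also have "\<dots> = of_real s"
      using radius_power(3)[OF n, of k] cis_multiple_2pi[of "real j"] by (simp add: s_def mult.assoc)
    finally have "b k (of_real (radius n k) * cis (2 * pi * real j / 2 ^ k)) = 0"
      by (simp add: b_def)
    then show "blaschke n (of_real (radius n k) * cis (2 * pi * real j / 2 ^ k)) = 0"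
      unfolding B using k by (intro prod_zero) auto
  qed
qed

section \<open>The sequence\<close>

lemma radius_inj: "n \<ge> 2 \<Longrightarrow> radius n k = radius n l \<Longrightarrow> k = l"
proof -
  assume n: "n \<ge> 2" and eq: "radius n k = radius n l"
  have s: "0 < 1 - 1 / real n" "1 - 1 / real n < 1" using n by auto
  then have "ln (1 - 1 / real n) \<noteq> 0" by simp
  moreover have "ln (radius n k) = ln (radius n l)" using eq by simp
  ultimately have "2 powr (- real k) = (2::real) powr (- real l)"
    unfolding radius_def using s by (simp add: ln_powr)
  then show "k = l" by (simp add: powr_inj)
qed

lemma set_sigma_block:
  "set (sigma_block n k) = (\<lambda>j. of_real (radius n k) * cis (2 * pi * real j / 2 ^ k)) ` {1..2 ^ k}"
  by (simp add: sigma_block_def atLeastLessThanSuc_atLeastAtMost del: upt_Suc)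

lemma norm_sigma_block: "n \<ge> 2 \<Longrightarrow> z \<in> set (sigma_block n k) \<Longrightarrow> norm z = radius n k"
  using radius_power(1)[of n k] by (auto simp: set_sigma_block norm_mult)

lemma distinct_sigma_block:
  assumes n: "n \<ge> 2"
  shows "distinct (sigma_block n k)"
  unfolding sigma_block_def distinct_map
proof (intro conjI inj_onI)
  fix i j assume ij: "i \<in> set [1..<Suc (2 ^ k)]" "j \<in> set [1..<Suc (2 ^ k)]"
    and eq: "of_real (radius n k) * cis (2 * pi * real i / 2 ^ k) = of_real (radius n k) * cis (2 * pi * real j / 2 ^ k)"
  define m :: nat where "m = 2 ^ k"
  have "cis (2 * pi * real i / 2 ^ k) = cis (2 * pi * real j / 2 ^ k)"
    using eq radius_power(1)[OF n, of k] by simp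
  moreover have "cis (2 * pi * real l / 2 ^ k) = exp (2 * of_real pi * \<i> * of_nat l / of_nat m)" for l
    by (simp add: cis_conv_exp m_def mult_ac)
  moreover have "1 \<le> m" by (simp add: m_def)
  ultimately have cong: "i mod m = j mod m"
    using complex_root_unity_eq[of m i j] by metis
  have "1 \<le> i" "i \<le> m" "1 \<le> j" "j \<le> m" using ij by (auto simp: m_def)
  then show "i = j" using cong by (cases "i = m"; cases "j = m") auto
qed simp

text \<open>Different blocks lie on different circles, and within a block the arguments differ. Consequently no
multiplicities occur.\<close>

lemma distinct_sigma_star:
  assumes n: "n \<ge> 2"
  shows "distinct (sigma_star n)"
  unfolding sigma_star_def
proof (rule distinct_concat)
  have ne: "set (sigma_block n k) \<noteq> {}" for k by (simp add: set_sigma_block)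
  have disj: "k = l" if "z \<in> set (sigma_block n k)" "z \<in> set (sigma_block n l)" for k l z
    using norm_sigma_block[OF n that(1)] norm_sigma_block[OF n that(2)] by (intro radius_inj[OF n]) simp
  have "inj_on (sigma_block n) {1..<Suc n}"
  proof (rule inj_onI)
    fix k l assume eq: "sigma_block n k = sigma_block n l"
    define z where "z = hd (sigma_block n k)"
    have "z \<in> set (sigma_block n k)" using ne[of k] by (simp add: z_def)
    then show "k = l" using eq by (intro disj[of z k l]) simp_all
  qed
  then show "distinct (map (sigma_block n) [1..<Suc n])"
    by (simp add: distinct_map del: upt_Suc)
  show "distinct ys" if "ys \<in> set (map (sigma_block n) [1..<Suc n])" for ys
    using that distinct_sigma_block[OF n] by auto
  show "set ys \<inter> set zs = {}" if y: "ys \<in> set (map (sigma_block n) [1..<Suc n])"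
      "zs \<in> set (map (sigma_block n) [1..<Suc n])" "ys \<noteq> zs" for ys zs
  proof -
    obtain k l where "ys = sigma_block n k" "zs = sigma_block n l" using y by auto
    then show ?thesis using disj[of _ k l] y(3) by auto
  qed
qed

lemma set_sigma_star: "set (sigma_star n) = (\<Union>k\<in>{1..n}. set (sigma_block n k))"
  by (simp add: sigma_star_def atLeastLessThanSuc_atLeastAtMost del: upt_Suc)

lemma vanishes_on_sigma_star:
  assumes "n \<ge> 2"
  shows "vanishes_on f (sigma_star n) \<longleftrightarrow> vanishes_on_grid n f"
proof -
  have "count_list (sigma_star n) z = 1" if "z \<in> set (sigma_star n)" for z
    using distinct_sigma_star[OF assms] that count_mset[of "sigma_star n" z]
    unfolding distinct_count_atmost_1 by metis
  then have "vanishes_on f (sigma_star n) \<longleftrightarrow> (\<forall>z\<in>set (sigma_star n). f z = 0)"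
    by (auto simp: vanishes_on_def)
  then show ?thesis
    by (auto simp: vanishes_on_grid_def set_sigma_star set_sigma_block)
qed

lemma prod_norm_sigma_star:
  assumes n: "n \<ge> 2"
  shows "(\<Prod>i<(\<Sum>k=1..n. 2 ^ k). norm (sigma_star n ! i)) = (1 - 1 / real n) ^ n"
proof -
  have "(\<Prod>i<(\<Sum>k=1..n. 2 ^ k). norm (sigma_star n ! i)) = (\<Prod>z\<in>set (sigma_star n). norm z)"
    using bij_betw_nth[OF distinct_sigma_star[OF n] refl refl]
    by (intro prod.reindex_bij_betw) (simp only: length_sigma_star)
  also have "\<dots> = (\<Prod>k\<in>{1..n}. \<Prod>z\<in>set (sigma_block n k). norm z)"
    unfolding set_sigma_star
  proof (rule prod.UNION_disjoint)
    show "\<forall>k\<in>{1..n}. \<forall>l\<in>{1..n}. k \<noteq> l \<longrightarrow> set (sigma_block n k) \<inter> set (sigma_block n l) = {}"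
    proof (intro ballI impI)
      fix k l :: nat assume "k \<noteq> l"
      then have "radius n k \<noteq> radius n l" using radius_inj[OF n] by blast
      then show "set (sigma_block n k) \<inter> set (sigma_block n l) = {}"
        using norm_sigma_block[OF n, of _ k] norm_sigma_block[OF n, of _ l] by force
    qed
  qed auto
  also have "\<dots> = (\<Prod>k\<in>{1..n}. radius n k ^ 2 ^ k)"
  proof (rule prod.cong)
    fix k
    have "card (set (sigma_block n k)) = 2 ^ k"
      using distinct_card[OF distinct_sigma_block[OF n, of k]] by (simp add: sigma_block_def del: upt_Suc)
    then show "(\<Prod>z\<in>set (sigma_block n k). norm z) = radius n k ^ 2 ^ k"
      using norm_sigma_block[OF n] by simp
  qed simp
  also have "\<dots> = (1 - 1 / real n) ^ n" using radius_power(3)[OF n] by simp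
  finally show ?thesis .
qed

text \<open>\<open>1 / s = 1 + 1 / (n - 1) \<le> e^(2/n)\<close> because \<open>n - 1 \<ge> n/2\<close>.\<close>

lemma prod_bounds:
  assumes n: "n \<ge> 2"
  shows "exp (- 2) \<le> (1 - 1 / real n) ^ n" "(1 - 1 / real n) ^ n \<le> 1"
proof -
  have "1 / (1 - 1 / real n) = 1 + 1 / (real n - 1)" using n by (simp add: field_simps)
  also have "\<dots> \<le> exp (1 / (real n - 1))" by (rule exp_ge_add_one_self)
  also have "\<dots> \<le> exp (2 / real n)" using n by (simp add: field_simps)
  finally have "(1 / (1 - 1 / real n)) ^ n \<le> exp (2 / real n) ^ n"
    using n by (intro power_mono) auto
  also have "\<dots> = exp 2" using n by (simp flip: exp_of_nat_mult)
  finally have "1 / (1 - 1 / real n) ^ n \<le> exp 2" by (simp add: power_divide)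
  moreover have "0 < (1 - 1 / real n) ^ n" using n by simp
  ultimately show "exp (- 2) \<le> (1 - 1 / real n) ^ n"
    by (simp add: exp_minus field_simps)
  show "(1 - 1 / real n) ^ n \<le> 1" using n by (intro power_le_one) auto
qed

section \<open>Bounds for the capacity\<close>

text \<open>Here \<open>N = 2^(n+1) - 2\<close>. The second bound is given in the shape of an arithmetic mean since it serves to
compare \<open>ln n = 2 ln (sqrt n)\<close> with \<open>2 ln (ln N)\<close>; it needs the gain \<open>N \<ge> (3/2) 2^n\<close> for \<open>n = 2\<close>.\<close>

lemma sigma_star_length_bounds:
  fixes n :: nat
  assumes n: "n \<ge> 2"
  defines "N \<equiv> (\<Sum>k=1..n. 2 ^ k) :: nat"
  shows "ln (real N) \<le> 2 * real n" "(1 + real n) / 2 \<le> ln (real N)"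
proof -
  have "real N + 2 = 2 ^ (n + 1)" unfolding N_def by (induction n) auto
  then have N: "real N = 2 * 2 ^ n - 2" by simp
  have four: "(4::real) \<le> 2 ^ n" using power_increasing[of 2 n "2::real"] n by simp
  have "ln (real N) \<le> ln (2 ^ (n + 1))" using N four by (intro ln_mono) auto
  also have "\<dots> = real (n + 1) * ln 2" by (simp add: ln_realpow del: power_Suc)
  also have "\<dots> \<le> real (n + 1) * 1" using ln_le_minus_one[of 2] by (intro mult_left_mono) auto
  also have "\<dots> \<le> 2 * real n" using n by simp
  finally show "ln (real N) \<le> 2 * real n" .
  have "(1 + real n) / 2 \<le> 1 / 3 + real n * (2 / 3)" using n by simp
  also have "\<dots> \<le> ln (3 / 2) + real n * ln 2"
  proof (intro add_mono mult_left_mono)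
    have "ln (2 / 3 :: real) \<le> 2 / 3 - 1" by (rule ln_le_minus_one) simp
    then show "1 / 3 \<le> ln (3 / 2 :: real)" by (simp add: ln_div)
  qed (use ln2_ge_two_thirds in auto)
  also have "\<dots> = ln (3 / 2 * 2 ^ n)" by (subst ln_mult) (simp_all add: ln_realpow)
  also have "\<dots> \<le> ln (real N)" using N four by (intro ln_mono) auto
  finally show "(1 + real n) / 2 \<le> ln (real N)" .
qed

lemma besov_capacity_lower_bound:
  fixes p q :: ennreal
  assumes p: "1 \<le> p" and q: "1 \<le> q" and n: "n \<ge> 2"
  defines "a \<equiv> enn2real (1 / p)"
  defines "C \<equiv> (if a = 0 then 4 else 4 / a)"
  shows "ennreal (exp (- 2) * ((4 * real n) powr enn2real (1 / q) / (32 * C * growth a n))) \<le>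
    ennreal (\<Prod>i<(\<Sum>k=1..n. 2 ^ k). norm (sigma_star n ! i)) * besov_capacity p q (sigma_star n)"
proof -
  let ?X = "(4 * real n) powr enn2real (1 / q) / (32 * C * growth a n)"
  have "ennreal ?X \<le> besov_capacity p q (sigma_star n)"
    unfolding besov_capacity_def capacity_def
  proof (rule INF_greatest)
    fix f assume "f \<in> {f \<in> besov_space p q. f 0 = 1 \<and> vanishes_on f (sigma_star n)}"
    then have f: "f holomorphic_on ball 0 1" "f 0 = 1" "vanishes_on_grid n f"
      by (auto simp: besov_space_def vanishes_on_sigma_star[OF n])
    have "ennreal ?X \<le> besov_seminorm p q f"
      unfolding C_def a_def by (rule besov_seminorm_lower_bound[OF p q f(1,2) n f(3)])
    also have "\<dots> \<le> besov_norm p q f" by (simp add: besov_norm_def)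
    finally show "ennreal ?X \<le> besov_norm p q f" .
  qed
  then have "ennreal (exp (- 2)) * ennreal ?X \<le>
      ennreal (\<Prod>i<(\<Sum>k=1..n. 2 ^ k). norm (sigma_star n ! i)) * besov_capacity p q (sigma_star n)"
    unfolding prod_norm_sigma_star[OF n] by (intro mult_mono ennreal_leI prod_bounds[OF n]) auto
  then show ?thesis by (simp only: ennreal_mult'[OF exp_ge_zero])
qed

text \<open>The competitor is the Blaschke product divided by its value \<open>s^n\<close> at the origin. That factor is cancelled by
the product of the moduli.\<close>

lemma besov_capacity_upper_bound:
  fixes P Q :: real
  assumes Q: "1 \<le> Q" "Q \<le> P" and P: "2 \<le> P" and n: "n \<ge> 2"
  shows "ennreal (\<Prod>i<(\<Sum>k=1..n. 2 ^ k). norm (sigma_star n ! i)) *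
      besov_capacity (ennreal P) (ennreal Q) (sigma_star n) \<le> ennreal (8 * real n powr (1 / Q - 1 / P))"
proof -
  define d where "d = (1 - 1 / real n) ^ n"
  have d: "0 < d" "d \<le> 1" using prod_bounds(2)[OF n] n by (auto simp: d_def)
  define f where "f z = blaschke n z / of_real d" for z
  note B = blaschke_bounds[OF n]
  have f: "f holomorphic_on ball 0 1" unfolding f_def using B(1) d by (intro holomorphic_intros) auto
  have f0: "f 0 = 1" using d unfolding f_def B(4) d_def[symmetric] by simp
  have van: "vanishes_on f (sigma_star n)"
    unfolding vanishes_on_sigma_star[OF n] using B(5) by (simp add: vanishes_on_grid_def f_def)
  have exponent: "0 \<le> 1 / Q - 1 / P" using Q by (simp add: frac_le)
  have sem: "besov_seminorm (ennreal P) (ennreal Q) f \<le> ennreal (7 * (1 / d) * real n powr (1 / Q - 1 / P))"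
  proof (rule besov_seminorm_upper_bound[OF Q P _ _ f])
    show "norm (f z) \<le> 1 / d" if "norm z < 1" for z
      using B(2)[OF that] d by (simp add: f_def norm_divide divide_right_mono)
    show "1 \<le> real n * 2 ^ (n + 2)"
      using mult_mono[of 1 "real n" 1 "2 ^ (n + 2)"] n by (simp del: power_Suc)
    show "ln (real n * 2 ^ (n + 2)) \<le> 4 * real n"
    proof -
      have "ln (real n * 2 ^ (n + 2)) = ln (real n) + real (n + 2) * ln 2"
        using n by (simp add: ln_mult ln_realpow del: power_Suc)
      moreover have "ln (real n) \<le> real n - 1" using n by (intro ln_le_minus_one) auto
      moreover have "real (n + 2) * ln 2 \<le> real (n + 2) * 1"
        using ln_le_minus_one[of 2] by (intro mult_left_mono) auto
      moreover have "real (n + 2) * 1 = real n + 2" "2 \<le> real n" using n by simp_all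
      ultimately show ?thesis by linarith
    qed
    show "norm (deriv f z) \<le> 1 / d * (real n * 2 ^ (n + 2))" if "norm z < 1" for z
    proof -
      have "blaschke n field_differentiable at z"
        using B(1) that by (auto intro: holomorphic_on_imp_differentiable_at)
      then have "deriv f z = deriv (blaschke n) z / of_real d"
        unfolding f_def by (rule deriv_cdivide_right)
      then show ?thesis using B(3)[OF that] d by (simp add: norm_divide divide_right_mono)
    qed
  qed (use n d in auto)
  have norm: "besov_norm (ennreal P) (ennreal Q) f \<le> ennreal (1 + 7 * (1 / d) * real n powr (1 / Q - 1 / P))"
  proof -
    have "besov_norm (ennreal P) (ennreal Q) f \<le> ennreal 1 + ennreal (7 * (1 / d) * real n powr (1 / Q - 1 / P))"
      unfolding besov_norm_def f0 using sem by (intro add_mono) auto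
    also have "\<dots> = ennreal (1 + 7 * (1 / d) * real n powr (1 / Q - 1 / P))"
      using d by (intro ennreal_plus[symmetric]) auto
    finally show ?thesis .
  qed
  then have "besov_norm (ennreal P) (ennreal Q) f < \<infinity>"
    using ennreal_less_top le_less_trans unfolding infinity_ennreal_def by blast
  then have "besov_capacity (ennreal P) (ennreal Q) (sigma_star n) \<le> besov_norm (ennreal P) (ennreal Q) f"
    unfolding besov_capacity_def capacity_def using f f0 van
    by (intro INF_lower) (simp add: besov_space_def)
  with norm have "ennreal d * besov_capacity (ennreal P) (ennreal Q) (sigma_star n) \<le>
      ennreal d * ennreal (1 + 7 * (1 / d) * real n powr (1 / Q - 1 / P))"
    by (intro mult_left_mono) auto
  also have "\<dots> = ennreal (d * (1 + 7 * (1 / d) * real n powr (1 / Q - 1 / P)))"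
    using d by (intro ennreal_mult'[symmetric]) auto
  also have "\<dots> \<le> ennreal (8 * real n powr (1 / Q - 1 / P))"
  proof (rule ennreal_leI)
    have "1 \<le> real n powr (1 / Q - 1 / P)" using exponent n by (intro ge_one_powr_ge_zero) auto
    then show "d * (1 + 7 * (1 / d) * real n powr (1 / Q - 1 / P)) \<le> 8 * real n powr (1 / Q - 1 / P)"
      using d by (simp add: distrib_left)
  qed
  finally show ?thesis unfolding prod_norm_sigma_star[OF n] d_def .
qed

lemma powr_le_double:
  fixes x y t :: real
  assumes "0 \<le> x" "x \<le> 2 * y" "0 \<le> t" "t \<le> 1"
  shows "x powr t \<le> 2 * y powr t"
proof -
  have y: "0 \<le> y" using assms by linarith
  have "x powr t \<le> (2 * y) powr t" using assms by (intro powr_mono2) auto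
  also have "\<dots> = 2 powr t * y powr t" using y by (simp add: powr_mult)
  also have "\<dots> \<le> 2 powr 1 * y powr t" using assms by (intro mult_right_mono powr_mono) auto
  finally show ?thesis by simp
qed

theorem theorem4:
  fixes p q :: ennreal
  assumes "1 \<le> q" and "q \<le> p"
  shows
    "(\<exists>c::real. c > 0 \<and> (\<forall>n::nat. n \<ge> 2 \<longrightarrow>
       (let N = (\<Sum>k=1..n. 2 ^ k) :: nat; \<sigma> = sigma_star n in
         (p < \<infinity> \<longrightarrow>
            ennreal (\<Prod>i<N. norm (\<sigma> ! i)) * besov_capacity p q \<sigma>
              \<ge> ennreal (c * ln (real N) powr (enn2real (1 / q) - enn2real (1 / p)))) \<and>
         (p = \<infinity> \<longrightarrow>
            ennreal (\<Prod>i<N. norm (\<sigma> ! i)) * besov_capacity \<infinity> q \<sigma>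
              \<ge> ennreal (c * (ln (real N) powr enn2real (1 / q) / ln (ln (real N))))))))
     \<and>
     (p < \<infinity> \<and> 2 \<le> p \<longrightarrow>
       (\<exists>c C::real. 0 < c \<and> c \<le> C \<and> (\<forall>n::nat. n \<ge> 2 \<longrightarrow>
         (let N = (\<Sum>k=1..n. 2 ^ k) :: nat; \<sigma> = sigma_star n in
           ennreal (c * ln (real N) powr (enn2real (1 / q) - enn2real (1 / p)))
             \<le> ennreal (\<Prod>i<N. norm (\<sigma> ! i)) * besov_capacity p q \<sigma> \<and>
           ennreal (\<Prod>i<N. norm (\<sigma> ! i)) * besov_capacity p q \<sigma>
             \<le> ennreal (C * ln (real N) powr (enn2real (1 / q) - enn2real (1 / p)))))))"
proof -
  have p: "1 \<le> p" using assms by (rule order_trans)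
  from p show ?thesis
  proof (cases rule: exponent_cases)
    case infinite
    have "ennreal (exp (- 2) / 256 * (ln (real N) powr enn2real (1 / q) / ln (ln (real N)))) \<le>
        ennreal (\<Prod>i<N. norm (sigma_star n ! i)) * besov_capacity \<infinity> q (sigma_star n)"
      if n: "n \<ge> 2" and N: "N = (\<Sum>k=1..n. 2 ^ k)" for n N :: nat
    proof -
      note lnN = sigma_star_length_bounds[OF n, folded N]
      have "ln (real n) / 2 = ln (sqrt (real n))" using n by (simp add: ln_sqrt)
      also have "\<dots> \<le> ln (ln (real N))"
      proof (rule ln_mono)
        have "sqrt (1 * real n) \<le> (1 + real n) / 2" by (rule arith_geo_mean_sqrt) auto
        with lnN(2) show "sqrt (real n) \<le> ln (real N)" by simp
        show "0 < sqrt (real n)" using n by simp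
      qed
      finally have lnln: "ln (real n) / 2 \<le> ln (ln (real N))" .
      have lnn: "0 < ln (real n)" using n by simp
      have "ln (real N) powr enn2real (1 / q) / ln (ln (real N)) \<le> (4 * real n) powr enn2real (1 / q) / (ln (real n) / 2)"
        using lnN n lnln lnn by (intro frac_le powr_mono2) auto
      then have "exp (- 2) / 256 * (ln (real N) powr enn2real (1 / q) / ln (ln (real N))) \<le>
          exp (- 2) / 256 * ((4 * real n) powr enn2real (1 / q) / (ln (real n) / 2))"
        by (rule mult_left_mono) simp
      also have "\<dots> = exp (- 2) * ((4 * real n) powr enn2real (1 / q) / (32 * 4 * growth 0 n))"
        by (simp add: growth_def)
      finally have "ennreal (exp (- 2) / 256 * (ln (real N) powr enn2real (1 / q) / ln (ln (real N)))) \<le>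
          ennreal (exp (- 2) * ((4 * real n) powr enn2real (1 / q) / (32 * 4 * growth 0 n)))"
        by (rule ennreal_leI)
      also have "\<dots> \<le> ennreal (\<Prod>i<N. norm (sigma_star n ! i)) * besov_capacity \<infinity> q (sigma_star n)"
        using besov_capacity_lower_bound[OF p assms(1) n] infinite unfolding N by simp
      finally show ?thesis .
    qed
    then show ?thesis using infinite
      by (intro conjI exI[of _ "exp (- 2) / 256"]) (auto simp: Let_def)
  next
    case (finite P)
    have "q \<noteq> \<infinity>" using assms(2) finite(1) by (auto simp: top_unique)
    with assms(1) obtain Q where Q: "q = ennreal Q" "1 \<le> Q" "enn2real (1 / q) = 1 / Q"
      by (cases rule: exponent_cases) auto
    have QP: "Q \<le> P" using assms(2) finite Q by simp
    define t where "t = 1 / Q - 1 / P"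
    have t: "0 \<le> t" "t \<le> 1"
    proof -
      show "0 \<le> t" unfolding t_def using QP Q by (simp add: frac_le)
      have "1 / Q \<le> 1" "0 \<le> 1 / P" using Q finite by auto
      then show "t \<le> 1" unfolding t_def by linarith
    qed
    define c where "c = exp (- 2) / (256 * P)"
    have c: "0 < c" using finite by (simp add: c_def)
    have lower: "ennreal (c * ln (real N) powr t) \<le>
        ennreal (\<Prod>i<N. norm (sigma_star n ! i)) * besov_capacity p q (sigma_star n)"
      if n: "n \<ge> 2" and N: "N = (\<Sum>k=1..n. 2 ^ k)" for n N :: nat
    proof -
      note lnN = sigma_star_length_bounds[OF n, folded N]
      have "ln (real N) powr t \<le> 2 * real n powr t"
        using lnN t n by (intro powr_le_double) auto
      also have "\<dots> = 2 * (real n powr (1 / Q) / real n powr (1 / P))"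
        by (simp add: t_def powr_diff)
      also have "\<dots> \<le> 2 * ((4 * real n) powr (1 / Q) / real n powr (1 / P))"
        using Q n by (intro mult_left_mono divide_right_mono powr_mono2) auto
      finally have "c * ln (real N) powr t \<le> c * (2 * ((4 * real n) powr (1 / Q) / real n powr (1 / P)))"
        using c by (intro mult_left_mono) auto
      also have "\<dots> = exp (- 2) * ((4 * real n) powr (1 / Q) / (32 * (4 / (1 / P)) * growth (1 / P) n))"
        using finite by (simp add: c_def growth_def)
      finally have "ennreal (c * ln (real N) powr t) \<le>
          ennreal (exp (- 2) * ((4 * real n) powr (1 / Q) / (32 * (4 / (1 / P)) * growth (1 / P) n)))"
        by (rule ennreal_leI)
      also have "\<dots> \<le> ennreal (\<Prod>i<N. norm (sigma_star n ! i)) * besov_capacity p q (sigma_star n)"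
        using besov_capacity_lower_bound[OF p assms(1) n] finite(2) unfolding N finite(4) Q(3) by simp
      finally show ?thesis .
    qed
    have upper: "ennreal (\<Prod>i<N. norm (sigma_star n ! i)) * besov_capacity p q (sigma_star n) \<le>
        ennreal (max c 16 * ln (real N) powr t)"
      if n: "n \<ge> 2" and N: "N = (\<Sum>k=1..n. 2 ^ k)" and two: "2 \<le> p" for n N :: nat
    proof -
      note lnN = sigma_star_length_bounds[OF n, folded N]
      have P: "2 \<le> P" using two finite(1,2) by (simp flip: ennreal_numeral)
      have "real n powr t \<le> 2 * ln (real N) powr t"
        using lnN t n by (intro powr_le_double) auto
      then have "8 * real n powr t \<le> 16 * ln (real N) powr t" by simp
      also have "\<dots> \<le> max c 16 * ln (real N) powr t" by (intro mult_right_mono) auto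
      finally have "ennreal (8 * real n powr t) \<le> ennreal (max c 16 * ln (real N) powr t)"
        by (rule ennreal_leI)
      with besov_capacity_upper_bound[OF Q(2) QP P n, folded N t_def] show ?thesis
        unfolding finite(1) Q(1) by (rule order_trans)
    qed
    have eq: "enn2real (1 / q) - enn2real (1 / p) = t" by (simp add: t_def finite(4) Q(3))
    show ?thesis unfolding eq Let_def
      using lower upper c finite(1) by (intro conjI impI exI[of _ c] exI[of _ "max c 16"]) auto
  qed
qed

end
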